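(* The pair $\{1+\eta,\ \eta+1\}$ is the greatest pair under computable embedding among the pairs that are $tc$-equivalent to $\{\omega,\omega^\star\}$: that is, $\{1+\eta,\eta+1\}\equiv_{tc}\{\omega,\omega^\star\}$, and for every pair of non-isomorphic structures $\mathcal{A},\mathcal{B}$ with $\{\mathcal{A},\mathcal{B}\}\equiv_{tc}\{\omega,\omega^\star\}$ we have $\{\mathcal{A},\mathcal{B}\}\leq_c\{1+\eta,\eta+1\}$.
   Context: All structures are in computable languages with domains contained in $\omega$; a class of structures is identified with the class of all isomorphic copies (with domain $\subseteq\omega$) of its members; $\{\mathcal{A},\mathcal{B}\}$ denotes the class of all copies of $\mathcal{A}$ and $\mathcal{B}$. An enumeration operator $\Gamma$ is a c.e. set of pairs $(\alpha,\varphi)$ with $\alpha$ a finite set of basic sentences of the input language with constants from $\omega$ and $\varphi$ a basic sentence of the output language with constants from $\omega$; $\Gamma(\mathcal{S})=\{\varphi:(\alpha,\varphi)\in\Gamma,\ \alpha\subseteq D(\mathcal{S})\}$ where $D(\mathcal{S})$ is the atomic diagram. $\Gamma$ is a computable embedding of $\mathcal{K}_0$ into $\mathcal{K}_1$ if for every $\mathcal{A}\in\mathcal{K}_0$, $\Gamma(\mathcal{A})$ is the atomic diagram of a structure in $\mathcal{K}_1$, and $\mathcal{A}\cong\mathcal{B}$ iff $\Gamma(\mathcal{A})\cong\Gamma(\mathcal{B})$ for $\mathcal{A},\mathcal{B}\in\mathcal{K}_0$. For non-isomorphic $\mathcal{A},\mathcal{B}$, $\{\mathcal{A},\mathcal{B}\}\leq_c\{\mathcal{C},\mathcal{D}\}$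 means there is such a $\Gamma$ between the corresponding classes with $\Gamma(\mathcal{A})\cong\mathcal{C}$, $\Gamma(\mathcal{B})\cong\mathcal{D}$. A Turing computable embedding is defined similarly using a Turing operator $\Phi$ with oracle $D(\mathcal{A})$ computing the characteristic function of the atomic diagram of $\Phi(\mathcal{A})$; $\leq_{tc}$ is the corresponding reducibility and $\equiv_{tc}$ means reducibility in both directions. $\omega$ is the order type of the natural numbers, $\omega^\star$ its reverse, $\eta$ the order type of the rationals, $1+\eta$ is $\eta$ with a least element added and $\eta+1$ is $\eta$ with a greatest element added. *)

theory Defs
  imports Complex_Main "HOL-Library.Countable" "HOL-Library.Nat_Bijection"
begin

section \<open>Computability relative to an oracle\<close>

text \<open>
  The partial mu-recursive functions relative to an oracle, in the unary formulation: several
  arguments are packed by the Cantor pairing function \<^const>\<open>prod_encode\<close>.  The programs are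
  finite objects that do not mention the oracle, so one program is one Turing operator.
\<close>

datatype prog =
    Zero
  | Succ
  | Left
  | Right
  | Oracle
  | Pair prog prog
  | Comp prog prog
  | Prec prog prog
  | Mu prog

text \<open>
  \<open>run X p n\<close> is the value of \<open>p\<close> on input \<open>n\<close> with oracle \<open>X\<close>; \<^const>\<open>None\<close> means divergence.
  In \<open>Mu p\<close> all values before the first zero have to converge.
\<close>

primrec run :: "nat set \<Rightarrow> prog \<Rightarrow> nat \<Rightarrow> nat option" where
  "run X Zero n = Some 0"
| "run X Succ n = Some (Suc n)"
| "run X Left n = Some (fst (prod_decode n))"
| "run X Right n = Some (snd (prod_decode n))"
| "run X Oracle n = Some (if n \<in> X then 1 else 0)"
| "run X (Pair p q) n =
     Option.bind (run X p n) (\<lambda>a. Option.bind (run X q n) (\<lambda>b. Some (prod_encode (a, b))))"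
| "run X (Comp p q) n = Option.bind (run X q n) (run X p)"
| "run X (Prec p q) n =
     (case prod_decode n of (a, k) \<Rightarrow>
        rec_nat (run X p a)
          (\<lambda>m r. Option.bind r (\<lambda>v. run X q (prod_encode (a, prod_encode (m, v))))) k)"
| "run X (Mu p) n =
     (if \<exists>k. run X p (prod_encode (n, k)) = Some 0 \<and>
             (\<forall>j<k. \<exists>v. run X p (prod_encode (n, j)) = Some (Suc v))
      then Some (LEAST k. run X p (prod_encode (n, k)) = Some 0)
      else None)"

definition computable_fun :: "(nat \<Rightarrow> nat) \<Rightarrow> bool" where
  "computable_fun f \<longleftrightarrow> (\<exists>p. \<forall>n. run {} p n = Some (f n))"

definition ce_set :: "nat set \<Rightarrow> bool" where
  "ce_set W \<longleftrightarrow> (\<exists>p. W = {n. run {} p n \<noteq> None})"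

definition computes_char_fun :: "prog \<Rightarrow> nat set \<Rightarrow> nat set \<Rightarrow> bool" where
  "computes_char_fun p X Y \<longleftrightarrow> (\<forall>n. run X p n = Some (if n \<in> Y then 1 else 0))"


section \<open>Languages and basic sentences\<close>

text \<open>
  The relation and function symbols of a language are the numbers on which the respective arity map
  is defined.  Constant symbols are function symbols of arity 0.
\<close>

record language =
  rel_arity :: "nat \<Rightarrow> nat option"
  fun_arity :: "nat \<Rightarrow> nat option"

definition code_arity :: "nat option \<Rightarrow> nat" where
  "code_arity k = (case k of None \<Rightarrow> 0 | Some m \<Rightarrow> Suc m)"

definition computable_language :: "language \<Rightarrow> bool" where
  "computable_language L \<longleftrightarrow>
     computable_fun (\<lambda>s. code_arity (rel_arity L s)) \<and>
     computable_fun (\<lambda>s. code_arity (fun_arity L s))"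

text \<open>
  Basic sentences are atomic sentences (equations included) and their negations.  The type
  parameter is the type of the additional constants, which is always \<^typ>\<open>nat\<close> below;
  \<open>set_basic \<phi>\<close> is the set of those constants that occur in \<open>\<phi>\<close>.
\<close>

datatype 'a tm = Elem 'a | App nat "'a tm list"

datatype 'a atom = Eq "'a tm" "'a tm" | Rel nat "'a tm list"

datatype 'a basic = Pos "'a atom" | Neg "'a atom"

fun tm_in :: "language \<Rightarrow> 'a tm \<Rightarrow> bool" where
  "tm_in L (Elem a) \<longleftrightarrow> True"
| "tm_in L (App f ts) \<longleftrightarrow> fun_arity L f = Some (length ts) \<and> (\<forall>t\<in>set ts. tm_in L t)"

fun atom_in :: "language \<Rightarrow> 'a atom \<Rightarrow> bool" where
  "atom_in L (Eq s t) \<longleftrightarrow> tm_in L s \<and> tm_in L t"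
| "atom_in L (Rel R ts) \<longleftrightarrow> rel_arity L R = Some (length ts) \<and> (\<forall>t\<in>set ts. tm_in L t)"

fun basic_in :: "language \<Rightarrow> 'a basic \<Rightarrow> bool" where
  "basic_in L (Pos a) \<longleftrightarrow> atom_in L a"
| "basic_in L (Neg a) \<longleftrightarrow> atom_in L a"

primrec code_tm :: "nat tm \<Rightarrow> nat" where
  "code_tm (Elem a) = prod_encode (0, a)"
| "code_tm (App f ts) = prod_encode (Suc f, list_encode (map code_tm ts))"

primrec code_atom :: "nat atom \<Rightarrow> nat" where
  "code_atom (Eq s t) = prod_encode (0, prod_encode (code_tm s, code_tm t))"
| "code_atom (Rel R ts) = prod_encode (Suc R, list_encode (map code_tm ts))"

primrec code_basic :: "nat basic \<Rightarrow> nat" where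
  "code_basic (Pos a) = prod_encode (0, code_atom a)"
| "code_basic (Neg a) = prod_encode (1, code_atom a)"


section \<open>Structures\<close>

text \<open>
  Interpretations are total functions; their values on symbols outside the language, on tuples of
  the wrong length and outside the universe are irrelevant.
\<close>

record struct =
  universe :: "nat set"
  rel_interp :: "nat \<Rightarrow> nat list \<Rightarrow> bool"
  fun_interp :: "nat \<Rightarrow> nat list \<Rightarrow> nat"

definition is_structure :: "language \<Rightarrow> struct \<Rightarrow> bool" where
  "is_structure L A \<longleftrightarrow> universe A \<noteq> {} \<and>
     (\<forall>f xs. fun_arity L f = Some (length xs) \<longrightarrow> set xs \<subseteq> universe A \<longrightarrow>
        fun_interp A f xs \<in> universe A)"

definition isomorphic :: "language \<Rightarrow> struct \<Rightarrow> struct \<Rightarrow> bool" where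
  "isomorphic L A B \<longleftrightarrow> (\<exists>h. bij_betw h (universe A) (universe B) \<and>
     (\<forall>R xs. rel_arity L R = Some (length xs) \<longrightarrow> set xs \<subseteq> universe A \<longrightarrow>
        (rel_interp A R xs \<longleftrightarrow> rel_interp B R (map h xs))) \<and>
     (\<forall>f xs. fun_arity L f = Some (length xs) \<longrightarrow> set xs \<subseteq> universe A \<longrightarrow>
        h (fun_interp A f xs) = fun_interp B f (map h xs)))"

primrec tm_val :: "struct \<Rightarrow> nat tm \<Rightarrow> nat" where
  "tm_val A (Elem a) = a"
| "tm_val A (App f ts) = fun_interp A f (map (tm_val A) ts)"

primrec atom_true :: "struct \<Rightarrow> nat atom \<Rightarrow> bool" where
  "atom_true A (Eq s t) \<longleftrightarrow> tm_val A s = tm_val A t"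
| "atom_true A (Rel R ts) \<longleftrightarrow> rel_interp A R (map (tm_val A) ts)"

primrec basic_true :: "struct \<Rightarrow> nat basic \<Rightarrow> bool" where
  "basic_true A (Pos a) \<longleftrightarrow> atom_true A a"
| "basic_true A (Neg a) \<longleftrightarrow> \<not> atom_true A a"

definition diagram :: "language \<Rightarrow> struct \<Rightarrow> nat basic set" where
  "diagram L A = {\<phi>. basic_in L \<phi> \<and> set_basic \<phi> \<subseteq> universe A \<and> basic_true A \<phi>}"

definition pair_class :: "language \<Rightarrow> struct \<Rightarrow> struct \<Rightarrow> struct set" where
  "pair_class L A B = {S. is_structure L S \<and> (isomorphic L S A \<or> isomorphic L S B)}"


section \<open>Computable embeddings\<close>

type_synonym operator = "(nat basic set \<times> nat basic) set"

definition code_axiom :: "nat basic set \<times> nat basic \<Rightarrow> nat" where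
  "code_axiom = (\<lambda>(\<alpha>, \<phi>). prod_encode (set_encode (code_basic ` \<alpha>), code_basic \<phi>))"

definition enumeration_operator :: "language \<Rightarrow> language \<Rightarrow> operator \<Rightarrow> bool" where
  "enumeration_operator L L' \<Gamma> \<longleftrightarrow>
     (\<forall>(\<alpha>, \<phi>)\<in>\<Gamma>. finite \<alpha> \<and> (\<forall>\<psi>\<in>\<alpha>. basic_in L \<psi>) \<and> basic_in L' \<phi>) \<and>
     ce_set (code_axiom ` \<Gamma>)"

definition apply_operator :: "operator \<Rightarrow> language \<Rightarrow> struct \<Rightarrow> nat basic set" where
  "apply_operator \<Gamma> L S = {\<phi>. \<exists>\<alpha>. (\<alpha>, \<phi>) \<in> \<Gamma> \<and> \<alpha> \<subseteq> diagram L S}"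

text \<open>
  A map between classes of structures that is given through atomic diagrams is presented by the
  relation ``the image of \<open>S\<close> is the diagram of \<open>T\<close>''.  The diagram determines the universe and the
  interpretation of the symbols, so \<open>T\<close> is unique up to the irrelevant values.
\<close>

definition embedding ::
  "language \<Rightarrow> struct set \<Rightarrow> language \<Rightarrow> struct set \<Rightarrow> (struct \<Rightarrow> struct \<Rightarrow> bool) \<Rightarrow> bool" where
  "embedding L K L' K' F \<longleftrightarrow>
     (\<forall>S\<in>K. \<exists>T\<in>K'. F S T) \<and>
     (\<forall>S1\<in>K. \<forall>S2\<in>K. \<forall>T1\<in>K'. \<forall>T2\<in>K'. F S1 T1 \<longrightarrow> F S2 T2 \<longrightarrow>
        (isomorphic L S1 S2 \<longleftrightarrow> isomorphic L' T1 T2))"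

definition enum_image :: "operator \<Rightarrow> language \<Rightarrow> language \<Rightarrow> struct \<Rightarrow> struct \<Rightarrow> bool" where
  "enum_image \<Gamma> L L' S T \<longleftrightarrow> apply_operator \<Gamma> L S = diagram L' T"

definition turing_image :: "prog \<Rightarrow> language \<Rightarrow> language \<Rightarrow> struct \<Rightarrow> struct \<Rightarrow> bool" where
  "turing_image \<Phi> L L' S T \<longleftrightarrow>
     computes_char_fun \<Phi> (code_basic ` diagram L S) (code_basic ` diagram L' T)"

definition computable_embedding ::
  "language \<Rightarrow> struct set \<Rightarrow> language \<Rightarrow> struct set \<Rightarrow> operator \<Rightarrow> bool" where
  "computable_embedding L K L' K' \<Gamma> \<longleftrightarrow>
     enumeration_operator L L' \<Gamma> \<and> embedding L K L' K' (enum_image \<Gamma> L L')"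

definition turing_embedding ::
  "language \<Rightarrow> struct set \<Rightarrow> language \<Rightarrow> struct set \<Rightarrow> prog \<Rightarrow> bool" where
  "turing_embedding L K L' K' \<Phi> \<longleftrightarrow> embedding L K L' K' (turing_image \<Phi> L L')"

text \<open>
  The pairs are ordered: \<open>A\<close> has to be mapped to a copy of \<open>C\<close>, and \<open>B\<close> to a copy of \<open>D\<close>.
\<close>

definition c_reducible ::
  "language \<Rightarrow> struct \<Rightarrow> struct \<Rightarrow> language \<Rightarrow> struct \<Rightarrow> struct \<Rightarrow> bool" where
  "c_reducible L A B L' C D \<longleftrightarrow>
     (\<exists>\<Gamma>. computable_embedding L (pair_class L A B) L' (pair_class L' C D) \<Gamma> \<and>
        (\<exists>T. is_structure L' T \<and> isomorphic L' T C \<and> enum_image \<Gamma> L L' A T) \<and>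
        (\<exists>T. is_structure L' T \<and> isomorphic L' T D \<and> enum_image \<Gamma> L L' B T))"

definition tc_reducible ::
  "language \<Rightarrow> struct \<Rightarrow> struct \<Rightarrow> language \<Rightarrow> struct \<Rightarrow> struct \<Rightarrow> bool" where
  "tc_reducible L A B L' C D \<longleftrightarrow>
     (\<exists>\<Phi>. turing_embedding L (pair_class L A B) L' (pair_class L' C D) \<Phi> \<and>
        (\<exists>T. is_structure L' T \<and> isomorphic L' T C \<and> turing_image \<Phi> L L' A T) \<and>
        (\<exists>T. is_structure L' T \<and> isomorphic L' T D \<and> turing_image \<Phi> L L' B T))"

definition tc_equivalent ::
  "language \<Rightarrow> struct \<Rightarrow> struct \<Rightarrow> language \<Rightarrow> struct \<Rightarrow> struct \<Rightarrow> bool" where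
  "tc_equivalent L A B L' C D \<longleftrightarrow> tc_reducible L A B L' C D \<and> tc_reducible L' C D L A B"


section \<open>The linear orders\<close>

text \<open>Linear orders are structures for one binary relation symbol, the strict order.\<close>

definition order_lang :: language where
  "order_lang = \<lparr>rel_arity = [0 \<mapsto> 2], fun_arity = Map.empty\<rparr>"

definition order_struct :: "('a::countable \<Rightarrow> 'a \<Rightarrow> bool) \<Rightarrow> struct" where
  "order_struct r =
     \<lparr>universe = range (to_nat :: 'a \<Rightarrow> nat),
      rel_interp = (\<lambda>R xs. R = 0 \<and> (\<exists>a b. xs = [to_nat a, to_nat b] \<and> r a b)),
      fun_interp = (\<lambda>f xs. 0)\<rparr>"

text \<open>The sum of two orders, the first one being placed below the second one.\<close>

fun sum_less :: "('a \<Rightarrow> 'a \<Rightarrow> bool) \<Rightarrow> ('b \<Rightarrow> 'b \<Rightarrow> bool) \<Rightarrow> 'a + 'b \<Rightarrow> 'a + 'b \<Rightarrow> bool" where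
  "sum_less r s (Inl a) (Inl a') \<longleftrightarrow> r a a'"
| "sum_less r s (Inl a) (Inr b') \<longleftrightarrow> True"
| "sum_less r s (Inr b) (Inl a') \<longleftrightarrow> False"
| "sum_less r s (Inr b) (Inr b') \<longleftrightarrow> s b b'"

definition one_less :: "unit \<Rightarrow> unit \<Rightarrow> bool" where
  "one_less x y \<longleftrightarrow> False"

definition eta_less :: "rat \<Rightarrow> rat \<Rightarrow> bool" where
  "eta_less p q \<longleftrightarrow> p < q"

definition omega :: struct where
  "omega = order_struct (\<lambda>m n::nat. m < n)"

definition omega_star :: struct where
  "omega_star = order_struct (\<lambda>m n::nat. n < m)"

definition one_plus_eta :: struct where
  "one_plus_eta = order_struct (sum_less one_less eta_less)"

definition eta_plus_one :: struct where
  "eta_plus_one = order_struct (sum_less eta_less one_less)"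

lemma is_structure_order_struct: "is_structure order_lang (order_struct r)"
  by (simp add: is_structure_def order_lang_def order_struct_def)

lemma isomorphic_order_struct_iff:
  fixes r :: "'a::countable \<Rightarrow> 'a \<Rightarrow> bool" and s :: "'b::countable \<Rightarrow> 'b \<Rightarrow> bool"
  shows "isomorphic order_lang (order_struct r) (order_struct s) \<longleftrightarrow>
    (\<exists>h. bij h \<and> (\<forall>x y. r x y \<longleftrightarrow> s (h x) (h y)))"
proof
  assume "isomorphic order_lang (order_struct r) (order_struct s)"
  then obtain g where g: "bij_betw g (range (to_nat :: 'a \<Rightarrow> nat)) (range (to_nat :: 'b \<Rightarrow> nat))"
    and rel: "\<And>xs. length xs = 2 \<Longrightarrow> set xs \<subseteq> range (to_nat :: 'a \<Rightarrow> nat) \<Longrightarrow>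
      (\<exists>a b. xs = [to_nat a, to_nat b] \<and> r a b) \<longleftrightarrow> (\<exists>a b. map g xs = [to_nat a, to_nat b] \<and> s a b)"
    unfolding isomorphic_def order_lang_def order_struct_def by (auto split: if_splits)
  define h :: "'a \<Rightarrow> 'b" where "h = (\<lambda>x. from_nat (g (to_nat x)))"
  have gh: "g (to_nat x) = to_nat (h x)" for x
  proof -
    have "g (to_nat x) \<in> range (to_nat :: 'b \<Rightarrow> nat)"
      using bij_betwE[OF g] by blast
    then show ?thesis by (auto simp: h_def)
  qed
  have "bij h"
  proof (rule bijI)
    show "inj h"
    proof (rule injI)
      fix x y assume "h x = h y"
      then have "g (to_nat x) = g (to_nat y)" by (simp add: gh)
      then have "to_nat x = to_nat y"
        using bij_betw_imp_inj_on[OF g] by (auto dest: inj_onD)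
      then show "x = y" by simp
    qed
    have "\<exists>x. y = h x" for y :: 'b
    proof -
      have "to_nat y \<in> g ` range (to_nat :: 'a \<Rightarrow> nat)"
        using g by (simp add: bij_betw_def)
      then show ?thesis by (auto simp: gh)
    qed
    then show "surj h" by (simp add: surj_def)
  qed
  moreover have "r x y \<longleftrightarrow> s (h x) (h y)" for x y
    using rel[of "[to_nat x, to_nat y]"] by (simp add: gh)
  ultimately show "\<exists>h. bij h \<and> (\<forall>x y. r x y \<longleftrightarrow> s (h x) (h y))" by blast
next
  assume "\<exists>h. bij h \<and> (\<forall>x y. r x y \<longleftrightarrow> s (h x) (h y))"
  then obtain h :: "'a \<Rightarrow> 'b" where h: "bij h" "\<And>x y. r x y \<longleftrightarrow> s (h x) (h y)" by blast
  define g :: "nat \<Rightarrow> nat" where "g = (\<lambda>n. to_nat (h (from_nat n :: 'a)))"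
  have gh: "g (to_nat x) = to_nat (h x)" for x :: 'a by (simp add: g_def)
  have "bij_betw g (range (to_nat :: 'a \<Rightarrow> nat)) (range (to_nat :: 'b \<Rightarrow> nat))"
    unfolding bij_betw_def
  proof
    show "inj_on g (range (to_nat :: 'a \<Rightarrow> nat))"
      using h(1) by (auto simp: inj_on_def gh bij_def)
    show "g ` range (to_nat :: 'a \<Rightarrow> nat) = range (to_nat :: 'b \<Rightarrow> nat)"
    proof -
      have "g ` range (to_nat :: 'a \<Rightarrow> nat) = to_nat ` range h"
        by (simp add: image_image gh)
      then show ?thesis using h(1) by (simp add: bij_def)
    qed
  qed
  moreover have "(\<exists>a b. xs = [to_nat a, to_nat b] \<and> r a b) \<longleftrightarrow>
      (\<exists>a b. map g xs = [to_nat a, to_nat b] \<and> s a b)"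
    if len: "length xs = 2" and sub: "set xs \<subseteq> range (to_nat :: 'a \<Rightarrow> nat)" for xs
  proof -
    obtain a b :: 'a where "xs = [to_nat a, to_nat b]"
      using len sub by (auto simp: numeral_2_eq_2 length_Suc_conv)
    then show ?thesis by (simp add: gh h(2))
  qed
  ultimately show "isomorphic order_lang (order_struct r) (order_struct s)"
    unfolding isomorphic_def order_lang_def order_struct_def
    by (intro exI[of _ g]) (auto split: if_splits)
qed

end

theory Submission
  imports Defs
begin

text \<open>
  Let \<open>\<Phi>\<close> be a Turing operator that reduces \<open>{A, B}\<close> to \<open>{\<omega>, \<omega>\<^sup>\<star>}\<close>.  A Turing operator can use the
  fact that a number is missing from the universe of its input, an enumeration operator cannot;
  so \<open>\<Phi>\<close> is run not on the given structure \<open>S\<close> but on copies of \<open>S\<close> that are approximated by finite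
  conditions.  A candidate is a condition that forces an element into the image and claims that it
  is the least one; it is refuted by an extension that forces a smaller element.  Candidates and
  refutations can be enumerated from the diagram of \<open>S\<close>.  If \<open>S\<close> is a copy of \<open>A\<close>, then some candidate
  is never refuted, since otherwise a generic copy of \<open>S\<close> would be sent to an order without a least
  element, while all candidates for a greatest element are refuted; for \<open>B\<close> it is the other way
  round.  Finally there is a linear order, growing with the enumeration, which has a least element
  if and only if some candidate is never refuted.  One such order for least elements, followed by
  the reverse of one for greatest elements, with rational half-lines in place of the points, is a
  copy of \<open>1 + \<eta>\<close> or \<open>\<eta> + 1\<close>, respectively.
\<close>

section \<open>Recursive functions and decidable predicates\<close>

text \<open>Enumeration operators are monotone: a longer piece of the diagram can add elements to
  the image but never remove one. That a candidate survives is a negative fact, so it cannot be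
  output; it has to show in the order type reached in the limit. Hence the order relation is fixed
  in advance on all numbers, only the universe grows, and a refutation acts by admitting points
  below those that trusted the refuted candidate. The half-lines [0, \<infinity>) of rationals
  absorb all other differences: a sum of copies of 1 + \<eta> along a non-empty countable linear
  order is 1 + \<eta> if that order has a least element and \<eta> if not, and 1 + \<eta> + \<eta> =
  1 + \<eta>, \<eta> + \<eta> + 1 = \<eta> + 1. The same sums reduce \<omega> and its reverse to the
  dense pair. Of \<omega> the argument uses that it has a least and no greatest element. Conversely,
  a copy of 1 + \<eta> is thinned out to \<omega> by keeping the numbers that set a new maximum or
  minimum.\<close>

definition recursive :: "(nat set \<Rightarrow> nat \<Rightarrow> nat) \<Rightarrow> bool" where
  "recursive f \<longleftrightarrow> (\<exists>p. \<forall>X n. run X p n = Some (f X n))"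

definition decidable :: "(nat set \<Rightarrow> nat \<Rightarrow> bool) \<Rightarrow> bool" where
  "decidable P \<longleftrightarrow> recursive (\<lambda>X n. if P X n then 1 else 0)"

definition p1 :: "nat \<Rightarrow> nat" where "p1 n = fst (prod_decode n)"
definition p2 :: "nat \<Rightarrow> nat" where "p2 n = snd (prod_decode n)"

lemma p1_encode [simp]: "p1 (prod_encode (a, b)) = a"
  and p2_encode [simp]: "p2 (prod_encode (a, b)) = b"
  and encode_p1_p2 [simp]: "prod_encode (p1 n, p2 n) = n"
  by (simp_all add: p1_def p2_def)

lemma p1_le: "p1 n \<le> n" and p2_le: "p2 n \<le> n"
  by (metis encode_p1_p2 le_prod_encode_1) (metis encode_p1_p2 le_prod_encode_2)

named_theorems recursive_intros

text \<open>
  Bound variables are packed into the single argument \<open>n\<close> with the projections \<^const>\<open>p1\<close> and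
  \<^const>\<open>p2\<close>, so that recursiveness is syntax-directed.
\<close>

lemma recursive_id [recursive_intros]: "recursive (\<lambda>X n. n)"
  unfolding recursive_def
  by (rule exI[of _ "Pair Left Right"]) simp

lemma recursive_const [recursive_intros]: "recursive (\<lambda>X n. c)"
proof (induction c)
  case 0
  show ?case unfolding recursive_def by (rule exI[of _ Zero]) simp
next
  case (Suc c)
  then obtain p where "\<forall>X n. run X p n = Some c" by (auto simp: recursive_def)
  then show ?case unfolding recursive_def by (intro exI[of _ "Comp Succ p"]) simp
qed

lemma recursive_comp:
  assumes "recursive f" "recursive g"
  shows "recursive (\<lambda>X n. f X (g X n))"
proof -
  from assms obtain p q where "\<forall>X n. run X p n = Some (f X n)" "\<forall>X n. run X q n = Some (g X n)"
    by (auto simp: recursive_def)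
  then show ?thesis unfolding recursive_def by (intro exI[of _ "Comp p q"]) simp
qed

lemma recursive_pair [recursive_intros]:
  assumes "recursive f" "recursive g"
  shows "recursive (\<lambda>X n. prod_encode (f X n, g X n))"
proof -
  from assms obtain p q where "\<forall>X n. run X p n = Some (f X n)" "\<forall>X n. run X q n = Some (g X n)"
    by (auto simp: recursive_def)
  then show ?thesis unfolding recursive_def by (intro exI[of _ "Pair p q"]) simp
qed

lemma recursive_Suc [recursive_intros]:
  assumes "recursive f" shows "recursive (\<lambda>X n. Suc (f X n))"
proof -
  have "recursive (\<lambda>X n. Suc n)" unfolding recursive_def by (rule exI[of _ Succ]) simp
  then show ?thesis using assms by (rule recursive_comp)
qed

lemma recursive_p1 [recursive_intros]:
  assumes "recursive f" shows "recursive (\<lambda>X n. p1 (f X n))"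
proof -
  have "recursive (\<lambda>X n. p1 n)" unfolding recursive_def by (rule exI[of _ Left]) (simp add: p1_def)
  then show ?thesis using assms by (rule recursive_comp)
qed

lemma recursive_p2 [recursive_intros]:
  assumes "recursive f" shows "recursive (\<lambda>X n. p2 (f X n))"
proof -
  have "recursive (\<lambda>X n. p2 n)" unfolding recursive_def by (rule exI[of _ Right]) (simp add: p2_def)
  then show ?thesis using assms by (rule recursive_comp)
qed

text \<open>A function of two arguments is given in packed form; replacing \<open>p1 n\<close> and
  \<open>p2 n\<close> by arbitrary recursive arguments lets locally defined functions take part in
  the syntax-directed proofs.\<close>

lemma recursive_comp2:
  assumes "recursive (\<lambda>X n. f X (p1 n) (p2 n))" "recursive a" "recursive b"
  shows "recursive (\<lambda>X n. f X (a X n) (b X n))"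
  using recursive_comp[OF assms(1) recursive_pair[OF assms(2,3)]] by simp

lemma recursive_comp3:
  assumes "recursive (\<lambda>X n. f X (p1 n) (p1 (p2 n)) (p2 (p2 n)))" "recursive a" "recursive b" "recursive c"
  shows "recursive (\<lambda>X n. f X (a X n) (b X n) (c X n))"
  using recursive_comp[OF assms(1) recursive_pair[OF assms(2) recursive_pair[OF assms(3,4)]]] by simp

lemma decidable_comp:
  assumes "decidable P" "recursive g"
  shows "decidable (\<lambda>X n. P X (g X n))"
  using assms unfolding decidable_def by (rule recursive_comp)

lemma decidable_comp2:
  assumes "decidable (\<lambda>X n. P X (p1 n) (p2 n))" "recursive a" "recursive b"
  shows "decidable (\<lambda>X n. P X (a X n) (b X n))"
  using assms unfolding decidable_def by (rule recursive_comp2)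

text \<open>The layout (parameter, (counter, value)) is the one in which \<open>Prec\<close> calls
  its step program. The parameter is the whole input \<open>n\<close>, so base and step may depend
  on all variables packed into it.\<close>

lemma recursive_rec_nat [recursive_intros]:
  assumes "recursive f" "recursive (\<lambda>X n. g X (p1 n) (p1 (p2 n)) (p2 (p2 n)))" "recursive k"
  shows "recursive (\<lambda>X n. rec_nat (f X n) (g X n) (k X n))"
proof -
  from assms(1) obtain p where p: "\<And>X n. run X p n = Some (f X n)" by (auto simp: recursive_def)
  from assms(2) obtain q where q: "\<And>X n. run X q n = Some (g X (p1 n) (p1 (p2 n)) (p2 (p2 n)))"
    by (auto simp: recursive_def)
  have "rec_nat (run X p a)
          (\<lambda>m r. Option.bind r (\<lambda>v. run X q (prod_encode (a, prod_encode (m, v))))) j =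
        Some (rec_nat (f X a) (g X a) j)" for X a j
    by (induction j) (simp_all add: p q)
  then have "recursive (\<lambda>X n. rec_nat (f X (p1 n)) (g X (p1 n)) (p2 n))"
    unfolding recursive_def
    by (intro exI[of _ "Prec p q"]) (simp add: p1_def p2_def split_beta)
  then show ?thesis using recursive_id assms(3) by (rule recursive_comp2)
qed

lemma recursive_pred [recursive_intros]:
  assumes "recursive f" shows "recursive (\<lambda>X n. f X n - Suc 0)"
proof -
  have "rec_nat 0 (\<lambda>m v. m) k = k - Suc 0" for k by (cases k) simp_all
  moreover have "recursive (\<lambda>X n. rec_nat 0 (\<lambda>m v. m) (f X n))"
    by (intro recursive_intros assms)
  ultimately show ?thesis by simp
qed

lemma recursive_diff [recursive_intros]:
  assumes "recursive f" "recursive g" shows "recursive (\<lambda>X n. f X n - g X n)"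
proof -
  have "rec_nat a (\<lambda>m v. v - Suc 0) k = a - k" for a k by (induction k) simp_all
  moreover have "recursive (\<lambda>X n. rec_nat (f X n) (\<lambda>m v. v - Suc 0) (g X n))"
    by (intro recursive_intros assms)
  ultimately show ?thesis by simp
qed

lemma recursive_add [recursive_intros]:
  assumes "recursive f" "recursive g" shows "recursive (\<lambda>X n. f X n + g X n)"
proof -
  have "rec_nat a (\<lambda>m v. Suc v) k = a + k" for a k by (induction k) simp_all
  moreover have "recursive (\<lambda>X n. rec_nat (f X n) (\<lambda>m v. Suc v) (g X n))"
    by (intro recursive_intros assms)
  ultimately show ?thesis by simp
qed

lemma recursive_mult [recursive_intros]:
  assumes "recursive f" "recursive g" shows "recursive (\<lambda>X n. f X n * g X n)"
proof -
  have "rec_nat 0 (\<lambda>m v. v + a) k = a * k" for a k :: nat by (induction k) simp_all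
  moreover have "recursive (\<lambda>X n. rec_nat 0 (\<lambda>m v. v + f X n) (g X n))"
    by (intro recursive_intros assms recursive_comp[OF assms(1)])
  ultimately show ?thesis by simp
qed

lemma recursive_if [recursive_intros]:
  assumes "decidable P" "recursive f" "recursive g"
  shows "recursive (\<lambda>X n. if P X n then f X n else g X n)"
proof -
  \<comment> \<open>Case distinction by arithmetic: both branches are computed, which is harmless
    because all functions here are total.\<close>
  have "recursive (\<lambda>X n. (if P X n then 1 else 0) * f X n + (1 - (if P X n then 1 else 0)) * g X n)"
    using assms(1) unfolding decidable_def by (intro recursive_intros assms(2,3)) simp_all
  then show ?thesis by (rule back_subst[of recursive]) (auto intro!: ext)
qed

lemma decidable_eq_0: "recursive f \<Longrightarrow> decidable (\<lambda>X n. f X n = 0)"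
proof -
  assume "recursive f"
  then have "recursive (\<lambda>X n. 1 - f X n)" by (intro recursive_intros)
  then show ?thesis unfolding decidable_def by (rule back_subst[of recursive]) (auto intro!: ext)
qed

lemma decidable_not [recursive_intros]:
  assumes "decidable P" shows "decidable (\<lambda>X n. \<not> P X n)"
proof -
  have "recursive (\<lambda>X n. if P X n then 0 else 1)"
    by (intro recursive_intros assms)
  then show ?thesis unfolding decidable_def by (rule back_subst[of recursive]) (auto intro!: ext)
qed

lemma decidable_le [recursive_intros]:
  "recursive f \<Longrightarrow> recursive g \<Longrightarrow> decidable (\<lambda>X n. f X n \<le> g X n)"
  using decidable_eq_0[OF recursive_diff, of f g] by simp

lemma decidable_less [recursive_intros]:
  "recursive f \<Longrightarrow> recursive g \<Longrightarrow> decidable (\<lambda>X n. f X n < g X n)"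
  using decidable_not[OF decidable_le, of g f] by (simp add: not_le)

lemma decidable_conj [recursive_intros]:
  assumes "decidable P" "decidable Q" shows "decidable (\<lambda>X n. P X n \<and> Q X n)"
proof -
  have "recursive (\<lambda>X n. if P X n then (if Q X n then 1 else 0) else 0)"
    by (intro recursive_intros assms)
  then show ?thesis unfolding decidable_def by (rule back_subst[of recursive]) (auto intro!: ext)
qed

lemma decidable_disj [recursive_intros]:
  assumes "decidable P" "decidable Q" shows "decidable (\<lambda>X n. P X n \<or> Q X n)"
proof -
  have "recursive (\<lambda>X n. if P X n then 1 else (if Q X n then 1 else 0))"
    by (intro recursive_intros assms)
  then show ?thesis unfolding decidable_def by (rule back_subst[of recursive]) (auto intro!: ext)
qed

lemma decidable_imp [recursive_intros]:
  assumes "decidable P" "decidable Q" shows "decidable (\<lambda>X n. P X n \<longrightarrow> Q X n)"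
  using decidable_disj[OF decidable_not[OF assms(1)] assms(2)] by (simp only: imp_conv_disj)

lemma decidable_if [recursive_intros]:
  assumes "decidable P" "decidable Q" "decidable R"
  shows "decidable (\<lambda>X n. if P X n then Q X n else R X n)"
proof -
  have "decidable (\<lambda>X n. (P X n \<longrightarrow> Q X n) \<and> (\<not> P X n \<longrightarrow> R X n))"
    by (intro recursive_intros assms)
  then show ?thesis by (rule back_subst[of decidable]) (auto intro!: ext)
qed

lemma decidable_eq [recursive_intros]:
  assumes "recursive f" "recursive g" shows "decidable (\<lambda>X n. f X n = g X n)"
proof -
  have "decidable (\<lambda>X n. f X n \<le> g X n \<and> g X n \<le> f X n)"
    by (intro recursive_intros assms)
  then show ?thesis by (rule back_subst[of decidable]) (auto intro!: ext)
qed

lemma decidable_oracle [recursive_intros]: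
  assumes "recursive f" shows "decidable (\<lambda>X n. f X n \<in> X)"
proof -
  have "recursive (\<lambda>X n. if n \<in> X then 1 else 0)"
    unfolding recursive_def by (rule exI[of _ Oracle]) simp
  then have "decidable (\<lambda>X n. n \<in> X)" unfolding decidable_def .
  then show ?thesis using assms by (rule decidable_comp)
qed

lemma decidable_all_less [recursive_intros]:
  assumes "decidable (\<lambda>X n. P X (p1 n) (p2 n))" "recursive b"
  shows "decidable (\<lambda>X n. \<forall>k<b X n. P X n k)"
proof -
  have *: "rec_nat 1 (\<lambda>k v. if P X n k then v else 0) m = (if \<forall>k<m. P X n k then 1 else 0)"
    for X n m
  proof (induction m)
    case 0
    show ?case by simp
  next
    case (Suc m)
    then show ?case using less_Suc_eq by auto
  qed
  have "recursive (\<lambda>X n. rec_nat 1 (\<lambda>k v. if P X n k then v else 0) (b X n))"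
    by (intro recursive_intros assms decidable_comp2[OF assms(1)])
  then show ?thesis unfolding * decidable_def .
qed

lemma decidable_ex_less [recursive_intros]:
  assumes "decidable (\<lambda>X n. P X (p1 n) (p2 n))" "recursive b"
  shows "decidable (\<lambda>X n. \<exists>k<b X n. P X n k)"
proof -
  have "decidable (\<lambda>X n. \<not> (\<forall>k<b X n. \<not> P X n k))"
    by (intro recursive_intros assms)
  then show ?thesis by simp
qed

lemma decidable_ex_le [recursive_intros]:
  assumes "decidable (\<lambda>X n. P X (p1 n) (p2 n))" "recursive b"
  shows "decidable (\<lambda>X n. \<exists>k\<le>b X n. P X n k)"
  using decidable_ex_less[OF assms(1) recursive_Suc[OF assms(2)]] by (simp add: less_Suc_eq_le)

text \<open>\<open>m\<close> lies in \<open>set_decode e\<close> iff \<open>e div 2 ^ m\<close> is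
  odd. Parity flips at each successor, and the half of \<open>Suc k\<close> is the half of
  \<open>k\<close> plus the parity of \<open>k\<close>, so every ingredient is a primitive
  recursion.\<close>

lemma decidable_set_decode [recursive_intros]:
  assumes "recursive f" "recursive g"
  shows "decidable (\<lambda>X n. f X n \<in> set_decode (g X n))"
proof -
  have mod2: "rec_nat 0 (\<lambda>m v. 1 - v) k = k mod 2" for k :: nat
    by (induction k) (simp_all, presburger)
  have div2: "rec_nat 0 (\<lambda>m v. v + rec_nat 0 (\<lambda>m v. 1 - v) m) k = k div 2" for k :: nat
    unfolding mod2 by (induction k) (simp_all, presburger)
  have shift: "rec_nat e (\<lambda>m v. rec_nat 0 (\<lambda>m v. v + rec_nat 0 (\<lambda>m v. 1 - v) m) v) k = e div 2 ^ k"
    for e k :: nat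
    unfolding div2 by (induction k) (simp_all add: div_mult2_eq[symmetric] mult.commute)
  have "decidable (\<lambda>X n. rec_nat 0 (\<lambda>m v. 1 - v)
      (rec_nat (g X n) (\<lambda>m v. rec_nat 0 (\<lambda>m v. v + rec_nat 0 (\<lambda>m v. 1 - v) m) v) (f X n)) = (1::nat))"
    by (intro recursive_intros assms)
  then show ?thesis unfolding shift unfolding mod2 by (simp add: set_decode_def odd_iff_mod_2_eq_one)
qed

text \<open>The set is the domain of an unbounded search; the searched program returns 0 exactly at
  witnesses, since \<open>Mu\<close> looks for a zero.\<close>

lemma recursive_ce_set:
  assumes "decidable (\<lambda>X n. P (p1 n) (p2 n))"
  shows "ce_set {n. \<exists>k. P n k}"
proof -
  have "recursive (\<lambda>X n. if P (p1 n) (p2 n) then 0 else 1)"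
    by (intro recursive_intros assms)
  then obtain p where p: "\<And>X n. run X p n = Some (if P (p1 n) (p2 n) then 0 else 1)"
    by (auto simp: recursive_def)
  have conv: "run {} p (prod_encode (n, k)) = Some 0 \<longleftrightarrow> P n k"
    "(\<exists>v. run {} p (prod_encode (n, k)) = Some (Suc v)) \<longleftrightarrow> \<not> P n k" for n k
    by (simp_all add: p)
  have "(\<exists>k. P n k \<and> (\<forall>j<k. \<not> P n j)) \<longleftrightarrow> (\<exists>k. P n k)" for n
    by (metis exists_least_iff)
  then have "{n. \<exists>k. P n k} = {n. run {} (Mu p) n \<noteq> None}"
    by (simp add: conv)
  then show ?thesis unfolding ce_set_def by blast
qed

text \<open>A computation with the empty oracle is imitated under any oracle by putting
  \<open>Zero\<close> in place of \<open>Oracle\<close>.\<close>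

lemma computable_fun_recursive:
  assumes "computable_fun f" "recursive g"
  shows "recursive (\<lambda>X n. f (g X n))"
proof -
  obtain p where p: "\<And>n. run {} p n = Some (f n)"
    using assms(1) by (auto simp: computable_fun_def)
  have "\<exists>q. \<forall>X n. run X q n = run {} p n" for p
  proof (induction p)
    case Oracle
    show ?case by (rule exI[of _ Zero]) simp
  next
    case (Pair p q)
    then obtain p' q' where "\<And>X n. run X p' n = run {} p n" "\<And>X n. run X q' n = run {} q n" by blast
    then show ?case by (intro exI[of _ "Pair p' q'"]) simp
  next
    case (Comp p q)
    then obtain p' q' where "\<And>X. run X p' = run {} p" "\<And>X n. run X q' n = run {} q n"
      by (meson ext)
    then show ?case by (intro exI[of _ "Comp p' q'"]) simp
  next
    case (Prec p q)
    then obtain p' q' where "\<And>X n. run X p' n = run {} p n" "\<And>X n. run X q' n = run {} q n" by blast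
    then show ?case by (intro exI[of _ "Prec p' q'"]) simp
  next
    case (Mu p)
    then obtain p' where "\<And>X n. run X p' n = run {} p n" by blast
    then show ?case by (intro exI[of _ "Mu p'"]) simp
  qed (metis run.simps(1) run.simps(2) run.simps(3) run.simps(4))+
  then have "recursive (\<lambda>X n. f n)" unfolding recursive_def by (metis p)
  then show ?thesis using assms(2) by (rule recursive_comp)
qed

subsection \<open>Recursion on codes of lists and terms\<close>

text \<open>Fits codes of lists of terms: \<open>Suc n\<close> is a non-empty list with head
  \<open>p1 n\<close> and tail \<open>p2 n\<close>, and \<open>p2 (p1 n)\<close> is the argument
  list if the head is an application. Terms and lists are thereby handled by one recursion. If the
  head is an element, the first recursive value is taken at that element, where it has no meaning,
  and \<open>k\<close> has to ignore it.\<close>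

function tree_rec :: "nat \<Rightarrow> (nat \<Rightarrow> nat \<Rightarrow> nat \<Rightarrow> nat) \<Rightarrow> nat \<Rightarrow> nat" where
  "tree_rec c k 0 = c"
| "tree_rec c k (Suc n) = k n (tree_rec c k (p2 (p1 n))) (tree_rec c k (p2 n))"
  by pat_completeness auto
termination
  by (relation "measure (\<lambda>(c, k, n). n)")
    (auto simp: less_Suc_eq_le intro: order_trans[OF p2_le p1_le] p2_le)

text \<open>Course-of-values recursion: the list of all earlier values is carried along.\<close>

lemma recursive_tree_rec [recursive_intros]:
  assumes c: "recursive c"
    and k: "recursive (\<lambda>X n. k X (p1 n) (p1 (p2 n)) (p1 (p2 (p2 n))) (p2 (p2 (p2 n))))"
    and g: "recursive g"
  shows "recursive (\<lambda>X n. tree_rec (c X n) (k X n) (g X n))"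
proof -
  \<comment> \<open>The history is stored newest first: among the values up to \<open>m\<close>, the
    one at \<open>i\<close> lies \<open>m - i\<close> places deep. The predecessor undoes the
    \<open>Suc\<close> of a list code.\<close>
  define look where "look h m i = p1 (rec_nat h (\<lambda>_ v. p2 (v - Suc 0)) (m - i) - Suc 0)" for h m i
  define hist where "hist X n = rec_nat (Suc (prod_encode (c X n, 0)))
      (\<lambda>m h. Suc (prod_encode (k X n m (look h m (p2 (p1 m))) (look h m (p2 m)), h)))" for X n
  have look_hist: "look (hist X n m) m i = p1 (hist X n i - Suc 0)" if "i \<le> m" for X n m i
  proof -
    have "rec_nat (hist X n m) (\<lambda>_ v. p2 (v - Suc 0)) j = hist X n (m - j)" if "j \<le> m" for j
      using that
    proof (induction j)
      case (Suc j)
      then have "m - j = Suc (m - Suc j)" by simp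
      then have "p2 (hist X n (m - j) - Suc 0) = hist X n (m - Suc j)" by (simp add: hist_def)
      then show ?case using Suc by simp
    qed simp
    then show ?thesis using that by (simp add: look_def)
  qed
  have hist: "p1 (hist X n m - Suc 0) = tree_rec (c X n) (k X n) m" for X n m
  proof (induction m rule: less_induct)
    case (less m)
    show ?case
    proof (cases m)
      case 0
      then show ?thesis by (simp add: hist_def)
    next
      case (Suc j)
      have j: "p2 (p1 j) \<le> j" "p2 j \<le> j" by (auto intro: order_trans[OF p2_le p1_le] p2_le)
      have "p1 (hist X n m - Suc 0) = k X n j (look (hist X n j) j (p2 (p1 j))) (look (hist X n j) j (p2 j))"
        by (simp add: Suc hist_def)
      also have "\<dots> = tree_rec (c X n) (k X n) m"
        using j by (simp add: look_hist less Suc)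
      finally show ?thesis .
    qed
  qed
  have look: "recursive (\<lambda>X n. look (h X n) (m X n) (i X n))"
    if "recursive h" "recursive m" "recursive i" for h m i
    unfolding look_def by (intro recursive_intros that)
  have k': "recursive (\<lambda>X n. k X (n1 X n) (n2 X n) (n3 X n) (n4 X n))"
    if "recursive n1" "recursive n2" "recursive n3" "recursive n4" for n1 n2 n3 n4
    using recursive_comp[OF k recursive_pair[OF that(1) recursive_pair[OF that(2) recursive_pair[OF that(3,4)]]]]
    by simp
  have "recursive (\<lambda>X n. p1 (hist X n (g X n) - Suc 0))"
    unfolding hist_def
    by (intro recursive_intros look recursive_comp[OF c] g k')
  then show ?thesis unfolding hist .
qed

section \<open>Order types\<close>

definition linear_on :: "'a set \<Rightarrow> ('a \<Rightarrow> 'a \<Rightarrow> bool) \<Rightarrow> bool" where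
  "linear_on W r \<longleftrightarrow> (\<forall>x\<in>W. \<not> r x x) \<and>
     (\<forall>x\<in>W. \<forall>y\<in>W. \<forall>z\<in>W. r x y \<longrightarrow> r y z \<longrightarrow> r x z) \<and>
     (\<forall>x\<in>W. \<forall>y\<in>W. x \<noteq> y \<longrightarrow> r x y \<or> r y x)"

definition order_iso :: "'a set \<Rightarrow> ('a \<Rightarrow> 'a \<Rightarrow> bool) \<Rightarrow> 'b set \<Rightarrow> ('b \<Rightarrow> 'b \<Rightarrow> bool) \<Rightarrow> bool" where
  "order_iso W r V s \<longleftrightarrow> (\<exists>h. bij_betw h W V \<and> (\<forall>x\<in>W. \<forall>y\<in>W. r x y \<longleftrightarrow> s (h x) (h y)))"

definition has_least :: "'a set \<Rightarrow> ('a \<Rightarrow> 'a \<Rightarrow> bool) \<Rightarrow> bool" where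
  "has_least W r \<longleftrightarrow> (\<exists>m\<in>W. \<forall>x\<in>W. x \<noteq> m \<longrightarrow> r m x)"

definition unbounded :: "'a set \<Rightarrow> ('a \<Rightarrow> 'a \<Rightarrow> bool) \<Rightarrow> bool" where
  "unbounded W r \<longleftrightarrow> (\<forall>x\<in>W. \<exists>y\<in>W. r x y)"

definition dense_on :: "'a set \<Rightarrow> ('a \<Rightarrow> 'a \<Rightarrow> bool) \<Rightarrow> bool" where
  "dense_on W r \<longleftrightarrow> (\<forall>x\<in>W. \<forall>y\<in>W. r x y \<longrightarrow> (\<exists>z\<in>W. r x z \<and> r z y))"

text \<open>Characterises \<omega> intrinsically; the reverse of \<omega> is expressed by applying
  the predicate to the converse relation.\<close>

definition type_omega :: "'a set \<Rightarrow> ('a \<Rightarrow> 'a \<Rightarrow> bool) \<Rightarrow> bool" where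
  "type_omega W r \<longleftrightarrow> linear_on W r \<and> infinite W \<and> (\<forall>x\<in>W. finite {y\<in>W. r y x})"

text \<open>Cantor's characterisation of 1 + \<eta>, with countability left to the type of the
  carrier. As \<eta> is its own reverse, \<eta> + 1 is the same predicate for the converse
  relation.\<close>

definition type_1eta :: "'a set \<Rightarrow> ('a \<Rightarrow> 'a \<Rightarrow> bool) \<Rightarrow> bool" where
  "type_1eta W r \<longleftrightarrow> linear_on W r \<and> dense_on W r \<and> has_least W r \<and> unbounded W r"

lemma linear_onD:
  assumes "linear_on W r"
  shows "x \<in> W \<Longrightarrow> \<not> r x x"
    and "r x y \<Longrightarrow> r y z \<Longrightarrow> x \<in> W \<Longrightarrow> y \<in> W \<Longrightarrow> z \<in> W \<Longrightarrow> r x z"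
    and "x \<noteq> y \<Longrightarrow> x \<in> W \<Longrightarrow> y \<in> W \<Longrightarrow> r x y \<or> r y x"
    and "r x y \<Longrightarrow> x \<in> W \<Longrightarrow> y \<in> W \<Longrightarrow> \<not> r y x"
  using assms unfolding linear_on_def by blast+

lemma linear_on_conversep [simp]: "linear_on W r\<inverse>\<inverse> \<longleftrightarrow> linear_on W r"
  unfolding linear_on_def by (simp; blast)

lemma order_iso_conversep: "order_iso W r\<inverse>\<inverse> V s\<inverse>\<inverse> \<longleftrightarrow> order_iso W r V s"
  unfolding order_iso_def by (simp; blast)

lemma order_iso_sym: "order_iso W r V s \<Longrightarrow> order_iso V s W r"
  unfolding order_iso_def
proof (elim exE conjE)
  fix h assume h: "bij_betw h W V" "\<forall>x\<in>W. \<forall>y\<in>W. r x y \<longleftrightarrow> s (h x) (h y)"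
  have inv: "bij_betw (inv_into W h) V W" by (rule bij_betw_inv_into[OF h(1)])
  show "\<exists>h. bij_betw h V W \<and> (\<forall>x\<in>V. \<forall>y\<in>V. s x y \<longleftrightarrow> r (h x) (h y))"
    using h inv bij_betwE[OF inv]
    by (intro exI[of _ "inv_into W h"]) (simp add: bij_betw_inv_into_right)
qed

lemma order_iso_trans: "order_iso W r V s \<Longrightarrow> order_iso V s U t \<Longrightarrow> order_iso W r U t"
  unfolding order_iso_def
proof (elim exE conjE)
  fix g h
  assume h: "bij_betw h W V" "\<forall>x\<in>W. \<forall>y\<in>W. r x y \<longleftrightarrow> s (h x) (h y)"
    and g: "bij_betw g V U" "\<forall>x\<in>V. \<forall>y\<in>V. s x y \<longleftrightarrow> t (g x) (g y)"
  have "\<forall>x\<in>W. h x \<in> V" using bij_betwE[OF h(1)] .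
  then show "\<exists>k. bij_betw k W U \<and> (\<forall>x\<in>W. \<forall>y\<in>W. r x y \<longleftrightarrow> t (k x) (k y))"
    using bij_betw_trans[OF h(1) g(1)] g(2) h(2) by (intro exI[of _ "g \<circ> h"]) simp
qed

lemma order_iso_linear_on: "order_iso W r V s \<Longrightarrow> linear_on V s \<Longrightarrow> linear_on W r"
  unfolding order_iso_def
proof (elim exE conjE)
  fix h
  assume h: "bij_betw h W V" "\<forall>x\<in>W. \<forall>y\<in>W. r x y \<longleftrightarrow> s (h x) (h y)" and V: "linear_on V s"
  have "h x \<in> V" if "x \<in> W" for x using bij_betwE[OF h(1)] that by blast
  moreover have "h x \<noteq> h y" if "x \<noteq> y" "x \<in> W" "y \<in> W" for x y
    using h(1) that by (auto simp: bij_betw_def inj_on_def)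
  moreover have "\<not> r x x" if "x \<in> W" for x
    using h(2) that calculation(1) linear_onD(1)[OF V] by simp
  moreover have "r x z" if "r x y" "r y z" "x \<in> W" "y \<in> W" "z \<in> W" for x y z
    using h(2) that calculation(1) linear_onD(2)[OF V, of "h x" "h y" "h z"] by simp
  moreover have "r x y \<or> r y x" if "x \<noteq> y" "x \<in> W" "y \<in> W" for x y
    using h(2) that calculation(1,2) linear_onD(3)[OF V, of "h x" "h y"] by simp
  ultimately show "linear_on W r" unfolding linear_on_def by metis
qed

lemma type_omega_iso:
  assumes "order_iso W r V s" "type_omega V s" shows "type_omega W r"
proof -
  from assms(1) obtain h where h: "bij_betw h W V" "\<forall>x\<in>W. \<forall>y\<in>W. r x y \<longleftrightarrow> s (h x) (h y)"
    by (auto simp: order_iso_def)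
  have "finite {y \<in> W. r y x}" if x: "x \<in> W" for x
  proof -
    have sub: "h ` {y \<in> W. r y x} \<subseteq> {y \<in> V. s y (h x)}" using h x bij_betwE[OF h(1)] by auto
    have "finite {y \<in> V. s y (h x)}"
      using assms(2) bij_betwE[OF h(1)] x by (auto simp: type_omega_def)
    then have "finite (h ` {y \<in> W. r y x})" using sub finite_subset by blast
    moreover have "inj_on h {y \<in> W. r y x}" using h(1) by (auto simp: bij_betw_def inj_on_def)
    ultimately show ?thesis by (rule finite_imageD)
  qed
  then show ?thesis
    using assms(2) order_iso_linear_on[OF assms(1)] bij_betw_finite[OF h(1)]
    by (simp add: type_omega_def)
qed

lemma type_1eta_iso:
  assumes "order_iso W r V s" "type_1eta V s" shows "type_1eta W r"
proof -
  from assms(1) obtain h where h: "bij_betw h W V" "\<forall>x\<in>W. \<forall>y\<in>W. r x y \<longleftrightarrow> s (h x) (h y)"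
    by (auto simp: order_iso_def)
  have im: "V = h ` W" using h(1) by (simp add: bij_betw_def)
  have V: "dense_on V s" "has_least V s" "unbounded V s" using assms(2) by (auto simp: type_1eta_def)
  have "\<exists>z\<in>W. r x z \<and> r z y" if xy: "x \<in> W" "y \<in> W" "r x y" for x y
  proof -
    have "h x \<in> V" "h y \<in> V" "s (h x) (h y)" using h(2) xy by (auto simp: im)
    then obtain z where "z \<in> V" "s (h x) z" "s z (h y)" using V(1) unfolding dense_on_def by blast
    then show ?thesis using h(2) xy by (auto simp: im)
  qed
  then have "dense_on W r" by (simp add: dense_on_def)
  moreover have "\<exists>y\<in>W. r x y" if x: "x \<in> W" for x
  proof -
    obtain y where "y \<in> V" "s (h x) y" using V(3) x unfolding unbounded_def im by blast
    then show ?thesis using h(2) x by (auto simp: im)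
  qed
  then have "unbounded W r" by (simp add: unbounded_def)
  moreover obtain m where m: "m \<in> W" "\<forall>x\<in>V. x \<noteq> h m \<longrightarrow> s (h m) x"
    using V(2) by (auto simp: has_least_def im)
  have "r m x" if "x \<in> W" "x \<noteq> m" for x
  proof -
    have "h x \<noteq> h m" using h(1) m(1) that by (auto simp: bij_betw_def inj_on_def)
    then show ?thesis using m h(2) that by (auto simp: im)
  qed
  then have "has_least W r" using m(1) by (auto simp: has_least_def)
  ultimately show ?thesis
    using assms(2) order_iso_linear_on[OF assms(1)] by (simp add: type_1eta_def)
qed

text \<open>The isomorphism counts predecessors.\<close>

lemma type_omega_order_iso:
  assumes "type_omega W r" shows "order_iso W r (UNIV :: nat set) (<)"
proof -
  define P where "P x = {y \<in> W. r y x}" for x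
  define h where "h x = card (P x)" for x
  have fin: "finite (P x)" if "x \<in> W" for x
    using assms that by (simp add: type_omega_def P_def)
  have lin: "linear_on W r" and inf: "infinite W" using assms by (auto simp: type_omega_def)
  have mono: "h x < h y" if "r x y" "x \<in> W" "y \<in> W" for x y
  proof -
    have "P x \<subseteq> P y" using linear_onD(2)[OF lin _ that(1)] that(2,3) by (auto simp: P_def)
    moreover have "x \<in> P y" "x \<notin> P x" using that linear_onD(1)[OF lin] by (auto simp: P_def)
    ultimately have "P x \<subset> P y" by blast
    then show ?thesis unfolding h_def using fin that(3) by (simp add: psubset_card_mono)
  qed
  have iff: "r x y \<longleftrightarrow> h x < h y" if "x \<in> W" "y \<in> W" for x y
    using mono[of x y] mono[of y x] linear_onD(3)[OF lin, of x y] that linear_onD(1)[OF lin, of x]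
    by (cases "x = y"; cases "r x y"; cases "r y x"; force)
  have inj: "inj_on h W"
  proof (rule inj_onI)
    fix x y assume xy: "x \<in> W" "y \<in> W" "h x = h y"
    show "x = y" using iff[OF xy(1,2)] iff[OF xy(2,1)] linear_onD(3)[OF lin, of x y] xy by auto
  qed
  \<comment> \<open>By cardinality the predecessors of \<open>x\<close> fill up everything below
    \<open>h x\<close>, so the image of \<open>h\<close> is an initial segment of the natural
    numbers; being infinite, it is everything.\<close>
  have down: "h ` P x = {..<h x}" if "x \<in> W" for x
  proof (rule card_subset_eq)
    show "h ` P x \<subseteq> {..<h x}" using mono that by (auto simp: P_def)
    have "inj_on h (P x)" using inj by (auto simp: P_def inj_on_def)
    then have "card (h ` P x) = card (P x)" by (rule card_image)
    then show "card (h ` P x) = card {..<h x}" by (simp only: card_lessThan h_def)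
  qed simp
  have "infinite (h ` W)" using inf inj finite_imageD by blast
  then have above: "\<exists>x\<in>W. n < h x" for n
    unfolding finite_nat_set_iff_bounded_le by (auto simp: not_le)
  have "n \<in> h ` W" for n
  proof -
    obtain x where x: "x \<in> W" "n < h x" using above by blast
    then have "n \<in> h ` P x" using down by simp
    then show ?thesis by (auto simp: P_def)
  qed
  then have "bij_betw h W UNIV" using inj by (auto simp: bij_betw_def)
  then show ?thesis unfolding order_iso_def using iff by blast
qed

lemma type_omega_iff: "order_iso W r (UNIV :: nat set) (<) \<longleftrightarrow> type_omega W r"
proof
  have "type_omega (UNIV :: nat set) (<)" by (auto simp: type_omega_def linear_on_def)
  then show "order_iso W r (UNIV :: nat set) (<) \<Longrightarrow> type_omega W r"
    by (rule type_omega_iso[rotated])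
qed (rule type_omega_order_iso)

section \<open>Back and forth between countable orders of type 1 + \<eta>\<close>

lemma linear_on_finite_extremum:
  assumes "linear_on W r" "finite A" "A \<subseteq> W" "A \<noteq> {}"
  shows "\<exists>m\<in>A. \<forall>x\<in>A. x \<noteq> m \<longrightarrow> r m x"
  using assms(2,4,3)
proof (induction rule: finite_ne_induct)
  case (insert x F)
  then obtain m where m: "m \<in> F" "\<forall>y\<in>F. y \<noteq> m \<longrightarrow> r m y" by auto
  show ?case
  proof (cases "r x m")
    case True
    have "r x y" if "y \<in> F" for y
      using m that True linear_onD(2)[OF assms(1), of x m y] insert.prems by (cases "y = m") auto
    then show ?thesis by blast
  next
    case False
    then have "r m x" using linear_onD(3)[OF assms(1), of m x] m(1) insert by auto
    then show ?thesis using m by blast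
  qed
qed simp

text \<open>The lower set is non-empty because nothing can be found below a least element; the upper
  one may be empty because there is no greatest element.\<close>

lemma between_finite:
  assumes W: "type_1eta W r" and A: "finite A" "A \<subseteq> W" "A \<noteq> {}" and B: "finite B" "B \<subseteq> W"
    and AB: "\<And>a b. a \<in> A \<Longrightarrow> b \<in> B \<Longrightarrow> r a b"
  shows "\<exists>y\<in>W. (\<forall>a\<in>A. r a y) \<and> (\<forall>b\<in>B. r y b)"
proof -
  have lin: "linear_on W r" and den: "dense_on W r" and unb: "unbounded W r"
    using W by (auto simp: type_1eta_def)
  obtain a where a: "a \<in> A" "\<forall>x\<in>A. x \<noteq> a \<longrightarrow> r x a"
    using linear_on_finite_extremum[of W "r\<inverse>\<inverse>" A] lin A by auto
  have "\<exists>y\<in>W. r a y \<and> (\<forall>b\<in>B. r y b)"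
  proof (cases "B = {}")
    case True
    then show ?thesis using unb a A(2) by (auto simp: unbounded_def)
  next
    case False
    then obtain b where b: "b \<in> B" "\<forall>x\<in>B. x \<noteq> b \<longrightarrow> r b x"
      using linear_on_finite_extremum[of W r B] lin B by auto
    then obtain y where y: "y \<in> W" "r a y" "r y b"
      using den a(1) AB A(2) B(2) by (auto simp: dense_on_def) (meson in_mono)
    have "r y x" if "x \<in> B" for x
      using b y that B(2) linear_onD(2)[OF lin, of y b x] by (cases "x = b") auto
    then show ?thesis using y by blast
  qed
  then obtain y where y: "y \<in> W" "r a y" "\<forall>b\<in>B. r y b" by blast
  have "r x y" if "x \<in> A" for x
    using a y that A(2) linear_onD(2)[OF lin, of x a y] by (cases "x = a") auto
  then show ?thesis using y by blast
qed

text \<open>The last clause keeps the least element of \<open>W\<close> in the domain, so that any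
  new element of \<open>W\<close> has a matched element below it and \<open>between_finite\<close>
  applies on the other side.\<close>

definition partial_iso ::
  "'a set \<Rightarrow> ('a \<Rightarrow> 'a \<Rightarrow> bool) \<Rightarrow> 'b set \<Rightarrow> ('b \<Rightarrow> 'b \<Rightarrow> bool) \<Rightarrow> ('a \<times> 'b) set \<Rightarrow> bool" where
  "partial_iso W r V s f \<longleftrightarrow> finite f \<and> f \<subseteq> W \<times> V \<and>
     (\<forall>a b c d. (a, b) \<in> f \<longrightarrow> (c, d) \<in> f \<longrightarrow> (r a c \<longleftrightarrow> s b d) \<and> (a = c \<longleftrightarrow> b = d)) \<and>
     (\<exists>a b. (a, b) \<in> f \<and> (\<forall>x\<in>W. x \<noteq> a \<longrightarrow> r a x))"

lemma partial_iso_extend: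
  assumes W: "type_1eta W r" and V: "type_1eta V s" and f: "partial_iso W r V s f" and x: "x \<in> W"
  shows "\<exists>g. partial_iso W r V s g \<and> f \<subseteq> g \<and> x \<in> Domain g"
proof (cases "x \<in> Domain f")
  case True
  then show ?thesis using f by blast
next
  case False
  define A where "A = {b. \<exists>a. (a, b) \<in> f \<and> r a x}"
  define B where "B = {b. \<exists>a. (a, b) \<in> f \<and> r x a}"
  have linW: "linear_on W r" and linV: "linear_on V s" using W V by (auto simp: type_1eta_def)
  have fsub: "f \<subseteq> W \<times> V" and fin: "finite f"
    and iso: "\<And>a b c d. (a, b) \<in> f \<Longrightarrow> (c, d) \<in> f \<Longrightarrow> (r a c \<longleftrightarrow> s b d) \<and> (a = c \<longleftrightarrow> b = d)"
    using f unfolding partial_iso_def by auto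
  obtain m m' where m: "(m, m') \<in> f" "\<forall>x\<in>W. x \<noteq> m \<longrightarrow> r m x"
    using f unfolding partial_iso_def by auto
  have "m \<noteq> x" using m(1) False by blast
  then have "r m x" using m(2) x by simp
  then have "m' \<in> A" using m(1) unfolding A_def by auto
  moreover have "A \<subseteq> Range f" "B \<subseteq> Range f" unfolding A_def B_def by auto
  then have "finite A" "finite B" using finite_Range[OF fin] finite_subset by blast+
  moreover have "A \<subseteq> V" "B \<subseteq> V" unfolding A_def B_def using fsub by auto
  moreover have "s a b" if "a \<in> A" "b \<in> B" for a b
  proof -
    from that obtain c d where cd: "(c, a) \<in> f" "r c x" "(d, b) \<in> f" "r x d"
      unfolding A_def B_def by blast
    then have "r c d" using linear_onD(2)[OF linW, of c x d] fsub x by blast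
    then show ?thesis using iso cd by blast
  qed
  ultimately obtain y where y: "y \<in> V" "\<forall>a\<in>A. s a y" "\<forall>b\<in>B. s y b"
    using between_finite[OF V, of A B] by blast
  have new: "(r a x \<longleftrightarrow> s b y) \<and> (r x a \<longleftrightarrow> s y b) \<and> a \<noteq> x \<and> b \<noteq> y" if ab: "(a, b) \<in> f" for a b
  proof -
    have in_sets: "a \<in> W" "b \<in> V" "a \<noteq> x" using ab fsub False by auto
    then consider "r a x" "b \<in> A" | "r x a" "b \<in> B"
      using linear_onD(3)[OF linW, of a x] x ab unfolding A_def B_def by blast
    then show ?thesis
      using y in_sets x linear_onD(1,4)[OF linW] linear_onD(1,4)[OF linV] by cases metis+
  qed
  have "partial_iso W r V s (insert (x, y) f)"
    unfolding partial_iso_def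
  proof (intro conjI)
    show "\<exists>a b. (a, b) \<in> insert (x, y) f \<and> (\<forall>x\<in>W. x \<noteq> a \<longrightarrow> r a x)" using m by blast
    show "\<forall>a b c d. (a, b) \<in> insert (x, y) f \<longrightarrow> (c, d) \<in> insert (x, y) f \<longrightarrow>
        (r a c \<longleftrightarrow> s b d) \<and> (a = c \<longleftrightarrow> b = d)"
    proof (intro allI impI)
      fix a b c d assume "(a, b) \<in> insert (x, y) f" "(c, d) \<in> insert (x, y) f"
      then show "(r a c \<longleftrightarrow> s b d) \<and> (a = c \<longleftrightarrow> b = d)"
        using iso[of a b c d] new[of a b] new[of c d]
          linear_onD(1)[OF linW x] linear_onD(1)[OF linV y(1)] by auto
    qed
  qed (use fin fsub x y in auto)
  then show ?thesis by (intro exI[of _ "insert (x, y) f"]) auto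
qed

text \<open>Stage \<open>n\<close> treats the elements with code \<open>n\<close> on both sides.
  Keeping the pair of least elements at all stages makes the inverse of a finite partial isomorphism
  one as well, so \<open>partial_iso_extend\<close> serves both directions.\<close>

lemma type_1eta_order_iso:
  fixes W :: "'a::countable set" and V :: "'b::countable set"
  assumes W: "type_1eta W r" and V: "type_1eta V s"
  shows "order_iso W r V s"
proof -
  have linW: "linear_on W r" and linV: "linear_on V s" using W V by (auto simp: type_1eta_def)
  obtain m m' where m: "m \<in> W" "\<forall>x\<in>W. x \<noteq> m \<longrightarrow> r m x" and m': "m' \<in> V" "\<forall>x\<in>V. x \<noteq> m' \<longrightarrow> s m' x"
    using W V by (auto simp: type_1eta_def has_least_def)
  have conv: "partial_iso V s W r (f\<inverse>)" if "partial_iso W r V s f" "(m, m') \<in> f" for f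
  proof -
    have f: "finite f" "f \<subseteq> W \<times> V"
      "\<And>a b c d. (a, b) \<in> f \<Longrightarrow> (c, d) \<in> f \<Longrightarrow> (r a c \<longleftrightarrow> s b d) \<and> (a = c \<longleftrightarrow> b = d)"
      using that(1) by (simp_all add: partial_iso_def)
    have "(s a c \<longleftrightarrow> r b d) \<and> (a = c \<longleftrightarrow> b = d)" if "(b, a) \<in> f" "(d, c) \<in> f" for a b c d
      using f(3)[OF that] by auto
    then show ?thesis unfolding partial_iso_def
      using f(1,2) m' that(2) by (intro conjI exI[of _ m'] exI[of _ m]) auto
  qed
  have conv': "partial_iso W r V s f" if "partial_iso V s W r (f\<inverse>)" "(m, m') \<in> f" for f
  proof -
    have f: "finite f" "f \<subseteq> W \<times> V"
      "\<And>a b c d. (a, b) \<in> f \<Longrightarrow> (c, d) \<in> f \<Longrightarrow> (s b d \<longleftrightarrow> r a c) \<and> (b = d \<longleftrightarrow> a = c)"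
      using that(1) by (simp_all add: partial_iso_def) auto
    have "(r a c \<longleftrightarrow> s b d) \<and> (a = c \<longleftrightarrow> b = d)" if "(a, b) \<in> f" "(c, d) \<in> f" for a b c d
      using f(3)[OF that] by auto
    then show ?thesis unfolding partial_iso_def
      using f(1,2) m that(2) by (intro conjI exI[of _ m'] exI[of _ m]) auto
  qed
  define Q where "Q f \<longleftrightarrow> partial_iso W r V s f \<and> (m, m') \<in> f" for f
  define step where "step n f g \<longleftrightarrow> f \<subseteq> g \<and> (\<forall>x\<in>W. to_nat x = n \<longrightarrow> x \<in> Domain g) \<and>
      (\<forall>y\<in>V. to_nat y = n \<longrightarrow> y \<in> Range g)" for n f g
  have extend: "\<exists>g. Q g \<and> step n f g" if "Q f" for f n
  proof -
    have f: "partial_iso W r V s f" "(m, m') \<in> f" using that by (auto simp: Q_def)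
    obtain g where g: "partial_iso W r V s g" "f \<subseteq> g" "\<forall>x\<in>W. to_nat x = n \<longrightarrow> x \<in> Domain g"
    proof (cases "\<exists>x\<in>W. to_nat x = n")
      case True
      then obtain x where x: "x \<in> W" "to_nat x = n" by blast
      then obtain g where "partial_iso W r V s g" "f \<subseteq> g" "x \<in> Domain g"
        using partial_iso_extend[OF W V f(1)] by blast
      then show ?thesis using x by (intro that) auto
    qed (use f that in blast)
    have g': "partial_iso V s W r (g\<inverse>)" using conv f g by blast
    obtain k where k: "partial_iso V s W r k" "g\<inverse> \<subseteq> k" "\<forall>y\<in>V. to_nat y = n \<longrightarrow> y \<in> Domain k"
    proof (cases "\<exists>y\<in>V. to_nat y = n")
      case True
      then obtain y where y: "y \<in> V" "to_nat y = n" by blast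
      then obtain k where "partial_iso V s W r k" "g\<inverse> \<subseteq> k" "y \<in> Domain k"
        using partial_iso_extend[OF V W g'] by blast
      then show ?thesis using y by (intro that) auto
    qed (use g' that in blast)
    have "(m, m') \<in> k\<inverse>" using f(2) g(2) k(2) by auto
    then have "Q (k\<inverse>)" using conv'[of "k\<inverse>"] k(1) by (simp add: Q_def)
    moreover have "g \<subseteq> k\<inverse>" using k(2) converse_mono[of g "k\<inverse>"] by simp
    then have "Domain g \<subseteq> Domain (k\<inverse>)" "f \<subseteq> k\<inverse>" using g(2) by blast+
    then have "step n f (k\<inverse>)" using g(3) k(3) unfolding step_def by blast
    ultimately show ?thesis by blast
  qed
  have "Q {(m, m')}" using m m' linear_onD(1)[OF linW m(1)] linear_onD(1)[OF linV m'(1)]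
    by (auto simp: Q_def partial_iso_def)
  then have "\<exists>F. \<forall>n. Q (F n) \<and> step n (F n) (F (Suc n))"
    using extend by (intro dependent_nat_choice) blast+
  then obtain F where F: "\<And>n. Q (F n)" "\<And>n. step n (F n) (F (Suc n))" by blast
  define G where "G = (\<Union>n. F n)"
  have mono: "F i \<subseteq> F j" if "i \<le> j" for i j
    using F(2) that lift_Suc_mono_le[of F] by (auto simp: step_def)
  have iso: "(r a c \<longleftrightarrow> s b d) \<and> (a = c \<longleftrightarrow> b = d)" if "(a, b) \<in> G" "(c, d) \<in> G" for a b c d
  proof -
    from that obtain i j where "(a, b) \<in> F i" "(c, d) \<in> F j" unfolding G_def by blast
    then have "(a, b) \<in> F (max i j)" "(c, d) \<in> F (max i j)"
      using mono[of i "max i j"] mono[of j "max i j"] by auto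
    then show ?thesis using F(1)[of "max i j"] by (simp add: Q_def partial_iso_def)
  qed
  have GW: "G \<subseteq> W \<times> V"
  proof -
    have "F n \<subseteq> W \<times> V" for n using F(1) by (simp add: Q_def partial_iso_def)
    then show ?thesis unfolding G_def by blast
  qed
  have "x \<in> Domain G" if "x \<in> W" for x using F(2)[of "to_nat x"] that by (auto simp: step_def G_def)
  moreover have "y \<in> Range G" if "y \<in> V" for y using F(2)[of "to_nat y"] that by (auto simp: step_def G_def)
  ultimately have "W \<subseteq> Domain G" "V \<subseteq> Range G" by blast+
  then have "\<forall>x\<in>W. \<exists>y. (x, y) \<in> G" by blast
  then obtain h where h: "\<And>x. x \<in> W \<Longrightarrow> (x, h x) \<in> G" by metis
  have "h ` W = V"
  proof
    show "h ` W \<subseteq> V" using h GW by blast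
    show "V \<subseteq> h ` W"
    proof
      fix y assume "y \<in> V"
      then obtain x where "(x, y) \<in> G" using \<open>V \<subseteq> Range G\<close> by blast
      moreover then have "x \<in> W" using GW by blast
      ultimately have "x \<in> W" "y = h x" using h[of x] iso[of x y x "h x"] by auto
      then show "y \<in> h ` W" by simp
    qed
  qed
  moreover have "inj_on h W" using iso[OF h h] by (intro inj_onI) simp
  moreover have "\<forall>x\<in>W. \<forall>y\<in>W. r x y \<longleftrightarrow> s (h x) (h y)" using iso[OF h h] by simp
  ultimately show ?thesis unfolding order_iso_def bij_betw_def by blast
qed

section \<open>The concrete orders 1 + \<eta> and \<eta> + 1\<close>

lemma type_1eta_one_plus_eta: "type_1eta UNIV (sum_less one_less eta_less)"
  unfolding type_1eta_def linear_on_def dense_on_def has_least_def unbounded_def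
proof (intro conjI)
  show "\<exists>m\<in>UNIV. \<forall>x\<in>UNIV. x \<noteq> m \<longrightarrow> sum_less one_less eta_less m x"
    by (intro bexI[of _ "Inl ()"] ballI) (case_tac x, auto)
  show "\<forall>x\<in>UNIV. \<exists>y\<in>UNIV. sum_less one_less eta_less x y"
  proof
    fix x :: "unit + rat"
    show "\<exists>y\<in>UNIV. sum_less one_less eta_less x y"
      by (intro bexI[of _ "Inr (case_sum (\<lambda>_. 0) (\<lambda>q. q + 1) x)"]) (cases x, auto simp: eta_less_def)
  qed
  show "\<forall>x\<in>UNIV. \<forall>y\<in>UNIV. sum_less one_less eta_less x y \<longrightarrow>
      (\<exists>z\<in>UNIV. sum_less one_less eta_less x z \<and> sum_less one_less eta_less z y)"
  proof (intro ballI impI)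
    fix x y :: "unit + rat" assume xy: "sum_less one_less eta_less x y"
    then obtain b where b: "y = Inr b" by (cases x; cases y) (auto simp: one_less_def)
    show "\<exists>z\<in>UNIV. sum_less one_less eta_less x z \<and> sum_less one_less eta_less z y"
    proof (cases x)
      case (Inl u)
      then show ?thesis using b by (intro bexI[of _ "Inr (b - 1)"]) (auto simp: eta_less_def)
    next
      case (Inr a)
      then obtain c where "a < c" "c < b" using xy b dense[of a b] by (auto simp: eta_less_def)
      then show ?thesis using b Inr by (intro bexI[of _ "Inr c"]) (auto simp: eta_less_def)
    qed
  qed
qed (auto simp: one_less_def eta_less_def elim!: sum_less.elims)

lemma order_iso_sum_swap:
  "order_iso UNIV (sum_less r s)\<inverse>\<inverse> UNIV (sum_less s\<inverse>\<inverse> r\<inverse>\<inverse>)"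
proof -
  let ?h = "case_sum Inr Inl :: 'a + 'b \<Rightarrow> 'b + 'a"
  have "bij ?h"
    by (rule bij_betw_byWitness[where f' = "case_sum Inr Inl"]) (auto split: sum.splits)
  moreover have "(sum_less r s)\<inverse>\<inverse> x y \<longleftrightarrow> sum_less s\<inverse>\<inverse> r\<inverse>\<inverse> (?h x) (?h y)" for x y
    by (cases x; cases y) auto
  ultimately show ?thesis unfolding order_iso_def by blast
qed

text \<open>Reversal swaps the summands, and \<open>uminus\<close> shows that \<eta> is its own
  reverse.\<close>

lemma type_1eta_eta_plus_one: "type_1eta UNIV (sum_less eta_less one_less)\<inverse>\<inverse>"
proof -
  have "order_iso UNIV (sum_less one_less eta_less\<inverse>\<inverse>) UNIV (sum_less one_less eta_less)"
  proof -
    let ?h = "map_sum id uminus :: unit + rat \<Rightarrow> unit + rat"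
    have "?h (?h x) = x" for x by (cases x) auto
    then have "bij ?h" by (intro bij_betw_byWitness[where f' = ?h]) simp_all
    moreover have "sum_less one_less eta_less\<inverse>\<inverse> x y \<longleftrightarrow> sum_less one_less eta_less (?h x) (?h y)" for x y
      by (cases x; cases y) (auto simp: eta_less_def one_less_def)
    ultimately show ?thesis unfolding order_iso_def by blast
  qed
  moreover have "order_iso UNIV (sum_less eta_less one_less)\<inverse>\<inverse> UNIV (sum_less one_less eta_less\<inverse>\<inverse>)"
  proof -
    have "one_less\<inverse>\<inverse> = one_less" by (simp add: one_less_def fun_eq_iff)
    then show ?thesis using order_iso_sum_swap[of eta_less one_less] by simp
  qed
  ultimately show ?thesis using order_iso_trans type_1eta_iso[OF _ type_1eta_one_plus_eta] by blast
qed

section \<open>Structures for the language of orders\<close>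

definition lt :: "struct \<Rightarrow> nat \<Rightarrow> nat \<Rightarrow> bool" where
  "lt S a b \<longleftrightarrow> rel_interp S 0 [a, b]"

definition ord :: "nat set \<Rightarrow> (nat \<Rightarrow> nat \<Rightarrow> bool) \<Rightarrow> struct" where
  "ord W r = \<lparr>universe = W, rel_interp = (\<lambda>R xs. r (xs ! 0) (xs ! 1)), fun_interp = (\<lambda>f xs. 0)\<rparr>"

lemma ord_simps [simp]: "universe (ord W r) = W" "lt (ord W r) = r"
  by (simp_all add: ord_def lt_def fun_eq_iff)

lemma is_structure_order: "is_structure order_lang S \<longleftrightarrow> universe S \<noteq> {}"
  by (simp add: is_structure_def order_lang_def)

lemma isomorphic_order:
  "isomorphic order_lang S T \<longleftrightarrow> order_iso (universe S) (lt S) (universe T) (lt T)"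
proof -
  have "(\<forall>R xs. rel_arity order_lang R = Some (length xs) \<longrightarrow> set xs \<subseteq> universe S \<longrightarrow>
        (rel_interp S R xs \<longleftrightarrow> rel_interp T R (map h xs))) \<longleftrightarrow>
      (\<forall>x\<in>universe S. \<forall>y\<in>universe S. lt S x y \<longleftrightarrow> lt T (h x) (h y))" for h
  proof
    assume all: "\<forall>R xs. rel_arity order_lang R = Some (length xs) \<longrightarrow> set xs \<subseteq> universe S \<longrightarrow>
        (rel_interp S R xs \<longleftrightarrow> rel_interp T R (map h xs))"
    have "lt S x y \<longleftrightarrow> lt T (h x) (h y)" if "x \<in> universe S" "y \<in> universe S" for x y
      using all[THEN spec[of _ 0], THEN spec[of _ "[x, y]"]] that by (simp add: lt_def order_lang_def)
    then show "\<forall>x\<in>universe S. \<forall>y\<in>universe S. lt S x y \<longleftrightarrow> lt T (h x) (h y)" by blast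
  next
    assume lt: "\<forall>x\<in>universe S. \<forall>y\<in>universe S. lt S x y \<longleftrightarrow> lt T (h x) (h y)"
    have "rel_interp S R xs \<longleftrightarrow> rel_interp T R (map h xs)"
      if R: "rel_arity order_lang R = Some (length xs)" and xs: "set xs \<subseteq> universe S" for R xs
    proof -
      have "length xs = 2" "R = 0" using R by (auto simp: order_lang_def split: if_splits)
      moreover from this obtain x y where "xs = [x, y]" by (auto simp: numeral_2_eq_2 length_Suc_conv)
      ultimately show ?thesis using lt xs by (simp add: lt_def)
    qed
    then show "\<forall>R xs. rel_arity order_lang R = Some (length xs) \<longrightarrow> set xs \<subseteq> universe S \<longrightarrow>
        (rel_interp S R xs \<longleftrightarrow> rel_interp T R (map h xs))" by blast
  qed
  then show ?thesis by (simp add: isomorphic_def order_iso_def order_lang_def)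
qed

lemma isomorphic_order_struct:
  fixes r :: "'a::countable \<Rightarrow> 'a \<Rightarrow> bool"
  shows "isomorphic order_lang S (order_struct r) \<longleftrightarrow> order_iso (universe S) (lt S) UNIV r"
proof -
  have "order_iso UNIV r (universe (order_struct r)) (lt (order_struct r))"
    unfolding order_iso_def
    by (rule exI[of _ to_nat]) (auto simp: order_struct_def lt_def inj_on_imp_bij_betw)
  note iso = this
  show ?thesis
    unfolding isomorphic_order using order_iso_trans[OF _ iso] order_iso_trans[OF _ order_iso_sym[OF iso]]
    by (intro iffI)
qed

lemma isomorphic_omega: "isomorphic order_lang S omega \<longleftrightarrow> type_omega (universe S) (lt S)"
  by (simp add: omega_def isomorphic_order_struct type_omega_iff)

lemma isomorphic_omega_star:
  "isomorphic order_lang S omega_star \<longleftrightarrow> type_omega (universe S) (lt S)\<inverse>\<inverse>"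
proof -
  have "(\<lambda>m n::nat. n < m) = (<)\<inverse>\<inverse>" by (simp add: fun_eq_iff)
  then show ?thesis
    using order_iso_conversep[of "universe S" "(lt S)\<inverse>\<inverse>" UNIV "(<) :: nat \<Rightarrow> nat \<Rightarrow> bool"]
    by (simp add: omega_star_def isomorphic_order_struct type_omega_iff)
qed

lemma isomorphic_one_plus_eta:
  "isomorphic order_lang S one_plus_eta \<longleftrightarrow> type_1eta (universe S) (lt S)"
  unfolding one_plus_eta_def isomorphic_order_struct
  by (intro iffI type_1eta_order_iso type_1eta_one_plus_eta) (rule type_1eta_iso[OF _ type_1eta_one_plus_eta])

lemma isomorphic_eta_plus_one:
  "isomorphic order_lang S eta_plus_one \<longleftrightarrow> type_1eta (universe S) (lt S)\<inverse>\<inverse>"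
proof -
  have "isomorphic order_lang S eta_plus_one \<longleftrightarrow>
      order_iso (universe S) (lt S)\<inverse>\<inverse> UNIV (sum_less eta_less one_less)\<inverse>\<inverse>"
    by (simp add: eta_plus_one_def isomorphic_order_struct order_iso_conversep)
  also have "\<dots> \<longleftrightarrow> type_1eta (universe S) (lt S)\<inverse>\<inverse>"
    by (intro iffI type_1eta_order_iso type_1eta_eta_plus_one) (rule type_1eta_iso[OF _ type_1eta_eta_plus_one])
  finally show ?thesis .
qed

text \<open>That \<open>S\<close> is closed under its functions is what allows the inverse bijection
  to cancel \<open>h\<close> at a function value of \<open>S\<close>.\<close>

lemma isomorphic_sym:
  assumes S: "is_structure L S" and "isomorphic L S T"
  shows "isomorphic L T S"
proof -
  obtain h where h: "bij_betw h (universe S) (universe T)"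
    and rel: "\<And>R xs. rel_arity L R = Some (length xs) \<Longrightarrow> set xs \<subseteq> universe S \<Longrightarrow>
        rel_interp S R xs \<longleftrightarrow> rel_interp T R (map h xs)"
    and func: "\<And>f xs. fun_arity L f = Some (length xs) \<Longrightarrow> set xs \<subseteq> universe S \<Longrightarrow>
        h (fun_interp S f xs) = fun_interp T f (map h xs)"
    using assms(2) unfolding isomorphic_def by blast
  define g where "g = inv_into (universe S) h"
  have g: "bij_betw g (universe T) (universe S)" unfolding g_def using h by (rule bij_betw_inv_into)
  have gh: "g (h x) = x" if "x \<in> universe S" for x
    using bij_betw_inv_into_left[OF h that] by (simp add: g_def)
  have sub: "set (map g xs) \<subseteq> universe S" if "set xs \<subseteq> universe T" for xs
    using bij_betwE[OF g] that by auto
  have hg: "map h (map g xs) = xs" if "set xs \<subseteq> universe T" for xs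
    using bij_betw_inv_into_right[OF h] that by (auto simp: g_def intro!: map_idI)
  have "rel_interp T R xs \<longleftrightarrow> rel_interp S R (map g xs)"
    if "rel_arity L R = Some (length xs)" "set xs \<subseteq> universe T" for R xs
    using rel[of R "map g xs"] sub[OF that(2)] hg[OF that(2)] that(1) by simp
  moreover have "g (fun_interp T f xs) = fun_interp S f (map g xs)"
    if "fun_arity L f = Some (length xs)" "set xs \<subseteq> universe T" for f xs
  proof -
    have "fun_interp S f (map g xs) \<in> universe S"
      using S that sub[OF that(2)] by (simp add: is_structure_def)
    then show ?thesis
      using func[of f "map g xs"] sub[OF that(2)] hg[OF that(2)] that(1) gh by (metis length_map)
  qed
  ultimately show ?thesis unfolding isomorphic_def using g by blast
qed

lemma isomorphic_trans:
  assumes "isomorphic L S T" "isomorphic L T U"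
  shows "isomorphic L S U"
proof -
  obtain h where h: "bij_betw h (universe S) (universe T)"
    and rel: "\<And>R xs. rel_arity L R = Some (length xs) \<Longrightarrow> set xs \<subseteq> universe S \<Longrightarrow>
        rel_interp S R xs \<longleftrightarrow> rel_interp T R (map h xs)"
    and func: "\<And>f xs. fun_arity L f = Some (length xs) \<Longrightarrow> set xs \<subseteq> universe S \<Longrightarrow>
        h (fun_interp S f xs) = fun_interp T f (map h xs)"
    using assms(1) unfolding isomorphic_def by blast
  obtain g where g: "bij_betw g (universe T) (universe U)"
    and rel': "\<And>R xs. rel_arity L R = Some (length xs) \<Longrightarrow> set xs \<subseteq> universe T \<Longrightarrow>
        rel_interp T R xs \<longleftrightarrow> rel_interp U R (map g xs)"
    and func': "\<And>f xs. fun_arity L f = Some (length xs) \<Longrightarrow> set xs \<subseteq> universe T \<Longrightarrow>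
        g (fun_interp T f xs) = fun_interp U f (map g xs)"
    using assms(2) unfolding isomorphic_def by blast
  have sub: "set (map h xs) \<subseteq> universe T" if "set xs \<subseteq> universe S" for xs
    using bij_betwE[OF h] that by auto
  have "rel_interp S R xs \<longleftrightarrow> rel_interp U R (map (g \<circ> h) xs)"
    if "rel_arity L R = Some (length xs)" "set xs \<subseteq> universe S" for R xs
    using rel[OF that] rel'[of R "map h xs"] sub[OF that(2)] that(1) by simp
  moreover have "(g \<circ> h) (fun_interp S f xs) = fun_interp U f (map (g \<circ> h) xs)"
    if "fun_arity L f = Some (length xs)" "set xs \<subseteq> universe S" for f xs
    using func[OF that] func'[of f "map h xs"] sub[OF that(2)] that(1) by simp
  ultimately show ?thesis unfolding isomorphic_def using bij_betw_trans[OF h g] by blast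
qed

section \<open>Codes of diagrams\<close>

lemma code_tm_inject: "code_tm s = code_tm t \<Longrightarrow> s = t"
proof (induction s arbitrary: t)
  case (Elem a)
  then show ?case by (cases t) auto
next
  case (App f ss)
  then obtain ts where t: "t = App f ts" and eq: "map code_tm ss = map code_tm ts"
    by (cases t) (auto simp: list_encode_eq)
  then have len: "length ss = length ts" by (metis length_map)
  have "ss ! i = ts ! i" if "i < length ss" for i
    using App.IH[of "ss ! i" "ts ! i"] eq that len by (metis nth_map nth_mem)
  then show ?case using len t by (simp add: list_eq_iff_nth_eq)
qed

lemma inj_code_tm: "inj code_tm"
  by (rule injI) (rule code_tm_inject)

lemma inj_code_basic: "inj code_basic"
proof (rule injI)
  have atom: "a = b" if "code_atom a = code_atom b" for a b
    using that inj_map_eq_map[OF inj_code_tm]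
    by (cases a; cases b) (auto simp: list_encode_eq dest: code_tm_inject)
  fix x y assume "code_basic x = code_basic y"
  then show "x = y" by (cases x; cases y) (auto dest: atom)
qed

abbreviation dcode :: "language \<Rightarrow> struct \<Rightarrow> nat set" where
  "dcode L S \<equiv> code_basic ` diagram L S"

text \<open>The four shapes of basic sentences in the language of orders. In any language
  \<open>eqc a a\<close> belongs to the coded diagram iff \<open>a\<close> is in the universe, so it
  also serves as the code of that fact.\<close>

definition eqc :: "nat \<Rightarrow> nat \<Rightarrow> nat" where "eqc a b = code_basic (Pos (Eq (Elem a) (Elem b)))"
definition nec :: "nat \<Rightarrow> nat \<Rightarrow> nat" where "nec a b = code_basic (Neg (Eq (Elem a) (Elem b)))"
definition ltc :: "nat \<Rightarrow> nat \<Rightarrow> nat" where "ltc a b = code_basic (Pos (Rel 0 [Elem a, Elem b]))"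
definition nlc :: "nat \<Rightarrow> nat \<Rightarrow> nat" where "nlc a b = code_basic (Neg (Rel 0 [Elem a, Elem b]))"

lemma recursive_codes [recursive_intros]:
  assumes "recursive f" "recursive g"
  shows "recursive (\<lambda>X n. eqc (f X n) (g X n))" "recursive (\<lambda>X n. nec (f X n) (g X n))"
    "recursive (\<lambda>X n. ltc (f X n) (g X n))" "recursive (\<lambda>X n. nlc (f X n) (g X n))"
  unfolding eqc_def nec_def ltc_def nlc_def code_basic.simps code_atom.simps code_tm.simps
    list.map list_encode.simps
  by (intro recursive_intros assms)+

text \<open>Turns the quantifiers over the constants of a sentence into bounded ones.\<close>

lemma le_codes:
  "a \<le> eqc a b" "b \<le> eqc a b" "a \<le> nec a b" "b \<le> nec a b"
  "a \<le> ltc a b" "b \<le> ltc a b" "a \<le> nlc a b" "b \<le> nlc a b"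
proof -
  have *: "a \<le> x \<Longrightarrow> a \<le> prod_encode (x, y)" "a \<le> y \<Longrightarrow> a \<le> prod_encode (x, y)" for a x y
    using le_prod_encode_1[of x y] le_prod_encode_2[of y x] by auto
  show "a \<le> eqc a b" "b \<le> eqc a b" "a \<le> nec a b" "b \<le> nec a b"
    "a \<le> ltc a b" "b \<le> ltc a b" "a \<le> nlc a b" "b \<le> nlc a b"
    by (simp_all add: eqc_def nec_def ltc_def nlc_def * le_SucI)
qed

text \<open>Describes the members of the diagram of an order by numbers, so that universe and
  relation may be given by an oracle.\<close>

definition order_code :: "nat set \<Rightarrow> (nat \<Rightarrow> nat \<Rightarrow> bool) \<Rightarrow> nat \<Rightarrow> nat \<Rightarrow> nat \<Rightarrow> bool" where
  "order_code W r n a b \<longleftrightarrow> a \<in> W \<and> b \<in> W \<and>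
     (n = eqc a b \<and> a = b \<or> n = nec a b \<and> a \<noteq> b \<or> n = ltc a b \<and> r a b \<or> n = nlc a b \<and> \<not> r a b)"

lemma tm_in_order_lang: "tm_in order_lang t \<longleftrightarrow> (\<exists>a. t = Elem a)"
  by (cases t) (simp_all add: order_lang_def)

lemma code_diagram_order:
  "dcode order_lang S = {n. \<exists>a b. order_code (universe S) (lt S) n a b}"
proof (intro set_eqI iffI)
  fix n assume "n \<in> dcode order_lang S"
  then obtain \<phi> where \<phi>: "n = code_basic \<phi>" "basic_in order_lang \<phi>" "set_basic \<phi> \<subseteq> universe S" "basic_true S \<phi>"
    by (auto simp: diagram_def)
  have "\<exists>a b. \<alpha> = Eq (Elem a) (Elem b) \<or> \<alpha> = Rel 0 [Elem a, Elem b]" if "atom_in order_lang \<alpha>" for \<alpha> :: "nat atom"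
  proof (cases \<alpha>)
    case (Rel R ts)
    then have "length ts = 2" "R = 0" using that by (auto simp: order_lang_def split: if_splits)
    moreover from this obtain s t where "ts = [s, t]" by (auto simp: numeral_2_eq_2 length_Suc_conv)
    ultimately show ?thesis using that Rel by (auto simp: tm_in_order_lang)
  qed (use that in \<open>auto simp: tm_in_order_lang\<close>)
  moreover obtain \<alpha> where "\<phi> = Pos \<alpha> \<or> \<phi> = Neg \<alpha>" "atom_in order_lang \<alpha>"
    using \<phi>(2) by (cases \<phi>) auto
  ultimately obtain a b where "\<phi> = Pos (Eq (Elem a) (Elem b)) \<or> \<phi> = Pos (Rel 0 [Elem a, Elem b]) \<or>
      \<phi> = Neg (Eq (Elem a) (Elem b)) \<or> \<phi> = Neg (Rel 0 [Elem a, Elem b])" by blast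
  then have "order_code (universe S) (lt S) n a b"
    using \<phi> by (auto simp: order_code_def eqc_def nec_def ltc_def nlc_def lt_def)
  then show "n \<in> {n. \<exists>a b. order_code (universe S) (lt S) n a b}" by blast
next
  fix n assume "n \<in> {n. \<exists>a b. order_code (universe S) (lt S) n a b}"
  then obtain a b where ab: "order_code (universe S) (lt S) n a b" by blast
  have "rel_arity order_lang 0 = Some 2" by (simp add: order_lang_def)
  then have in_lang: "basic_in order_lang (Pos (Eq (Elem a) (Elem b)))"
    "basic_in order_lang (Neg (Eq (Elem a) (Elem b)))"
    "basic_in order_lang (Pos (Rel 0 [Elem a, Elem b]))"
    "basic_in order_lang (Neg (Rel 0 [Elem a, Elem b]))" by simp_all
  have mem: "a = b \<Longrightarrow> Pos (Eq (Elem a) (Elem b)) \<in> diagram order_lang S"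
    "a \<noteq> b \<Longrightarrow> Neg (Eq (Elem a) (Elem b)) \<in> diagram order_lang S"
    "lt S a b \<Longrightarrow> Pos (Rel 0 [Elem a, Elem b]) \<in> diagram order_lang S"
    "\<not> lt S a b \<Longrightarrow> Neg (Rel 0 [Elem a, Elem b]) \<in> diagram order_lang S"
    using ab in_lang by (simp_all add: diagram_def order_code_def lt_def)
  show "n \<in> dcode order_lang S"
    using ab unfolding order_code_def eqc_def nec_def ltc_def nlc_def
    by (elim conjE disjE) (metis imageI mem)+
qed

lemma eqc_in_diagram: "eqc a a \<in> dcode L S \<longleftrightarrow> a \<in> universe S"
  unfolding eqc_def inj_image_mem_iff[OF inj_code_basic] by (simp add: diagram_def)

lemma ltc_in_diagram:
  "ltc a b \<in> dcode order_lang T \<longleftrightarrow> a \<in> universe T \<and> b \<in> universe T \<and> lt T a b"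
  unfolding ltc_def inj_image_mem_iff[OF inj_code_basic]
  by (auto simp: diagram_def lt_def order_lang_def)

text \<open>If the oracle decides universe and relation of an order, it decides its diagram, because
  the constants of a sentence are bounded by its code.\<close>

lemma turing_operator_order:
  assumes P: "decidable P" and r: "decidable (\<lambda>X n. r X (p1 n) (p2 n))"
  shows "\<exists>\<Phi>. \<forall>L S X. X = dcode L S \<longrightarrow> turing_image \<Phi> L order_lang S (ord {a. P X a} (r X))"
proof -
  have "decidable (\<lambda>X n. \<exists>a\<le>n. \<exists>b\<le>n. order_code {a. P X a} (r X) n a b)"
    unfolding order_code_def mem_Collect_eq
    by (intro recursive_intros decidable_comp[OF P] decidable_comp2[OF r])
  moreover have "(\<exists>a\<le>n. \<exists>b\<le>n. order_code W s n a b) \<longleftrightarrow> (\<exists>a b. order_code W s n a b)" for W s n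
    unfolding order_code_def using le_codes by blast
  ultimately have "decidable (\<lambda>X n. \<exists>a b. order_code {a. P X a} (r X) n a b)" by simp
  then obtain \<Phi> where "\<And>X n. run X \<Phi> n = Some (if \<exists>a b. order_code {a. P X a} (r X) n a b then 1 else 0)"
    unfolding decidable_def recursive_def by blast
  then show ?thesis
    by (intro exI[of _ \<Phi>]) (simp add: turing_image_def computes_char_fun_def code_diagram_order)
qed

section \<open>Criteria for embeddings into a pair of orders\<close>

lemma isomorphic_diagram_eq:
  assumes "diagram order_lang S = diagram order_lang T"
  shows "isomorphic order_lang S T"
proof -
  have univ: "universe S = universe T" using assms eqc_in_diagram by (metis set_eqI)
  have "lt S x y \<longleftrightarrow> lt T x y" if "x \<in> universe S" "y \<in> universe S" for x y
    using ltc_in_diagram[of x y S] ltc_in_diagram[of x y T] univ that assms by simp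
  then show ?thesis unfolding isomorphic_order order_iso_def univ by (intro exI[of _ id]) auto
qed

text \<open>\<open>embedding\<close> speaks of all images of a structure, the hypotheses of some
  image. Two images of one structure have the same diagram and are therefore isomorphic, so every
  image lies in the expected isomorphism class, and the equivalence follows by comparing
  classes.\<close>

lemma embedding_pairI:
  assumes A: "is_structure L A" and B: "is_structure L B" and AB: "\<not> isomorphic L A B"
    and CD: "\<not> isomorphic order_lang C D" and C: "is_structure order_lang C"
    and imgA: "\<And>S. is_structure L S \<Longrightarrow> isomorphic L S A \<Longrightarrow>
      \<exists>T. is_structure order_lang T \<and> isomorphic order_lang T C \<and> F S T"
    and imgB: "\<And>S. is_structure L S \<Longrightarrow> isomorphic L S B \<Longrightarrow>
      \<exists>T. is_structure order_lang T \<and> isomorphic order_lang T D \<and> F S T"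
    and F: "\<And>S T T'. F S T \<Longrightarrow> F S T' \<Longrightarrow> diagram order_lang T = diagram order_lang T'"
  shows "embedding L (pair_class L A B) order_lang (pair_class order_lang C D) F"
  unfolding embedding_def
proof (intro conjI ballI impI)
  fix S assume "S \<in> pair_class L A B"
  then show "\<exists>T\<in>pair_class order_lang C D. F S T"
    using imgA[of S] imgB[of S] unfolding pair_class_def by blast
next
  fix S1 S2 T1 T2
  assume S: "S1 \<in> pair_class L A B" "S2 \<in> pair_class L A B" and T: "F S1 T1" "F S2 T2"
  have str: "is_structure L S1" "is_structure L S2" using S by (auto simp: pair_class_def)
  have sym: "isomorphic order_lang T S" if "isomorphic order_lang S T" for S T
    using that order_iso_sym unfolding isomorphic_order by blast
  have image: "isomorphic order_lang T C" if "is_structure L S" "isomorphic L S A" "F S T" for S T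
    using imgA[OF that(1,2)] F[OF that(3)] isomorphic_diagram_eq isomorphic_trans by metis
  have image': "isomorphic order_lang T D" if "is_structure L S" "isomorphic L S B" "F S T" for S T
    using imgB[OF that(1,2)] F[OF that(3)] isomorphic_diagram_eq isomorphic_trans by metis
  consider "isomorphic L S1 A" "isomorphic L S2 A" | "isomorphic L S1 B" "isomorphic L S2 B"
    | "isomorphic L S1 A" "isomorphic L S2 B" | "isomorphic L S1 B" "isomorphic L S2 A"
    using S by (auto simp: pair_class_def)
  then show "isomorphic L S1 S2 \<longleftrightarrow> isomorphic order_lang T1 T2"
  proof cases
    case 1
    then show ?thesis
      using isomorphic_trans[OF 1(1) isomorphic_sym[OF str(2) 1(2)]]
        isomorphic_trans[OF image[OF str(1) 1(1) T(1)] sym[OF image[OF str(2) 1(2) T(2)]]] by simp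
  next
    case 2
    then show ?thesis
      using isomorphic_trans[OF 2(1) isomorphic_sym[OF str(2) 2(2)]]
        isomorphic_trans[OF image'[OF str(1) 2(1) T(1)] sym[OF image'[OF str(2) 2(2) T(2)]]] by simp
  next
    case 3
    have "\<not> isomorphic L S1 S2"
      using AB isomorphic_trans[OF isomorphic_sym[OF str(1) 3(1)]] isomorphic_trans[OF _ 3(2)] by blast
    moreover have "\<not> isomorphic order_lang T1 T2"
      using CD isomorphic_trans[OF sym[OF image[OF str(1) 3(1) T(1)]]]
        isomorphic_trans[OF _ image'[OF str(2) 3(2) T(2)]] by blast
    ultimately show ?thesis by simp
  next
    case 4
    have "\<not> isomorphic L S1 S2"
      using AB isomorphic_sym[OF str(1), of S2] isomorphic_trans[OF isomorphic_sym[OF str(2) 4(2)]]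
        isomorphic_trans[OF _ 4(1)] by blast
    moreover have "\<not> isomorphic order_lang T1 T2"
      using CD sym isomorphic_trans[OF sym[OF image[OF str(2) 4(2) T(2)]]]
        isomorphic_trans[OF _ image'[OF str(1) 4(1) T(1)]] by blast
    ultimately show ?thesis by simp
  qed
qed

lemma isomorphic_refl: "isomorphic L S S"
  unfolding isomorphic_def by (rule exI[of _ id]) simp

lemma computes_char_fun_unique:
  assumes "computes_char_fun p X Y" "computes_char_fun p X Z"
  shows "Y = Z"
proof (rule set_eqI)
  fix n
  have "run X p n = Some (if n \<in> Y then 1 else 0)" "run X p n = Some (if n \<in> Z then 1 else 0)"
    using assms unfolding computes_char_fun_def by blast+
  then have "Some (if n \<in> Y then 1 else 0 :: nat) = Some (if n \<in> Z then 1 else 0)"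
    by (rule trans[OF sym])
  then show "n \<in> Y \<longleftrightarrow> n \<in> Z" by (cases "n \<in> Y"; cases "n \<in> Z") simp_all
qed

lemma turing_image_unique:
  assumes "turing_image \<Phi> L L' S T" "turing_image \<Phi> L L' S T'"
  shows "diagram L' T = diagram L' T'"
  using computes_char_fun_unique[OF assms[unfolded turing_image_def]]
  by (rule inj_image_eq_iff[OF inj_code_basic, THEN iffD1])

lemma tc_reducibleI:
  assumes "is_structure L A" "is_structure L B" "\<not> isomorphic L A B"
    "\<not> isomorphic order_lang C D" "is_structure order_lang C"
    "\<And>S. is_structure L S \<Longrightarrow> isomorphic L S A \<Longrightarrow>
      \<exists>T. is_structure order_lang T \<and> isomorphic order_lang T C \<and> turing_image \<Phi> L order_lang S T"
    "\<And>S. is_structure L S \<Longrightarrow> isomorphic L S B \<Longrightarrow>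
      \<exists>T. is_structure order_lang T \<and> isomorphic order_lang T D \<and> turing_image \<Phi> L order_lang S T"
  shows "tc_reducible L A B order_lang C D"
  unfolding tc_reducible_def turing_embedding_def
proof (intro exI[of _ \<Phi>] conjI)
  show "embedding L (pair_class L A B) order_lang (pair_class order_lang C D) (turing_image \<Phi> L order_lang)"
  proof (rule embedding_pairI[OF assms(1-5)])
    fix S assume "is_structure L S" "isomorphic L S A"
    then show "\<exists>T. is_structure order_lang T \<and> isomorphic order_lang T C \<and> turing_image \<Phi> L order_lang S T"
      by (rule assms(6))
  next
    fix S assume "is_structure L S" "isomorphic L S B"
    then show "\<exists>T. is_structure order_lang T \<and> isomorphic order_lang T D \<and> turing_image \<Phi> L order_lang S T"
      by (rule assms(7))
  next
    fix S T T' assume "turing_image \<Phi> L order_lang S T" "turing_image \<Phi> L order_lang S T'"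
    then show "diagram order_lang T = diagram order_lang T'" by (rule turing_image_unique)
  qed
  show "\<exists>T. is_structure order_lang T \<and> isomorphic order_lang T C \<and> turing_image \<Phi> L order_lang A T"
    by (rule assms(6)[OF assms(1) isomorphic_refl])
  show "\<exists>T. is_structure order_lang T \<and> isomorphic order_lang T D \<and> turing_image \<Phi> L order_lang B T"
    by (rule assms(7)[OF assms(2) isomorphic_refl])
qed

lemma type_omega_not_conversep: "type_omega W r \<Longrightarrow> \<not> type_omega W r\<inverse>\<inverse>"
proof
  assume W: "type_omega W r" "type_omega W r\<inverse>\<inverse>"
  then have "infinite W" by (simp add: type_omega_def)
  then obtain x where x: "x \<in> W" by fastforce
  have "W \<subseteq> {y \<in> W. r y x} \<union> {y \<in> W. r x y} \<union> {x}"
    using W(1) x unfolding type_omega_def linear_on_def by blast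
  moreover have "finite ({y \<in> W. r y x} \<union> {y \<in> W. r x y} \<union> {x})"
    using W x by (simp add: type_omega_def)
  ultimately show False using \<open>infinite W\<close> finite_subset by blast
qed

lemma has_least_not_unbounded:
  assumes "linear_on W r" "has_least W r" shows "\<not> unbounded W r\<inverse>\<inverse>"
proof
  assume unb: "unbounded W r\<inverse>\<inverse>"
  obtain m where m: "m \<in> W" "\<forall>x\<in>W. x \<noteq> m \<longrightarrow> r m x" using assms(2) by (auto simp: has_least_def)
  then obtain y where y: "y \<in> W" "r y m" using unb by (auto simp: unbounded_def)
  then show False
    using m linear_onD(1)[OF assms(1), of m] linear_onD(4)[OF assms(1), of y m] by (cases "y = m") auto
qed

lemma not_isomorphic_omega: "\<not> isomorphic order_lang omega omega_star"
  unfolding isomorphic_omega_star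
  by (rule type_omega_not_conversep) (rule isomorphic_refl[of order_lang omega, unfolded isomorphic_omega])

lemma not_isomorphic_eta: "\<not> isomorphic order_lang one_plus_eta eta_plus_one"
proof -
  have "type_1eta (universe one_plus_eta) (lt one_plus_eta)"
    by (rule isomorphic_refl[of order_lang one_plus_eta, unfolded isomorphic_one_plus_eta])
  then have "\<not> unbounded (universe one_plus_eta) (lt one_plus_eta)\<inverse>\<inverse>"
    by (intro has_least_not_unbounded) (simp_all add: type_1eta_def)
  then show ?thesis by (simp add: isomorphic_eta_plus_one type_1eta_def)
qed

lemma is_structure_orders:
  "is_structure order_lang omega" "is_structure order_lang omega_star"
  "is_structure order_lang one_plus_eta" "is_structure order_lang eta_plus_one"
  by (simp_all add: omega_def omega_star_def one_plus_eta_def eta_plus_one_def is_structure_order_struct)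

section \<open>The Turing reduction of the dense pair to the discrete pair\<close>

text \<open>The comparison \<open>a < s\<close> is that of numbers: \<open>s\<close> exceeds all
  elements listed before it when \<open>S\<close> is listed in numerical order.\<close>

definition newmax :: "nat set \<Rightarrow> (nat \<Rightarrow> nat \<Rightarrow> bool) \<Rightarrow> nat \<Rightarrow> bool" where
  "newmax S r s \<longleftrightarrow> (\<forall>a<s. a \<in> S \<longrightarrow> r a s)"

abbreviation newmin :: "nat set \<Rightarrow> (nat \<Rightarrow> nat \<Rightarrow> bool) \<Rightarrow> nat \<Rightarrow> bool" where
  "newmin S r \<equiv> newmax S r\<inverse>\<inverse>"

text \<open>
  In a copy of \<open>1 + \<eta>\<close> no number beyond the least element is a new minimum, so that all but
  finitely many records form an increasing sequence.
\<close>

definition records :: "nat set \<Rightarrow> (nat \<Rightarrow> nat \<Rightarrow> bool) \<Rightarrow> nat set" where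
  "records S r = {s \<in> S. newmax S r s \<or> newmin S r s}"

lemma records_conversep: "records S r\<inverse>\<inverse> = records S r"
  unfolding records_def by auto

lemma linear_on_subset: "linear_on S r \<Longrightarrow> T \<subseteq> S \<Longrightarrow> linear_on T r"
  unfolding linear_on_def by (meson subsetD)

lemma unbounded_finite:
  assumes "linear_on S r" "unbounded S r" "finite A" "A \<subseteq> S" "S \<noteq> {}"
  shows "\<exists>y\<in>S. \<forall>a\<in>A. r a y"
proof (cases "A = {}")
  case True
  then show ?thesis using assms(5) by auto
next
  case False
  then obtain m where m: "m \<in> A" "\<forall>x\<in>A. x \<noteq> m \<longrightarrow> r x m"
    using linear_on_finite_extremum[of S "r\<inverse>\<inverse>" A] assms(1,3,4) by auto
  then obtain y where y: "y \<in> S" "r m y" using assms(2,4) unfolding unbounded_def by blast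
  have "r a y" if "a \<in> A" for a
    using m y that assms(4) linear_onD(2)[OF assms(1), of a m y] by (cases "a = m") auto
  then show ?thesis using y by blast
qed

lemma unbounded_infinite:
  assumes "linear_on S r" "unbounded S r" "S \<noteq> {}" shows "infinite S"
proof
  assume "finite S"
  then obtain y where "y \<in> S" "\<forall>a\<in>S. r a y" using unbounded_finite[OF assms(1,2)] assms(3) by blast
  then show False using linear_onD(1)[OF assms(1)] by blast
qed

text \<open>Take for \<open>t\<close> the first element that exceeds all elements listed up to
  \<open>s\<close>. An element listed between \<open>s\<close> and \<open>t\<close> fails this, so
  it lies below one listed up to \<open>s\<close>, and hence below \<open>t\<close>.\<close>

lemma newmax_above:
  assumes lin: "linear_on S r" and unb: "unbounded S r" and s: "s \<in> S"
  obtains t where "t \<in> S" "newmax S r t" "r s t"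
proof -
  define Z where "Z = {t \<in> S. \<forall>a\<in>S. a \<le> s \<longrightarrow> r a t}"
  have "\<exists>y\<in>S. \<forall>a\<in>{a \<in> S. a \<le> s}. r a y"
    using s by (intro unbounded_finite[OF lin unb]) auto
  then have ex: "\<exists>t. t \<in> Z" by (auto simp: Z_def)
  define t where "t = (LEAST t. t \<in> Z)"
  have t: "t \<in> Z" unfolding t_def using ex by (rule LeastI_ex)
  have least: "a \<notin> Z" if "a < t" for a using that unfolding t_def by (rule not_less_Least)
  have tS: "t \<in> S" and below: "\<And>a. a \<in> S \<Longrightarrow> a \<le> s \<Longrightarrow> r a t" using t by (auto simp: Z_def)
  have "r a t" if a: "a < t" "a \<in> S" for a
  proof (cases "a \<le> s")
    case True
    then show ?thesis using below a by simp
  next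
    case False
    obtain b where b: "b \<in> S" "b \<le> s" "\<not> r b a" using least[OF a(1)] a(2) by (auto simp: Z_def)
    then have "r a b" using linear_onD(3)[OF lin, of a b] a False by auto
    then show ?thesis using linear_onD(2)[OF lin, of a b t] below[OF b(1,2)] b(1) a(2) tS by simp
  qed
  then have "newmax S r t" by (simp add: newmax_def)
  then show thesis using that[of t] tS below[OF s] by simp
qed

lemma type_omega_records:
  assumes lin: "linear_on S r" and least: "has_least S r" and unb: "unbounded S r"
  shows "type_omega (records S r) r"
proof -
  have sub: "records S r \<subseteq> S" by (auto simp: records_def)
  then have lin': "linear_on (records S r) r" using lin linear_on_subset by blast
  obtain m where m: "m \<in> S" "\<forall>x\<in>S. x \<noteq> m \<longrightarrow> r m x" using least by (auto simp: has_least_def)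
  have "unbounded (records S r) r"
    unfolding unbounded_def
  proof
    fix x assume "x \<in> records S r"
    then show "\<exists>y\<in>records S r. r x y"
      using newmax_above[OF lin unb, of x] sub by (metis (mono_tags, lifting) mem_Collect_eq records_def subsetD)
  qed
  moreover have "records S r \<noteq> {}"
    using newmax_above[OF lin unb m(1)] by (auto simp: records_def)
  ultimately have "infinite (records S r)" using unbounded_infinite lin' by blast
  moreover have "finite {y \<in> records S r. r y x}" if x: "x \<in> records S r" for x
  proof -
    \<comment> \<open>A record listed after both \<open>x\<close> and the least element
      \<open>m\<close> does not lie below \<open>m\<close> and so is no new minimum; it is a new
      maximum and lies above \<open>x\<close>.\<close>
    have "y \<le> max x m" if y: "y \<in> records S r" "r y x" for y
    proof (rule ccontr)
      assume "\<not> y \<le> max x m"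
      then have "r x y \<or> r y m"
        using y(1) x m(1) by (auto simp: records_def newmax_def)
      moreover have "\<not> r x y" using linear_onD(4)[OF lin] y x sub by blast
      moreover have "\<not> r y m"
        using m linear_onD(1)[OF lin m(1)] linear_onD(4)[OF lin, of y m] y(1) sub by (cases "y = m") auto
      ultimately show False by blast
    qed
    then have "{y \<in> records S r. r y x} \<subseteq> {..max x m}" by auto
    then show ?thesis using finite_subset by blast
  qed
  ultimately show ?thesis using lin' by (simp add: type_omega_def)
qed

lemma order_iso_cong:
  assumes "\<And>x y. x \<in> W \<Longrightarrow> y \<in> W \<Longrightarrow> r x y \<longleftrightarrow> s x y"
  shows "order_iso W r W s" "order_iso W r\<inverse>\<inverse> W s\<inverse>\<inverse>"
  unfolding order_iso_def using assms by (auto intro!: exI[of _ id])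

text \<open>Reversing the order leaves the set of records unchanged, so the one operator that keeps
  the records serves both structures of the pair.\<close>

lemma tc_reducible_eta_omega:
  "tc_reducible order_lang one_plus_eta eta_plus_one order_lang omega omega_star"
proof -
  define r where "r X a b \<longleftrightarrow> ltc a b \<in> X" for X a b
  define P where "P X a \<longleftrightarrow> eqc a a \<in> X \<and>
      ((\<forall>b<a. eqc b b \<in> X \<longrightarrow> r X b a) \<or> (\<forall>b<a. eqc b b \<in> X \<longrightarrow> r X a b))" for X a
  have "decidable P" unfolding P_def r_def by (intro recursive_intros)
  moreover have "decidable (\<lambda>X n. r X (p1 n) (p2 n))" unfolding r_def by (intro recursive_intros)
  ultimately obtain \<Phi> where \<Phi>: "\<And>L S X. X = dcode L S \<Longrightarrow>
      turing_image \<Phi> L order_lang S (ord {a. P X a} (r X))"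
    using turing_operator_order[of P r] by auto
  define T where "T S = (let X = dcode order_lang S in ord {a. P X a} (r X))" for S
  have img: "turing_image \<Phi> order_lang order_lang S (T S)" for S
    unfolding T_def Let_def by (rule \<Phi>) simp
  have r: "r (dcode order_lang S) a b \<longleftrightarrow> lt S a b"
    if "a \<in> universe S" "b \<in> universe S" for S a b
    using that by (simp add: r_def ltc_in_diagram)
  have univ: "universe (T S) = records (universe S) (lt S)" for S
    unfolding T_def Let_def ord_simps P_def records_def newmax_def eqc_in_diagram by (auto simp: r)
  have iso: "order_iso (universe (T S)) (lt (T S)) (records (universe S) (lt S)) (lt S)"
    "order_iso (universe (T S)) (lt (T S))\<inverse>\<inverse> (records (universe S) (lt S)) (lt S)\<inverse>\<inverse>" for S
    unfolding univ by (rule order_iso_cong; simp add: T_def Let_def r records_def)+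
  show ?thesis
  proof (rule tc_reducibleI[OF is_structure_orders(3,4) not_isomorphic_eta not_isomorphic_omega is_structure_orders(1)])
    fix S assume "isomorphic order_lang S one_plus_eta"
    then have "type_omega (records (universe S) (lt S)) (lt S)"
      unfolding isomorphic_one_plus_eta type_1eta_def using type_omega_records by blast
    then have T: "type_omega (universe (T S)) (lt (T S))" using type_omega_iso[OF iso(1)] by blast
    then have "universe (T S) \<noteq> {}" by (auto simp: type_omega_def)
    then show "\<exists>T. is_structure order_lang T \<and> isomorphic order_lang T omega \<and>
        turing_image \<Phi> order_lang order_lang S T"
      using img T by (intro exI[of _ "T S"]) (simp add: is_structure_order isomorphic_omega)
  next
    fix S assume "isomorphic order_lang S eta_plus_one"
    then have "type_omega (records (universe S) (lt S)\<inverse>\<inverse>) (lt S)\<inverse>\<inverse>"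
      unfolding isomorphic_eta_plus_one type_1eta_def using type_omega_records by blast
    then have T: "type_omega (universe (T S)) (lt (T S))\<inverse>\<inverse>"
      unfolding records_conversep using type_omega_iso[OF iso(2)] by blast
    then have "universe (T S) \<noteq> {}" by (auto simp: type_omega_def)
    then show "\<exists>T. is_structure order_lang T \<and> isomorphic order_lang T omega_star \<and>
        turing_image \<Phi> order_lang order_lang S T"
      using img T by (intro exI[of _ "T S"]) (simp add: is_structure_order isomorphic_omega_star)
  qed
qed

section \<open>Sums of rational half-lines\<close>

text \<open>Ranges over all non-negative rationals; the successor avoids the denominator 0.\<close>

definition val :: "nat \<Rightarrow> rat" where
  "val c = of_nat (p1 c) / of_nat (Suc (p2 c))"

text \<open>A rational has many codes; the least one represents it, so that distinct elements of a
  half-line have distinct values.\<close>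

definition canon :: "nat \<Rightarrow> bool" where
  "canon c \<longleftrightarrow> (\<forall>d<c. val d \<noteq> val c)"

text \<open>Cross multiplication brings the comparison of rationals down to natural numbers and so
  makes it decidable.\<close>

lemma val_less_iff: "val c < val d \<longleftrightarrow> p1 c * Suc (p2 d) < p1 d * Suc (p2 c)"
proof -
  have "val c < val d \<longleftrightarrow>
      (of_nat (p1 c) * of_nat (Suc (p2 d)) :: rat) < of_nat (p1 d) * of_nat (Suc (p2 c))"
    unfolding val_def by (simp add: divide_less_eq less_divide_eq mult.commute del: of_nat_Suc)
  then show ?thesis by (simp only: of_nat_less_iff flip: of_nat_mult)
qed

lemma val_eq_iff: "val c = val d \<longleftrightarrow> p1 c * Suc (p2 d) = p1 d * Suc (p2 c)"
  using val_less_iff[of c d] val_less_iff[of d c] by (cases "val c" "val d" rule: linorder_cases) simp_all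

lemma val_nonneg: "0 \<le> val c"
  by (simp add: val_def)

lemma recursive_val [recursive_intros]:
  assumes "recursive f" "recursive g"
  shows "decidable (\<lambda>X n. val (f X n) < val (g X n))" "decidable (\<lambda>X n. val (f X n) = val (g X n))"
  unfolding val_less_iff val_eq_iff by (intro recursive_intros assms)+

lemma decidable_canon [recursive_intros]:
  assumes "recursive f" shows "decidable (\<lambda>X n. canon (f X n))"
proof -
  have "decidable (\<lambda>X n. canon n)" unfolding canon_def by (intro recursive_intros)
  then show ?thesis using assms by (rule decidable_comp)
qed

lemma canon_ex:
  assumes "0 \<le> q" obtains c where "canon c" "val c = q"
proof -
  obtain a b where ab: "quotient_of q = (a, b)" by force
  have b: "b > 0" using quotient_of_denom_pos[OF ab] .
  have q: "q = of_int a / of_int b" using quotient_of_div[OF ab] .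
  have a: "a \<ge> 0" using assms b unfolding q by (simp add: zero_le_divide_iff)
  have "val (prod_encode (nat a, nat b - 1)) = q"
    using a b unfolding val_def q by (simp add: of_nat_diff)
  then have ex: "\<exists>c. val c = q" by blast
  define c where "c = (LEAST c. val c = q)"
  have "val c = q" unfolding c_def using ex by (rule LeastI_ex)
  moreover have "val d \<noteq> q" if "d < c" for d using that unfolding c_def by (rule not_less_Least)
  ultimately show thesis by (intro that[of c]) (auto simp: canon_def)
qed

lemma canon_inject: "canon c \<Longrightarrow> canon d \<Longrightarrow> val c = val d \<Longrightarrow> c = d"
  unfolding canon_def by (cases c d rule: linorder_cases) auto

lemma linear_on_lex:
  fixes g :: "'a \<Rightarrow> rat"
  assumes lin: "linear_on W r" and f: "f ` V \<subseteq> W"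
    and inj: "\<And>m n. m \<in> V \<Longrightarrow> n \<in> V \<Longrightarrow> f m = f n \<Longrightarrow> g m = g n \<Longrightarrow> m = n"
  shows "linear_on V (\<lambda>m n. r (f m) (f n) \<or> f m = f n \<and> g m < g n)"
proof -
  have fW: "f m \<in> W" if "m \<in> V" for m using f that by blast
  show ?thesis
    unfolding linear_on_def
  proof (intro conjI ballI impI)
    fix x assume "x \<in> V"
    then show "\<not> (r (f x) (f x) \<or> f x = f x \<and> g x < g x)" using linear_onD(1)[OF lin, of "f x"] fW by simp
  next
    fix x y z assume V: "x \<in> V" "y \<in> V" "z \<in> V" and xy: "r (f x) (f y) \<or> f x = f y \<and> g x < g y"
      and yz: "r (f y) (f z) \<or> f y = f z \<and> g y < g z"
    have "r (f x) (f y) \<Longrightarrow> r (f y) (f z) \<Longrightarrow> r (f x) (f z)"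
      using linear_onD(2)[OF lin] fW[OF V(1)] fW[OF V(2)] fW[OF V(3)] by blast
    then show "r (f x) (f z) \<or> f x = f z \<and> g x < g z"
      using xy yz by (elim disjE conjE) auto
  next
    fix x y assume V: "x \<in> V" "y \<in> V" "x \<noteq> y"
    show "(r (f x) (f y) \<or> f x = f y \<and> g x < g y) \<or> (r (f y) (f x) \<or> f y = f x \<and> g y < g x)"
    proof (cases "f x = f y")
      case True
      then have "g x \<noteq> g y" using inj[OF V(1,2)] V(3) by blast
      then show ?thesis using True by (metis neq_iff)
    next
      case False
      then show ?thesis using linear_onD(3)[OF lin False fW[OF V(1)] fW[OF V(2)]] by blast
    qed
  qed
qed

lemma canon_eqI:
  assumes "p1 m = p1 n" "canon (p2 m)" "canon (p2 n)" "val (p2 m) = val (p2 n)"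
  shows "m = n"
proof -
  have "p2 m = p2 n" by (rule canon_inject[OF assms(2-4)])
  then have "prod_encode (p1 m, p2 m) = prod_encode (p1 n, p2 n)" using assms(1) by (simp only:)
  then show ?thesis by (simp only: encode_p1_p2)
qed

definition lex_less :: "(nat \<Rightarrow> nat \<Rightarrow> bool) \<Rightarrow> nat \<Rightarrow> nat \<Rightarrow> bool" where
  "lex_less r m n \<longleftrightarrow> r (p1 m) (p1 n) \<or> p1 m = p1 n \<and> val (p2 m) < val (p2 n)"

text \<open>The carrier of the sum, along \<open>A\<close>, of copies of the rational half-line [0,
  \<infinity>).\<close>

definition rays :: "nat set \<Rightarrow> nat set" where
  "rays A = {m. p1 m \<in> A \<and> canon (p2 m)}"

lemma rays_ex:
  assumes "p \<in> A" "0 \<le> q" shows "\<exists>m\<in>rays A. p1 m = p \<and> val (p2 m) = q"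
proof -
  obtain c where "canon c" "val c = q" by (rule canon_ex[OF assms(2)])
  then show ?thesis using assms(1) by (intro bexI[of _ "prod_encode (p, c)"]) (simp_all add: rays_def)
qed

lemma linear_on_rays:
  assumes "linear_on A r" shows "linear_on (rays A) (lex_less r)"
proof -
  have eq: "lex_less r = (\<lambda>m n. r (p1 m) (p1 n) \<or> p1 m = p1 n \<and> val (p2 m) < val (p2 n))"
    by (simp add: lex_less_def fun_eq_iff)
  show ?thesis unfolding eq
  proof (rule linear_on_lex[OF assms])
    show "p1 ` rays A \<subseteq> A" unfolding rays_def by blast
    fix m n assume mn: "m \<in> rays A" "n \<in> rays A" "p1 m = p1 n" "val (p2 m) = val (p2 n)"
    have "canon (p2 m)" "canon (p2 n)" using mn(1,2) unfolding rays_def by blast+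
    then show "m = n" using canon_eqI mn(3,4) by blast
  qed
qed

lemma rays_between:
  assumes "x \<in> rays A" "val (p2 x) < q"
  shows "\<exists>z\<in>rays A. p1 z = p1 x \<and> val (p2 z) = q"
proof -
  have "0 \<le> q" using assms(2) val_nonneg[of "p2 x"] by linarith
  moreover have "p1 x \<in> A" using assms(1) unfolding rays_def by blast
  ultimately show ?thesis using rays_ex by blast
qed

lemma unbounded_rays: "unbounded (rays A) (lex_less r)"
  unfolding unbounded_def
proof
  fix x assume x: "x \<in> rays A"
  have "\<exists>z\<in>rays A. p1 z = p1 x \<and> val (p2 z) = val (p2 x) + 1"
    by (rule rays_between[OF x]) simp
  then obtain z where "z \<in> rays A" "p1 z = p1 x" "val (p2 z) = val (p2 x) + 1" by blast
  then show "\<exists>y\<in>rays A. lex_less r x y" by (intro bexI[of _ z]) (simp_all add: lex_less_def)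
qed

text \<open>Elements of different half-lines are separated by going further up in the lower
  half-line, which has no greatest element; within one half-line the rationals are dense.\<close>

lemma dense_on_rays: "dense_on (rays A) (lex_less r)"
  unfolding dense_on_def
proof (intro ballI impI)
  fix x y assume x: "x \<in> rays A" and y: "y \<in> rays A" and xy: "lex_less r x y"
  show "\<exists>z\<in>rays A. lex_less r x z \<and> lex_less r z y"
  proof (cases "r (p1 x) (p1 y)")
    case True
    have "\<exists>z\<in>rays A. p1 z = p1 x \<and> val (p2 z) = val (p2 x) + 1"
      by (rule rays_between[OF x]) simp
    then obtain z where "z \<in> rays A" "p1 z = p1 x" "val (p2 z) = val (p2 x) + 1" by blast
    then show ?thesis using True by (intro bexI[of _ z]) (simp_all add: lex_less_def)
  next
    case False
    then have eq: "p1 x = p1 y" and less: "val (p2 x) < val (p2 y)" using xy by (simp_all add: lex_less_def)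
    obtain q where q: "val (p2 x) < q" "q < val (p2 y)" using dense[OF less] by blast
    obtain z where "z \<in> rays A" "p1 z = p1 x" "val (p2 z) = q" using rays_between[OF x q(1)] by blast
    then show ?thesis using q eq by (intro bexI[of _ z]) (simp_all add: lex_less_def)
  qed
qed

lemma has_least_rays:
  assumes "has_least (A) r" shows "has_least (rays A) (lex_less r)"
proof -
  obtain m where m: "m \<in> A" "\<forall>x\<in>A. x \<noteq> m \<longrightarrow> r m x"
    using assms unfolding has_least_def by blast
  obtain n where n: "n \<in> rays A" "p1 n = m" "val (p2 n) = 0" using rays_ex[OF m(1) order_refl] by blast
  have "lex_less r n x" if x: "x \<in> rays A" "x \<noteq> n" for x
  proof (cases "p1 x = m")
    case True
    have "canon (p2 x)" "canon (p2 n)" using x n unfolding rays_def by blast+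
    then have "val (p2 x) \<noteq> 0" using canon_eqI[of x n] True n x(2) by metis
    then have "0 < val (p2 x)" using val_nonneg[of "p2 x"] by linarith
    then show ?thesis using n True by (simp add: lex_less_def)
  next
    case False
    have "p1 x \<in> A" using x unfolding rays_def by blast
    then have "r m (p1 x)" using m(2) False by blast
    then show ?thesis using n by (simp add: lex_less_def)
  qed
  then show ?thesis unfolding has_least_def using n(1) by blast
qed

lemma no_least_rays:
  assumes "unbounded (A) r\<inverse>\<inverse>" shows "unbounded (rays A) (lex_less r)\<inverse>\<inverse>"
  unfolding unbounded_def
proof
  fix x assume "x \<in> rays A"
  then have "p1 x \<in> A" unfolding rays_def by blast
  then obtain p where p: "p \<in> A" "r p (p1 x)" using assms unfolding unbounded_def by blast
  obtain z where "z \<in> rays A" "p1 z = p" using rays_ex[OF p(1) order_refl] by blast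
  then show "\<exists>y\<in>rays A. (lex_less r)\<inverse>\<inverse> x y"
    using p(2) by (intro bexI[of _ z]) (simp_all add: lex_less_def)
qed

text \<open>The elements on side 1 carry the reverse of the order that \<open>s\<close> induces.\<close>

definition oless :: "(nat \<Rightarrow> nat \<Rightarrow> bool) \<Rightarrow> (nat \<Rightarrow> nat \<Rightarrow> bool) \<Rightarrow> nat \<Rightarrow> nat \<Rightarrow> bool" where
  "oless r s c d \<longleftrightarrow> p1 c < p1 d \<or> p1 c = p1 d \<and>
     (if p1 c = 0 then lex_less r (p2 c) (p2 d) else lex_less s (p2 d) (p2 c))"

definition sides :: "nat set \<Rightarrow> nat set \<Rightarrow> nat set" where
  "sides B C = {c. p1 c = 0 \<and> p2 c \<in> B \<or> p1 c = 1 \<and> p2 c \<in> C}"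

lemma sides_cases:
  assumes "c \<in> sides B C"
  obtains x where "c = prod_encode (0, x)" "x \<in> B" | x where "c = prod_encode (1, x)" "x \<in> C"
proof -
  have c: "c = prod_encode (p1 c, p2 c)" by simp
  consider "p1 c = 0" "p2 c \<in> B" | "p1 c = 1" "p2 c \<in> C" using assms unfolding sides_def by auto
  then show thesis
  proof cases
    case 1
    then show ?thesis using c by (intro that(1)[of "p2 c"]) simp_all
  next
    case 2
    then show ?thesis using c by (intro that(2)[of "p2 c"]) simp_all
  qed
qed

lemma sides_encode [simp]:
  "prod_encode (0, x) \<in> sides B C \<longleftrightarrow> x \<in> B" "prod_encode (Suc 0, x) \<in> sides B C \<longleftrightarrow> x \<in> C"
  by (simp_all add: sides_def)

lemma oless_encode [simp]:
  "oless r s (prod_encode (0, x)) (prod_encode (0, y)) \<longleftrightarrow> lex_less r x y"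
  "oless r s (prod_encode (Suc 0, x)) (prod_encode (Suc 0, y)) \<longleftrightarrow> lex_less s y x"
  "oless r s (prod_encode (0, x)) (prod_encode (Suc 0, y))"
  "\<not> oless r s (prod_encode (Suc 0, x)) (prod_encode (0, y))"
  by (simp_all add: oless_def)

lemma linear_on_sides:
  assumes B: "linear_on B (lex_less r)" and C: "linear_on C (lex_less s)"
  shows "linear_on (sides B C) (oless r s)"
  unfolding linear_on_def
proof (intro conjI ballI impI)
  fix c assume "c \<in> sides B C"
  then show "\<not> oless r s c c" by (cases rule: sides_cases) (simp_all add: linear_onD(1)[OF B] linear_onD(1)[OF C])
next
  fix c d e assume cde: "c \<in> sides B C" "d \<in> sides B C" "e \<in> sides B C" "oless r s c d" "oless r s d e"
  show "oless r s c e"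
    using cde(1)
  proof (cases rule: sides_cases)
    case c: (1 x)
    show ?thesis
      using cde(3)
    proof (cases rule: sides_cases)
      case e: (1 z)
      show ?thesis using cde(2)
      proof (cases rule: sides_cases)
        case (1 y)
        then show ?thesis using cde(4,5) c e linear_onD(2)[OF B, of x y z] by simp
      next
        case (2 y)
        then show ?thesis using cde(5) e by simp
      qed
    next
      case (2 z)
      then show ?thesis using c by simp
    qed
  next
    case c: (2 x)
    show ?thesis using cde(2)
    proof (cases rule: sides_cases)
      case (1 y)
      then show ?thesis using cde(4) c by simp
    next
      case d: (2 y)
      show ?thesis using cde(3)
      proof (cases rule: sides_cases)
        case (1 z)
        then show ?thesis using cde(5) d by simp
      next
        case (2 z)
        then show ?thesis using cde(4,5) c d linear_onD(2)[OF C, of z y x] by simp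
      qed
    qed
  qed
next
  fix c d assume cd: "c \<in> sides B C" "d \<in> sides B C" "c \<noteq> d"
  show "oless r s c d \<or> oless r s d c"
    using cd(1)
  proof (cases rule: sides_cases)
    case c: (1 x)
    show ?thesis using cd(2)
    proof (cases rule: sides_cases)
      case (1 y)
      then show ?thesis using c cd(3) linear_onD(3)[OF B, of x y] by auto
    next
      case (2 y)
      then show ?thesis using c by simp
    qed
  next
    case c: (2 x)
    show ?thesis using cd(2)
    proof (cases rule: sides_cases)
      case (1 y)
      then show ?thesis using c by simp
    next
      case (2 y)
      then show ?thesis using c cd(3) linear_onD(3)[OF C, of x y] by auto
    qed
  qed
qed

text \<open>At the junction of the two summands an intermediate element is taken from the lower one,
  which has no greatest element.\<close>

lemma dense_on_sides:
  assumes B: "dense_on B (lex_less r)" "unbounded B (lex_less r)" and C: "dense_on C (lex_less s)"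
  shows "dense_on (sides B C) (oless r s)"
  unfolding dense_on_def
proof (intro ballI impI)
  fix c d assume cd: "c \<in> sides B C" "d \<in> sides B C" "oless r s c d"
  show "\<exists>z\<in>sides B C. oless r s c z \<and> oless r s z d"
    using cd(1)
  proof (cases rule: sides_cases)
    case c: (1 x)
    show ?thesis using cd(2)
    proof (cases rule: sides_cases)
      case (1 y)
      then have "lex_less r x y" using c cd(3) by simp
      then obtain z where "z \<in> B" "lex_less r x z" "lex_less r z y"
        using B(1) c 1 unfolding dense_on_def by blast
      then show ?thesis using c 1 by (intro bexI[of _ "prod_encode (0, z)"]) simp_all
    next
      case (2 y)
      obtain z where "z \<in> B" "lex_less r x z" using B(2) c unfolding unbounded_def by blast
      then show ?thesis using c 2 by (intro bexI[of _ "prod_encode (0, z)"]) simp_all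
    qed
  next
    case c: (2 x)
    show ?thesis using cd(2)
    proof (cases rule: sides_cases)
      case (1 y)
      then show ?thesis using c cd(3) by simp
    next
      case (2 y)
      then have "lex_less s y x" using c cd(3) by simp
      then obtain z where "z \<in> C" "lex_less s y z" "lex_less s z x"
        using C c 2 unfolding dense_on_def by blast
      then show ?thesis using c 2 by (intro bexI[of _ "prod_encode (Suc 0, z)"]) simp_all
    qed
  qed
qed

lemma has_least_sides:
  assumes "has_least B (lex_less r)" shows "has_least (sides B C) (oless r s)"
proof -
  obtain m where m: "m \<in> B" "\<forall>x\<in>B. x \<noteq> m \<longrightarrow> lex_less r m x"
    using assms unfolding has_least_def by blast
  have "oless r s (prod_encode (0, m)) c" if c: "c \<in> sides B C" "c \<noteq> prod_encode (0, m)" for c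
    using c(1)
  proof (cases rule: sides_cases)
    case (1 x)
    then show ?thesis using m(2) c(2) by simp
  next
    case (2 x)
    then show ?thesis by simp
  qed
  then show ?thesis unfolding has_least_def using m(1) by (intro bexI[of _ "prod_encode (0, m)"]) simp_all
qed

lemma unbounded_sides:
  assumes "unbounded B (lex_less r)" "unbounded C (lex_less s)\<inverse>\<inverse>"
  shows "unbounded (sides B C) (oless r s)"
  unfolding unbounded_def
proof
  fix c assume "c \<in> sides B C"
  then show "\<exists>y\<in>sides B C. oless r s c y"
  proof (cases rule: sides_cases)
    case (1 x)
    then obtain y where "y \<in> B" "lex_less r x y" using assms(1) unfolding unbounded_def by blast
    then show ?thesis using 1 by (intro bexI[of _ "prod_encode (0, y)"]) simp_all
  next
    case (2 x)
    then obtain y where "y \<in> C" "lex_less s y x" using assms(2) unfolding unbounded_def by blast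
    then show ?thesis using 2 by (intro bexI[of _ "prod_encode (Suc 0, y)"]) simp_all
  qed
qed

text \<open>Reversing the sum exchanges its sides, which reduces the case of \<eta> + 1 to that of 1
  + \<eta>.\<close>

lemma order_iso_sides_swap: "order_iso (sides B C) (oless r s)\<inverse>\<inverse> (sides C B) (oless s r)"
proof -
  let ?h = "\<lambda>c. prod_encode (1 - p1 c, p2 c)"
  have "bij_betw ?h (sides B C) (sides C B)"
    by (rule bij_betw_byWitness[where f' = ?h]) (auto elim!: sides_cases)
  moreover have "(oless r s)\<inverse>\<inverse> c d \<longleftrightarrow> oless s r (?h c) (?h d)"
    if "c \<in> sides B C" "d \<in> sides B C" for c d
    using that by (elim sides_cases) simp_all
  ultimately show ?thesis unfolding order_iso_def by blast
qed

text \<open>The lower summand begins with the least half-line. The upper one is the reverse of a sum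
  of half-lines without a least element, so it has no greatest element.\<close>

lemma type_1eta_sides:
  assumes "linear_on A r" "linear_on C s" "has_least A r" "unbounded C s\<inverse>\<inverse>"
  shows "type_1eta (sides (rays A) (rays C)) (oless r s)"
  unfolding type_1eta_def
  by (intro conjI linear_on_sides linear_on_rays dense_on_sides dense_on_rays unbounded_rays
      has_least_sides has_least_rays unbounded_sides no_least_rays assms)

lemma type_1eta_sides_conversep:
  assumes "linear_on A r" "linear_on C s" "unbounded A r\<inverse>\<inverse>" "has_least C s"
  shows "type_1eta (sides (rays A) (rays C)) (oless r s)\<inverse>\<inverse>"
  using order_iso_sides_swap type_1eta_sides[OF assms(2,1,4,3)] by (rule type_1eta_iso)

lemma decidable_oless:
  assumes r: "decidable (\<lambda>X n. r X (p1 n) (p2 n))" and s: "decidable (\<lambda>X n. s X (p1 n) (p2 n))"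
    and "recursive f" "recursive g"
  shows "decidable (\<lambda>X n. oless (r X) (s X) (f X n) (g X n))"
proof -
  have "decidable (\<lambda>X n. oless (r X) (s X) (p1 n) (p2 n))"
    unfolding oless_def lex_less_def
    by (intro recursive_intros decidable_comp2[OF r] decidable_comp2[OF s])
  then show ?thesis using assms(3,4) by (rule decidable_comp2)
qed

section \<open>The Turing reduction of the discrete pair to the dense pair\<close>

lemma type_omega_ends:
  assumes "type_omega S r" shows "linear_on S r" "has_least S r" "unbounded S r"
proof -
  show lin: "linear_on S r" using assms by (simp add: type_omega_def)
  have fin: "finite {y \<in> S. r y x}" if "x \<in> S" for x
    using assms that by (simp add: type_omega_def)
  have inf: "infinite S" using assms by (simp add: type_omega_def)
  then obtain x where x: "x \<in> S" by fastforce
  let ?I = "insert x {y \<in> S. r y x}"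
  have "\<exists>m\<in>?I. \<forall>z\<in>?I. z \<noteq> m \<longrightarrow> r m z"
    using x fin by (intro linear_on_finite_extremum[OF lin]) auto
  then obtain m where m: "m \<in> ?I" "\<forall>z\<in>?I. z \<noteq> m \<longrightarrow> r m z" by blast
  have mS: "m \<in> S" and mx: "m = x \<or> r m x" using m(1) x by auto
  have "r m z" if z: "z \<in> S" "z \<noteq> m" for z
  proof (cases "z \<in> ?I")
    case True
    then show ?thesis using m(2) z(2) by blast
  next
    case False
    then have "r x z" using linear_onD(3)[OF lin, of x z] x z(1) by blast
    then show ?thesis using mx linear_onD(2)[OF lin _ _ mS x z(1)] by blast
  qed
  then show "has_least S r" using mS unfolding has_least_def by blast
  show "unbounded S r"
    unfolding unbounded_def
  proof
    fix x assume x: "x \<in> S"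
    have "finite (insert x {y \<in> S. r y x})" using fin[OF x] by simp
    then have "\<not> S \<subseteq> insert x {y \<in> S. r y x}" using inf finite_subset by blast
    then obtain y where "y \<in> S" "y \<noteq> x" "\<not> r y x" by blast
    then show "\<exists>y\<in>S. r x y" using linear_onD(3)[OF lin, of x y] x by blast
  qed
qed

lemma records_ends:
  assumes "type_omega S r"
  shows "has_least {s \<in> S. newmin S r s} r" "unbounded {s \<in> S. newmax S r s} r"
proof -
  note ends = type_omega_ends[OF assms]
  obtain m where m: "m \<in> S" "\<forall>x\<in>S. x \<noteq> m \<longrightarrow> r m x" using ends(2) unfolding has_least_def by blast
  then have "newmin S r m" by (simp add: newmax_def)
  then show "has_least {s \<in> S. newmin S r s} r" unfolding has_least_def using m by blast
  show "unbounded {s \<in> S. newmax S r s} r"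
    unfolding unbounded_def
  proof
    fix s assume "s \<in> {s \<in> S. newmax S r s}"
    then obtain t where "t \<in> S" "newmax S r t" "r s t"
      using newmax_above[OF ends(1,3), of s] by blast
    then show "\<exists>y\<in>{s \<in> S. newmax S r s}. r s y" by blast
  qed
qed

text \<open>
  Every new minimum contributes a copy of \<open>1 + \<eta>\<close> on the left, every new maximum a copy of
  \<open>\<eta> + 1\<close> on the right; the number first seen contributes both.
\<close>

definition omega_image :: "nat set \<Rightarrow> (nat \<Rightarrow> nat \<Rightarrow> bool) \<Rightarrow> nat set" where
  "omega_image S r = sides (rays {s \<in> S. newmin S r s}) (rays {s \<in> S. newmax S r s})"

text \<open>In \<omega> the least element is a new minimum, so the left side has a least element;
  there is no last new maximum, so the right side has no greatest element. In the reverse of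
  \<omega> the two kinds of records exchange their roles.\<close>

lemma type_1eta_omega_image:
  "type_omega S r \<Longrightarrow> type_1eta (omega_image S r) (oless r r\<inverse>\<inverse>)"
  "type_omega S r\<inverse>\<inverse> \<Longrightarrow> type_1eta (omega_image S r) (oless r r\<inverse>\<inverse>)\<inverse>\<inverse>"
proof -
  assume S: "type_omega S r"
  have "linear_on S r" using S by (simp add: type_omega_def)
  then have "linear_on {s \<in> S. newmin S r s} r" "linear_on {s \<in> S. newmax S r s} r"
    by (rule linear_on_subset, blast)+
  then show "type_1eta (omega_image S r) (oless r r\<inverse>\<inverse>)"
    unfolding omega_image_def using records_ends[OF S] by (intro type_1eta_sides) simp_all
next
  assume S: "type_omega S r\<inverse>\<inverse>"
  have "linear_on S r" using S by (simp add: type_omega_def)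
  then have "linear_on {s \<in> S. newmin S r s} r" "linear_on {s \<in> S. newmax S r s} r"
    by (rule linear_on_subset, blast)+
  then show "type_1eta (omega_image S r) (oless r r\<inverse>\<inverse>)\<inverse>\<inverse>"
    unfolding omega_image_def using records_ends[OF S] by (intro type_1eta_sides_conversep) simp_all
qed

lemma type_1eta_nonempty: "type_1eta W r \<Longrightarrow> W \<noteq> {}"
  by (auto simp: type_1eta_def has_least_def)

lemma tc_reducible_omega_eta:
  "tc_reducible order_lang omega omega_star order_lang one_plus_eta eta_plus_one"
proof -
  define s where "s X a b \<longleftrightarrow> ltc a b \<in> X" for X a b
  \<comment> \<open>\<open>c\<close> is read as (side, (element, code of a rational)); side 0 asks
    for a new minimum, side 1 for a new maximum.\<close>
  define P where "P X c \<longleftrightarrow> p1 c \<le> 1 \<and> eqc (p1 (p2 c)) (p1 (p2 c)) \<in> X \<and> canon (p2 (p2 c)) \<and>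
      (\<forall>b<p1 (p2 c). eqc b b \<in> X \<longrightarrow> (if p1 c = 0 then s X (p1 (p2 c)) b else s X b (p1 (p2 c))))" for X c
  define r where "r X = oless (s X) (s X)\<inverse>\<inverse>" for X
  have "decidable P" unfolding P_def s_def by (intro recursive_intros)
  moreover have "decidable (\<lambda>X n. r X (p1 n) (p2 n))"
    unfolding r_def
    by (intro decidable_oless; (unfold conversep_iff s_def)?; intro recursive_intros)
  ultimately obtain \<Phi> where \<Phi>: "\<And>L S X. X = dcode L S \<Longrightarrow>
      turing_image \<Phi> L order_lang S (ord {a. P X a} (r X))"
    using turing_operator_order[of P r] by auto
  define T where "T S = (let X = dcode order_lang S in ord {a. P X a} (r X))" for S
  have img: "turing_image \<Phi> order_lang order_lang S (T S)" for S
    unfolding T_def Let_def by (rule \<Phi>) simp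
  have s: "s (dcode order_lang S) a b \<longleftrightarrow> lt S a b"
    if "a \<in> universe S" "b \<in> universe S" for S a b
    using that by (simp add: s_def ltc_in_diagram)
  have univ: "universe (T S) = omega_image (universe S) (lt S)" for S
  proof (rule set_eqI)
    fix c
    have "c \<in> universe (T S) \<longleftrightarrow> p1 c \<le> 1 \<and> p1 (p2 c) \<in> universe S \<and> canon (p2 (p2 c)) \<and>
        (if p1 c = 0 then newmin (universe S) (lt S) (p1 (p2 c)) else newmax (universe S) (lt S) (p1 (p2 c)))"
      unfolding T_def Let_def ord_simps P_def eqc_in_diagram newmax_def mem_Collect_eq by (auto simp: s)
    also have "\<dots> \<longleftrightarrow> c \<in> omega_image (universe S) (lt S)"
      unfolding omega_image_def sides_def rays_def by (cases "p1 c = 0") (auto simp: le_Suc_eq)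
    finally show "c \<in> universe (T S) \<longleftrightarrow> c \<in> omega_image (universe S) (lt S)" .
  qed
  have less: "lt (T S) c d \<longleftrightarrow> oless (lt S) (lt S)\<inverse>\<inverse> c d"
    if "c \<in> omega_image (universe S) (lt S)" "d \<in> omega_image (universe S) (lt S)" for S c d
  proof -
    have "p1 (p2 c) \<in> universe S" "p1 (p2 d) \<in> universe S"
      using that unfolding omega_image_def sides_def rays_def by blast+
    then show ?thesis by (simp add: T_def Let_def r_def oless_def lex_less_def s)
  qed
  have iso: "order_iso (universe (T S)) (lt (T S)) (omega_image (universe S) (lt S)) (oless (lt S) (lt S)\<inverse>\<inverse>)"
    "order_iso (universe (T S)) (lt (T S))\<inverse>\<inverse> (omega_image (universe S) (lt S)) (oless (lt S) (lt S)\<inverse>\<inverse>)\<inverse>\<inverse>" for S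
    unfolding univ by (rule order_iso_cong; rule less; assumption)+
  show ?thesis
  proof (rule tc_reducibleI[OF is_structure_orders(1,2) not_isomorphic_omega not_isomorphic_eta is_structure_orders(3)])
    fix S assume "isomorphic order_lang S omega"
    then have T: "type_1eta (universe (T S)) (lt (T S))"
      unfolding isomorphic_omega using type_1eta_iso[OF iso(1)] type_1eta_omega_image(1) by blast
    then show "\<exists>T. is_structure order_lang T \<and> isomorphic order_lang T one_plus_eta \<and>
        turing_image \<Phi> order_lang order_lang S T"
      using img type_1eta_nonempty[OF T]
      by (intro exI[of _ "T S"]) (simp add: is_structure_order isomorphic_one_plus_eta)
  next
    fix S assume "isomorphic order_lang S omega_star"
    then have T: "type_1eta (universe (T S)) (lt (T S))\<inverse>\<inverse>"
      unfolding isomorphic_omega_star using type_1eta_iso[OF iso(2)] type_1eta_omega_image(2) by blast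
    then show "\<exists>T. is_structure order_lang T \<and> isomorphic order_lang T eta_plus_one \<and>
        turing_image \<Phi> order_lang order_lang S T"
      using img type_1eta_nonempty[OF T]
      by (intro exI[of _ "T S"]) (simp add: is_structure_order isomorphic_eta_plus_one)
  qed
qed

section \<open>Bounded evaluation with a finite oracle\<close>

text \<open>
  \<open>ev p l D n\<close> is \<open>Suc v\<close> if \<open>p\<close> returns \<open>v\<close> on \<open>n\<close> with the oracle \<open>set_decode D\<close>, all queries
  and unbounded searches staying below \<open>l\<close>, and \<open>0\<close> otherwise.
\<close>

primrec ev :: "prog \<Rightarrow> nat \<Rightarrow> nat \<Rightarrow> nat \<Rightarrow> nat" where
  "ev Zero l D n = Suc 0"
| "ev Succ l D n = Suc (Suc n)"
| "ev Left l D n = Suc (p1 n)"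
| "ev Right l D n = Suc (p2 n)"
| "ev Oracle l D n = (if n < l then Suc (if n \<in> set_decode D then 1 else 0) else 0)"
| "ev (Pair p q) l D n =
     (if ev p l D n = 0 \<or> ev q l D n = 0 then 0
      else Suc (prod_encode (ev p l D n - Suc 0, ev q l D n - Suc 0)))"
| "ev (Comp p q) l D n = (if ev q l D n = 0 then 0 else ev p l D (ev q l D n - Suc 0))"
| "ev (Prec p q) l D n =
     rec_nat (ev p l D (p1 n))
       (\<lambda>m v. if v = 0 then 0 else ev q l D (prod_encode (p1 n, prod_encode (m, v - Suc 0)))) (p2 n)"
| "ev (Mu p) l D n =
     rec_nat 1 (\<lambda>k v. if v = Suc 0 then
         (if ev p l D (prod_encode (n, k)) = 0 then 0
          else if ev p l D (prod_encode (n, k)) = Suc 0 then Suc (Suc k) else Suc 0) else v) l - Suc 0"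

lemma recursive_ev:
  assumes "recursive a" "recursive b" "recursive c"
  shows "recursive (\<lambda>X n. ev p (a X n) (b X n) (c X n))"
proof -
  have "recursive (\<lambda>X n. ev p (p1 n) (p1 (p2 n)) (p2 (p2 n)))"
  proof (induction p)
    case Zero
    show ?case unfolding ev.simps by (intro recursive_intros)
  next
    case Succ
    show ?case unfolding ev.simps by (intro recursive_intros)
  next
    case Left
    show ?case unfolding ev.simps by (intro recursive_intros)
  next
    case Right
    show ?case unfolding ev.simps by (intro recursive_intros)
  next
    case Oracle
    show ?case unfolding ev.simps by (intro recursive_intros)
  next
    case (Pair p q)
    show ?case unfolding ev.simps
      by (intro recursive_intros recursive_comp3[OF Pair(1)] recursive_comp3[OF Pair(2)])
  next
    case (Comp p q)
    show ?case unfolding ev.simps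
      by (intro recursive_intros recursive_comp3[OF Comp(1)] recursive_comp3[OF Comp(2)])
  next
    case (Prec p q)
    show ?case unfolding ev.simps
      by (intro recursive_intros recursive_comp3[OF Prec(1)] recursive_comp3[OF Prec(2)])
  next
    case (Mu p)
    show ?case unfolding ev.simps
      by (intro recursive_intros recursive_comp3[OF Mu])
  qed
  then show ?thesis using assms by (rule recursive_comp3)
qed

text \<open>The accumulator of the bounded search: 1 means that all values so far are positive, 0
  that an undetermined value was met first, and \<open>Suc (Suc k)\<close> that the first zero is at
  \<open>k\<close>. The final predecessor in \<open>ev\<close> turns an unfinished search into no
  answer.\<close>

lemma search_rec:
  fixes e :: "nat \<Rightarrow> nat" and l :: nat
  defines "s \<equiv> \<lambda>l. rec_nat 1 (\<lambda>k v. if v = Suc 0 then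
      (if e k = 0 then 0 else if e k = Suc 0 then Suc (Suc k) else Suc 0) else v) l"
  shows "(s l = Suc 0 \<longleftrightarrow> (\<forall>k<l. Suc 0 < e k)) \<and>
    (\<forall>k. s l = Suc (Suc k) \<longleftrightarrow> k < l \<and> e k = Suc 0 \<and> (\<forall>j<k. Suc 0 < e j))"
proof (induction l)
  case 0
  show ?case by (simp add: s_def)
next
  case (Suc l)
  have step: "s (Suc l) = (if s l = Suc 0 then
      (if e l = 0 then 0 else if e l = Suc 0 then Suc (Suc l) else Suc 0) else s l)"
    by (simp add: s_def)
  show ?case
  proof (cases "s l = Suc 0")
    case True
    then have all: "\<forall>k<l. Suc 0 < e k" using Suc by blast
    have uniq: "k = l" if "k < Suc l" "e k = Suc 0" for k
    proof (rule ccontr)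
      assume "k \<noteq> l"
      then have "Suc 0 < e k" using all that(1) by simp
      then show False using that(2) by simp
    qed
    have least: "(k < Suc l \<and> e k = Suc 0 \<and> (\<forall>j<k. Suc 0 < e j)) \<longleftrightarrow> k = l \<and> e l = Suc 0" for k
      using uniq[of k] all by blast
    have "(\<forall>k<Suc l. Suc 0 < e k) \<longleftrightarrow> Suc 0 < e l" using all less_Suc_eq by blast
    then show ?thesis unfolding step least using True by auto
  next
    case False
    then have "\<not> (\<forall>k<l. Suc 0 < e k)" using Suc by blast
    then obtain i where "i < l" "\<not> Suc 0 < e i" by blast
    then have least: "k < Suc l \<and> e k = Suc 0 \<and> (\<forall>j<k. Suc 0 < e j) \<longleftrightarrow>
        k < l \<and> e k = Suc 0 \<and> (\<forall>j<k. Suc 0 < e j)" for k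
      by (metis less_Suc_eq)
    have "\<not> (\<forall>k<Suc l. Suc 0 < e k)" using \<open>i < l\<close> \<open>\<not> Suc 0 < e i\<close> by (meson less_SucI)
    moreover have "s (Suc l) = s l" by (simp add: step False)
    ultimately show ?thesis unfolding least using False Suc by (simp; blast)
  qed
qed

lemma ev_Mu:
  "ev (Mu p) l D n = Suc v \<longleftrightarrow> v < l \<and> ev p l D (prod_encode (n, v)) = Suc 0 \<and>
     (\<forall>j<v. Suc 0 < ev p l D (prod_encode (n, j)))"
proof -
  have "ev (Mu p) l D n = Suc v \<longleftrightarrow> rec_nat 1 (\<lambda>k v. if v = Suc 0 then
         (if ev p l D (prod_encode (n, k)) = 0 then 0
          else if ev p l D (prod_encode (n, k)) = Suc 0 then Suc (Suc k) else Suc 0) else v) l = Suc (Suc v)"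
    unfolding ev.simps by linarith
  then show ?thesis using search_rec[where l = l and e = "\<lambda>k. ev p l D (prod_encode (n, k))"] by blast
qed

text \<open>All values before the witness are positive, so it is the \<open>LEAST\<close> number in
  the definition of \<open>run\<close>.\<close>

lemma run_Mu:
  "run X (Mu p) n = Some v \<longleftrightarrow> run X p (prod_encode (n, v)) = Some 0 \<and>
     (\<forall>j<v. \<exists>w. run X p (prod_encode (n, j)) = Some (Suc w))"
proof -
  let ?P = "\<lambda>k. run X p (prod_encode (n, k)) = Some 0 \<and>
     (\<forall>j<k. \<exists>w. run X p (prod_encode (n, j)) = Some (Suc w))"
  have least: "(LEAST k. run X p (prod_encode (n, k)) = Some 0) = k" if P: "?P k" for k
  proof (rule Least_equality)
    show "run X p (prod_encode (n, k)) = Some 0" using P by blast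
    fix j assume j: "run X p (prod_encode (n, j)) = Some 0"
    show "k \<le> j"
    proof (rule ccontr)
      assume "\<not> k \<le> j"
      then obtain w where "run X p (prod_encode (n, j)) = Some (Suc w)" using P by (auto simp: not_le)
      then show False using j by simp
    qed
  qed
  show ?thesis
  proof (cases "\<exists>k. ?P k")
    case True
    then obtain k where k: "?P k" by blast
    have "run X (Mu p) n = Some k" unfolding run.simps using True least[OF k] by simp
    moreover have "v = k" if "?P v" using least[OF k] least[OF that] by simp
    ultimately show ?thesis using k by (auto simp del: run.simps)
  next
    case False
    then have None: "run X (Mu p) n = None" unfolding run.simps by (rule if_not_P)
    show ?thesis using False by (auto simp: None simp del: run.simps)
  qed
qed

definition agree :: "nat \<Rightarrow> nat \<Rightarrow> nat set \<Rightarrow> bool" where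
  "agree l D X \<longleftrightarrow> (\<forall>m<l. m \<in> set_decode D \<longleftrightarrow> m \<in> X)"

lemma run_Prec_rec:
  "run X (Prec p q) n = rec_nat (run X p (p1 n))
     (\<lambda>m r. Option.bind r (\<lambda>v. run X q (prod_encode (p1 n, prod_encode (m, v))))) (p2 n)"
  by (simp add: p1_def p2_def split_beta)

text \<open>Bounded evaluation consults the oracle only below \<open>l\<close>, where
  \<open>D\<close> and \<open>X\<close> agree.\<close>

lemma ev_sound:
  assumes "agree l D X"
  shows "ev p l D n = Suc v \<Longrightarrow> run X p n = Some v"
proof (induction p arbitrary: n v)
  case Oracle
  then show ?case using assms by (auto simp: agree_def split: if_splits)
next
  case (Pair p q)
  then obtain a b where ab: "ev p l D n = Suc a" "ev q l D n = Suc b"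
    by (cases "ev p l D n"; cases "ev q l D n") auto
  then show ?case using Pair.IH(1)[OF ab(1)] Pair.IH(2)[OF ab(2)] Pair.prems by simp
next
  case (Comp p q)
  then obtain b where b: "ev q l D n = Suc b" by (cases "ev q l D n") auto
  then have "ev p l D b = Suc v" using Comp.prems by simp
  then show ?case using Comp.IH(1) Comp.IH(2)[OF b] by simp
next
  case (Prec p q)
  have "rec_nat (ev p l D (p1 n))
       (\<lambda>m v. if v = 0 then 0 else ev q l D (prod_encode (p1 n, prod_encode (m, v - Suc 0)))) k = Suc v
     \<Longrightarrow> rec_nat (run X p (p1 n))
     (\<lambda>m r. Option.bind r (\<lambda>v. run X q (prod_encode (p1 n, prod_encode (m, v))))) k = Some v" for k v
  proof (induction k arbitrary: v)
    case 0
    then show ?case using Prec.IH(1) by simp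
  next
    case (Suc k)
    let ?r = "rec_nat (ev p l D (p1 n))
       (\<lambda>m v. if v = 0 then 0 else ev q l D (prod_encode (p1 n, prod_encode (m, v - Suc 0)))) k"
    obtain u where u: "?r = Suc u" using Suc.prems by (cases ?r) auto
    then have "ev q l D (prod_encode (p1 n, prod_encode (k, u))) = Suc v" using Suc.prems by simp
    then show ?case using Suc.IH[OF u] Prec.IH(2) by simp
  qed
  then show ?case using Prec.prems unfolding run_Prec_rec ev.simps by blast
next
  case (Mu p)
  then have e: "ev p l D (prod_encode (n, v)) = Suc 0" "\<And>j. j < v \<Longrightarrow> Suc 0 < ev p l D (prod_encode (n, j))"
    unfolding ev_Mu by blast+
  have "\<exists>w. run X p (prod_encode (n, j)) = Some (Suc w)" if j: "j < v" for j
  proof -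
    obtain w where "ev p l D (prod_encode (n, j)) = Suc (Suc w)"
      using e(2)[OF j] by (metis Suc_less_eq2 gr0_implies_Suc)
    then show ?thesis using Mu.IH by blast
  qed
  then show ?case using Mu.IH[OF e(1)] unfolding run_Mu by blast
qed (simp_all add: p1_def p2_def)

text \<open>A halting computation asks finitely many questions and searches finitely far. Stating
  this for all sufficiently large bounds lets the bounds of subcomputations be combined without
  tracking them.\<close>

lemma ev_complete:
  "run X p n = Some v \<Longrightarrow> \<forall>\<^sub>F l in sequentially. \<forall>D. agree l D X \<longrightarrow> ev p l D n = Suc v"
proof (induction p arbitrary: n v)
  case Oracle
  show ?case using eventually_gt_at_top[of n]
  proof eventually_elim
    case (elim l)
    then show ?case using Oracle by (auto simp: agree_def)
  qed
next
  case (Pair p q)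
  then obtain a b where ab: "run X p n = Some a" "run X q n = Some b" "v = prod_encode (a, b)"
    by (auto simp: bind_eq_Some_conv)
  show ?case using Pair.IH(1)[OF ab(1)] Pair.IH(2)[OF ab(2)]
    by eventually_elim (simp add: ab(3))
next
  case (Comp p q)
  then obtain b where b: "run X q n = Some b" "run X p b = Some v"
    by (auto simp: bind_eq_Some_conv)
  show ?case using Comp.IH(1)[OF b(2)] Comp.IH(2)[OF b(1)]
    by eventually_elim simp
next
  case (Prec p q)
  have "rec_nat (run X p (p1 n))
     (\<lambda>m r. Option.bind r (\<lambda>v. run X q (prod_encode (p1 n, prod_encode (m, v))))) k = Some v \<Longrightarrow>
    \<forall>\<^sub>F l in sequentially. \<forall>D. agree l D X \<longrightarrow> rec_nat (ev p l D (p1 n))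
       (\<lambda>m v. if v = 0 then 0 else ev q l D (prod_encode (p1 n, prod_encode (m, v - Suc 0)))) k = Suc v" for k v
  proof (induction k arbitrary: v)
    case 0
    then show ?case using Prec.IH(1) by simp
  next
    case (Suc k)
    then obtain u where u: "rec_nat (run X p (p1 n))
         (\<lambda>m r. Option.bind r (\<lambda>v. run X q (prod_encode (p1 n, prod_encode (m, v))))) k = Some u"
        "run X q (prod_encode (p1 n, prod_encode (k, u))) = Some v"
      by (auto simp: bind_eq_Some_conv)
    show ?case using Suc.IH[OF u(1)] Prec.IH(2)[OF u(2)]
      by eventually_elim simp
  qed
  then show ?case using Prec.prems unfolding run_Prec_rec ev.simps by blast
next
  case (Mu p)
  then have r: "run X p (prod_encode (n, v)) = Some 0"
      "\<And>j. j < v \<Longrightarrow> \<exists>w. run X p (prod_encode (n, j)) = Some (Suc w)"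
    unfolding run_Mu by blast+
  have "\<forall>\<^sub>F l in sequentially. \<forall>D. agree l D X \<longrightarrow> Suc 0 < ev p l D (prod_encode (n, j))"
    if "j \<in> {..<v}" for j
  proof -
    obtain w where "run X p (prod_encode (n, j)) = Some (Suc w)" using r(2)[of j] \<open>j \<in> {..<v}\<close> by auto
    from Mu.IH[OF this] show ?thesis by eventually_elim simp
  qed
  then have "\<forall>\<^sub>F l in sequentially. \<forall>j\<in>{..<v}. \<forall>D. agree l D X \<longrightarrow> Suc 0 < ev p l D (prod_encode (n, j))"
    by (intro eventually_ball_finite) auto
  then show ?case using Mu.IH[OF r(1)] eventually_gt_at_top[of v]
    unfolding ev_Mu by eventually_elim simp
qed (simp_all add: p1_def p2_def)

section \<open>Codes of terms and basic sentences\<close>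

text \<open>Yields 0 on numbers that are not lists of terms of \<open>L\<close>, and otherwise the
  length plus one, which is how \<open>code_arity\<close> represents arities. The test
  \<open>u \<noteq> 0\<close> matters because \<open>code_arity\<close> is 0 at undefined
  symbols.\<close>

definition cval :: "language \<Rightarrow> nat \<Rightarrow> nat" where
  "cval L = tree_rec 1 (\<lambda>n u v.
     if v \<noteq> 0 \<and> (p1 (p1 n) = 0 \<or> u \<noteq> 0 \<and> u = code_arity (fun_arity L (p1 (p1 n) - Suc 0))) then Suc v else 0)"

text \<open>Nonzero iff an absent number, one at which \<open>H\<close> is 0, occurs as a
  constant.\<close>

definition cabs :: "(nat \<Rightarrow> nat) \<Rightarrow> nat \<Rightarrow> nat" where
  "cabs H = tree_rec 0 (\<lambda>n u v.
     if v \<noteq> 0 \<or> (if p1 (p1 n) = 0 then H (p2 (p1 n)) = 0 else u \<noteq> 0) then 1 else 0)"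

text \<open>Renames each constant to the element that it stands for in the presentation
  \<open>H\<close>; the predecessor undoes the shift by which 0 is free to mean absence.\<close>

definition csub :: "(nat \<Rightarrow> nat) \<Rightarrow> nat \<Rightarrow> nat" where
  "csub H = tree_rec 0 (\<lambda>n u v. Suc (prod_encode
     (if p1 (p1 n) = 0 then prod_encode (0, H (p2 (p1 n)) - Suc 0) else prod_encode (p1 (p1 n), u), v)))"

abbreviation cterms :: "nat tm list \<Rightarrow> nat" where
  "cterms ts \<equiv> list_encode (map code_tm ts)"

text \<open>Follows the recursion of \<open>tree_rec\<close>: the arguments of the first term and
  the rest of the list both have smaller codes.\<close>

lemma cterms_induct [case_names Nil Elem App]:
  fixes P :: "nat tm list \<Rightarrow> bool"
  assumes "P []" "\<And>a ts. P ts \<Longrightarrow> P (Elem a # ts)"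
    "\<And>f us ts. P us \<Longrightarrow> P ts \<Longrightarrow> P (App f us # ts)"
  shows "P ts"
proof (induction "cterms ts" arbitrary: ts rule: less_induct)
  case less
  show ?case
  proof (cases ts)
    case Nil
    then show ?thesis using assms(1) by simp
  next
    case (Cons t us)
    have us: "P us" using less Cons by (simp add: le_imp_less_Suc le_prod_encode_2)
    show ?thesis
    proof (cases t)
      case (Elem a)
      then show ?thesis using assms(2) us Cons by simp
    next
      case (App f ss)
      have "cterms ss \<le> code_tm t" using App by (simp add: le_prod_encode_2)
      also have "\<dots> \<le> prod_encode (code_tm t, cterms us)" by (rule le_prod_encode_1)
      finally have "cterms ss < cterms ts" using Cons by simp
      then show ?thesis using assms(3) us less Cons App by simp
    qed
  qed
qed

lemma cval_cterms: "(\<forall>t\<in>set ts. tm_in L t) \<Longrightarrow> cval L (cterms ts) = Suc (length ts)"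
proof (induction ts rule: cterms_induct)
  case (App f us ts)
  then show ?case by (simp add: cval_def code_arity_def)
qed (simp_all add: cval_def)

lemma cval_nonzero: "cval L c \<noteq> 0 \<Longrightarrow> \<exists>ts. c = cterms ts \<and> (\<forall>t\<in>set ts. tm_in L t)"
proof (induction c rule: less_induct)
  case (less c)
  show ?case
  proof (cases c)
    case 0
    then show ?thesis by (intro exI[of _ "[]"]) simp
  next
    case (Suc n)
    have v: "cval L (p2 n) \<noteq> 0" and ok: "p1 (p1 n) = 0 \<or> cval L (p2 (p1 n)) \<noteq> 0 \<and>
        cval L (p2 (p1 n)) = code_arity (fun_arity L (p1 (p1 n) - Suc 0))"
      using less.prems by (auto simp: Suc cval_def split: if_splits)
    have lt: "p2 n < c" "p2 (p1 n) < c"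
      using p2_le[of n] order_trans[OF p2_le p1_le, of n] Suc by simp_all
    obtain ts where ts: "p2 n = cterms ts" "\<forall>t\<in>set ts. tm_in L t" using less.IH[OF lt(1) v] by blast
    have "\<exists>t. p1 n = code_tm t \<and> tm_in L t"
    proof (cases "p1 (p1 n)")
      case 0
      then have "p1 n = code_tm (Elem (p2 (p1 n)))" using encode_p1_p2[of "p1 n"] by simp
      then show ?thesis by (intro exI[of _ "Elem (p2 (p1 n))"]) simp
    next
      case (Suc f)
      then have u: "cval L (p2 (p1 n)) \<noteq> 0" "cval L (p2 (p1 n)) = code_arity (fun_arity L f)" using ok by simp_all
      obtain us where us: "p2 (p1 n) = cterms us" "\<forall>t\<in>set us. tm_in L t" using less.IH[OF lt(2) u(1)] by blast
      have "code_arity (fun_arity L f) = Suc (length us)" using u(2) us cval_cterms by simp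
      then have "fun_arity L f = Some (length us)" by (simp add: code_arity_def split: option.splits)
      moreover have "p1 n = code_tm (App f us)" using encode_p1_p2[of "p1 n"] Suc us(1) by simp
      ultimately show ?thesis using us(2) by (intro exI[of _ "App f us"]) simp
    qed
    then obtain t where t: "p1 n = code_tm t" "tm_in L t" by blast
    have "c = Suc (prod_encode (p1 n, p2 n))" by (simp add: Suc)
    then have "c = cterms (t # ts)" by (simp only: t ts list.map list_encode.simps)
    then show ?thesis using t(2) ts(2) by (intro exI[of _ "t # ts"]) simp
  qed
qed

lemma cabs_cterms: "cabs H (cterms ts) = 0 \<longleftrightarrow> (\<forall>t\<in>set ts. \<forall>a\<in>set_tm t. H a \<noteq> 0)"
proof (induction ts rule: cterms_induct)
  case (App f us ts)
  then show ?case by (auto simp: cabs_def)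
qed (auto simp: cabs_def)

lemma csub_cterms: "csub H (cterms ts) = cterms (map (map_tm (\<lambda>a. H a - Suc 0)) ts)"
proof (induction ts rule: cterms_induct)
  case (App f us ts)
  then show ?case by (simp add: csub_def)
qed (simp_all add: csub_def)

text \<open>The arguments of an atom are treated as one list; an equation has two of them.\<close>

primrec atom_args :: "nat atom \<Rightarrow> nat tm list" where
  "atom_args (Eq s t) = [s, t]"
| "atom_args (Rel R ts) = ts"

primrec the_atom :: "nat basic \<Rightarrow> nat atom" where
  "the_atom (Pos a) = a"
| "the_atom (Neg a) = a"

primrec negate :: "nat basic \<Rightarrow> nat basic" where
  "negate (Pos a) = Neg a"
| "negate (Neg a) = Pos a"

text \<open>An equation is coded as a pair of terms, so the code of its argument list is assembled
  here; the final 0 is the empty list.\<close>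

definition args :: "nat \<Rightarrow> nat" where
  "args m = (if p1 (p2 m) = 0
     then Suc (prod_encode (p1 (p2 (p2 m)), Suc (prod_encode (p2 (p2 (p2 m)), 0)))) else p2 (p2 m))"

text \<open>In the code of a basic sentence \<open>p1 m\<close> is the sign, and
  \<open>p1 (p2 m)\<close> is 0 for an equation and the successor of the relation symbol otherwise.
  For an equation \<open>args\<close> itself supplies the right number of arguments.\<close>

definition bval :: "language \<Rightarrow> nat \<Rightarrow> bool" where
  "bval L m \<longleftrightarrow> p1 m \<le> 1 \<and> cval L (args m) \<noteq> 0 \<and>
     (p1 (p2 m) \<noteq> 0 \<longrightarrow> cval L (args m) = code_arity (rel_arity L (p1 (p2 m) - Suc 0)))"

definition babs :: "(nat \<Rightarrow> nat) \<Rightarrow> nat \<Rightarrow> bool" where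
  "babs H m \<longleftrightarrow> cabs H (args m) \<noteq> 0"

text \<open>For an equation the two-element list returned by \<open>csub\<close> is unpacked into a
  pair of terms again.\<close>

definition bsub :: "(nat \<Rightarrow> nat) \<Rightarrow> nat \<Rightarrow> nat" where
  "bsub H m = prod_encode (p1 m, if p1 (p2 m) = 0
     then prod_encode (0, prod_encode (p1 (csub H (args m) - Suc 0), p1 (p2 (csub H (args m) - Suc 0) - Suc 0)))
     else prod_encode (p1 (p2 m), csub H (args m)))"

definition bneg :: "nat \<Rightarrow> nat" where
  "bneg m = prod_encode (1 - p1 m, p2 m)"

lemma args_code_basic: "args (code_basic \<psi>) = cterms (atom_args (the_atom \<psi>))"
proof -
  have "args (prod_encode (i, code_atom a)) = cterms (atom_args a)" for i a
    by (cases a) (simp_all add: args_def)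
  then show ?thesis by (cases \<psi>) simp_all
qed

lemma bval_code_basic: "basic_in L \<psi> \<Longrightarrow> bval L (code_basic \<psi>)"
proof -
  assume \<psi>: "basic_in L \<psi>"
  then have "atom_in L (the_atom \<psi>)" by (cases \<psi>) simp_all
  then have "\<forall>t\<in>set (atom_args (the_atom \<psi>)). tm_in L t" by (cases "the_atom \<psi>") simp_all
  note c = cval_cterms[OF this]
  show ?thesis
    unfolding bval_def args_code_basic c
    using \<psi> by (cases \<psi>; cases "the_atom \<psi>") (auto simp: code_arity_def)
qed

lemma bval_ex:
  assumes "bval L m" shows "\<exists>\<psi>. basic_in L \<psi> \<and> m = code_basic \<psi>"
proof -
  obtain ts where ts: "args m = cterms ts" "\<forall>t\<in>set ts. tm_in L t"
    using assms cval_nonzero unfolding bval_def by blast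
  have "\<exists>a. atom_in L a \<and> p2 m = code_atom a"
  proof (cases "p1 (p2 m)")
    case 0
    then obtain s t where st: "ts = [s, t]"
      using ts(1) by (cases ts; cases "tl ts"; cases "tl (tl ts)") (auto simp: args_def)
    then have "p1 (p2 (p2 m)) = code_tm s" "p2 (p2 (p2 m)) = code_tm t" using ts(1) 0 by (simp_all add: args_def)
    then have "p2 m = code_atom (Eq s t)"
      using 0 encode_p1_p2[of "p2 m"] encode_p1_p2[of "p2 (p2 m)"] by simp
    then show ?thesis using ts(2) st by (intro exI[of _ "Eq s t"]) simp
  next
    case (Suc R)
    then have p: "p2 (p2 m) = cterms ts" using ts(1) by (simp add: args_def)
    have "code_arity (rel_arity L R) = Suc (length ts)"
      using assms Suc cval_cterms[OF ts(2)] by (simp add: bval_def ts(1))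
    then have "rel_arity L R = Some (length ts)" by (simp add: code_arity_def split: option.splits)
    moreover have "p2 m = code_atom (Rel R ts)" using Suc p encode_p1_p2[of "p2 m"] by simp
    ultimately show ?thesis using ts(2) by (intro exI[of _ "Rel R ts"]) simp
  qed
  then obtain a where a: "atom_in L a" "p2 m = code_atom a" by blast
  have "p1 m = 0 \<or> p1 m = 1" using assms unfolding bval_def by linarith
  then show ?thesis
  proof
    assume "p1 m = 0"
    then show ?thesis using a encode_p1_p2[of m] by (intro exI[of _ "Pos a"]) simp
  next
    assume "p1 m = 1"
    then show ?thesis using a encode_p1_p2[of m] by (intro exI[of _ "Neg a"]) simp
  qed
qed

lemma babs_code_basic: "babs H (code_basic \<psi>) \<longleftrightarrow> (\<exists>a\<in>set_basic \<psi>. H a = 0)"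
proof -
  have "(\<Union>t\<in>set (atom_args (the_atom \<psi>)). set_tm t) = set_basic \<psi>"
    by (cases \<psi>; cases "the_atom \<psi>") auto
  then have "set_basic \<psi> = (\<Union>t\<in>set (atom_args (the_atom \<psi>)). set_tm t)" ..
  then show ?thesis unfolding babs_def args_code_basic cabs_cterms by auto
qed

lemma bsub_code_basic: "bsub H (code_basic \<psi>) = code_basic (map_basic (\<lambda>a. H a - Suc 0) \<psi>)"
  unfolding bsub_def args_code_basic csub_cterms
  by (cases \<psi>; cases "the_atom \<psi>") simp_all

lemma bneg_code_basic: "bneg (code_basic \<psi>) = code_basic (negate \<psi>)"
  by (cases \<psi>) (simp_all add: bneg_def)

lemma le_list_encode: "x \<in> set xs \<Longrightarrow> x \<le> list_encode xs"
proof (induction xs)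
  case (Cons y ys)
  then show ?case
    using le_prod_encode_1[of y "list_encode ys"] le_prod_encode_2[of "list_encode ys" y] by auto
qed simp

lemma set_tm_le_code: "a \<in> set_tm t \<Longrightarrow> a \<le> code_tm t"
proof (induction t)
  case (App f ts)
  then obtain t where t: "t \<in> set ts" "a \<in> set_tm t" by auto
  have "a \<le> code_tm t" using App.IH t by blast
  also have "\<dots> \<le> cterms ts" using t(1) by (intro le_list_encode) simp
  also have "\<dots> \<le> code_tm (App f ts)" by (simp add: le_prod_encode_2)
  finally show ?case .
qed (simp add: le_prod_encode_2)

text \<open>Hence the entries of a presentation up to \<open>m\<close> determine what the sentence
  with code \<open>m\<close> says about the presented structure.\<close>

lemma set_basic_le_code: "a \<in> set_basic \<psi> \<Longrightarrow> a \<le> code_basic \<psi>"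
proof -
  have atom: "a \<le> code_atom \<alpha>" if a: "a \<in> set_atom \<alpha>" for \<alpha>
  proof (cases \<alpha>)
    case (Eq s t)
    then consider "a \<le> code_tm s" | "a \<le> code_tm t" using a set_tm_le_code by auto
    then have "a \<le> prod_encode (code_tm s, code_tm t)"
      by cases (meson le_prod_encode_1 le_prod_encode_2 order_trans)+
    also have "\<dots> \<le> code_atom \<alpha>" using Eq by (simp add: le_prod_encode_2)
    finally show ?thesis .
  next
    case (Rel R ts)
    then obtain t where t: "t \<in> set ts" "a \<in> set_tm t" using a by auto
    have "a \<le> code_tm t" using t(2) by (rule set_tm_le_code)
    also have "\<dots> \<le> cterms ts" using t(1) by (intro le_list_encode) simp
    also have "\<dots> \<le> code_atom \<alpha>" using Rel by (simp add: le_prod_encode_2)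
    finally show ?thesis .
  qed
  assume "a \<in> set_basic \<psi>"
  then show ?thesis
    using atom by (cases \<psi>) (auto intro: order_trans[OF _ le_prod_encode_2])
qed

section \<open>Recursiveness of the operations on codes\<close>

lemma recursive_args [recursive_intros]:
  assumes "recursive f" shows "recursive (\<lambda>X n. args (f X n))"
proof -
  have "recursive (\<lambda>X n. args n)" unfolding args_def by (intro recursive_intros)
  then show ?thesis using assms by (rule recursive_comp)
qed

lemma recursive_cval:
  assumes "computable_language L" "recursive f" shows "recursive (\<lambda>X n. cval L (f X n))"
  using assms unfolding cval_def computable_language_def
  by (intro recursive_intros computable_fun_recursive[where f = "\<lambda>s. code_arity (fun_arity L s)"]) auto

lemma decidable_bval:
  assumes "computable_language L" "recursive f" shows "decidable (\<lambda>X n. bval L (f X n))"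
proof -
  have "decidable (\<lambda>X n. bval L n)"
    using assms(1) unfolding bval_def computable_language_def
    by (intro recursive_intros recursive_cval[OF assms(1)]
        computable_fun_recursive[where f = "\<lambda>s. code_arity (rel_arity L s)"]) auto
  then show ?thesis using assms(2) by (rule decidable_comp)
qed

text \<open>Reads the code of a finite list as a presentation; the default 0 beyond its end is the
  value that marks absent numbers.\<close>

definition look :: "nat \<Rightarrow> nat \<Rightarrow> nat" where
  "look h i = (if i < length (list_decode h) then list_decode h ! i else 0)"

definition len :: "nat \<Rightarrow> nat" where
  "len h = length (list_decode h)"

lemma look_list_encode: "look (list_encode xs) i = (if i < length xs then xs ! i else 0)"
  and len_list_encode: "len (list_encode xs) = length xs"
  by (simp_all add: look_def len_def)

lemma recursive_len [recursive_intros]: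
  assumes "recursive f" shows "recursive (\<lambda>X n. len (f X n))"
proof -
  have "tree_rec 0 (\<lambda>_ _ v. Suc v) (list_encode xs) = length xs" for xs
    by (induction xs) simp_all
  from this[of "list_decode _"] have eq: "tree_rec 0 (\<lambda>_ _ v. Suc v) h = len h" for h
    by (simp add: len_def)
  have "recursive (\<lambda>X n. tree_rec 0 (\<lambda>_ _ v. Suc v) (f X n))" by (intro recursive_intros assms)
  then show ?thesis unfolding eq .
qed

lemma p_zero: "p1 0 = 0" "p2 0 = 0"
proof -
  have "prod_encode (0, 0) = 0" by (simp add: prod_encode_def)
  then show "p1 0 = 0" "p2 0 = 0" by (metis p1_encode) (metis \<open>prod_encode (0, 0) = 0\<close> p2_encode)
qed

lemma recursive_look [recursive_intros]:
  assumes "recursive f" "recursive g" shows "recursive (\<lambda>X n. look (f X n) (g X n))"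
proof -
  have drop: "rec_nat (list_encode xs) (\<lambda>_ v. p2 (v - Suc 0)) i = list_encode (drop i xs)" for xs i
  proof (induction i)
    case (Suc i)
    have "p2 (list_encode ys - Suc 0) = list_encode (tl ys)" for ys
      by (cases ys) (simp_all add: p_zero)
    then show ?case using Suc by (simp add: drop_Suc drop_tl)
  qed simp
  \<comment> \<open>At the empty list the code is 0, and so are its predecessor and the first
    projection of that, in agreement with the default of \<open>look\<close>.\<close>
  have head: "p1 (list_encode ys - Suc 0) = (if ys = [] then 0 else hd ys)" for ys
    by (cases ys) (simp_all add: p_zero)
  have eq: "p1 (rec_nat h (\<lambda>_ v. p2 (v - Suc 0)) i - Suc 0) = look h i" for h i
    using drop[of "list_decode h" i] head[of "drop i (list_decode h)"]
    by (simp add: look_def hd_drop_conv_nth)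
  have "recursive (\<lambda>X n. p1 (rec_nat (f X n) (\<lambda>_ v. p2 (v - Suc 0)) (g X n) - Suc 0))"
    by (intro recursive_intros assms)
  then show ?thesis unfolding eq .
qed

lemma recursive_bsub [recursive_intros]:
  assumes "recursive f" "recursive g" shows "recursive (\<lambda>X n. bsub (look (f X n)) (g X n))"
proof -
  have "recursive (\<lambda>X n. bsub (look (p1 n)) (p2 n))"
    unfolding bsub_def csub_def by (intro recursive_intros)
  then show ?thesis using assms by (rule recursive_comp2)
qed

lemma decidable_babs [recursive_intros]:
  assumes "recursive f" "recursive g" shows "decidable (\<lambda>X n. babs (look (f X n)) (g X n))"
proof -
  have "decidable (\<lambda>X n. babs (look (p1 n)) (p2 n))"
    unfolding babs_def cabs_def by (intro recursive_intros)
  then show ?thesis using assms by (rule decidable_comp2)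
qed

lemma recursive_bneg [recursive_intros]:
  assumes "recursive f" shows "recursive (\<lambda>X n. bneg (f X n))"
  unfolding bneg_def by (intro recursive_intros assms)

section \<open>Generic copies\<close>

text \<open>
  A copy of \<open>S\<close> is presented by \<open>H\<close>: the number \<open>i\<close> is outside the universe of the copy if
  \<open>H i = 0\<close>, and stands for the element \<open>a\<close> of \<open>S\<close> if \<open>H i = Suc a\<close>.  Finite lists are the finite
  parts of such presentations.  The value \<open>0\<close> makes the numbers outside the universe decidable
  from the presentation, which is what a Turing operator can use but an enumeration operator cannot.
\<close>

definition full :: "struct \<Rightarrow> (nat \<Rightarrow> nat) \<Rightarrow> bool" where
  "full S H \<longleftrightarrow> inj_on H {i. H i \<noteq> 0} \<and> H ` {i. H i \<noteq> 0} = Suc ` universe S"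

definition copy :: "struct \<Rightarrow> (nat \<Rightarrow> nat) \<Rightarrow> struct" where
  "copy S H = \<lparr>universe = {i. H i \<noteq> 0},
     rel_interp = (\<lambda>R xs. rel_interp S R (map (\<lambda>i. H i - Suc 0) xs)),
     fun_interp = (\<lambda>f xs. inv_into {i. H i \<noteq> 0} H (Suc (fun_interp S f (map (\<lambda>i. H i - Suc 0) xs))))\<rparr>"

lemma full_bij:
  assumes "full S H" shows "bij_betw (\<lambda>i. H i - Suc 0) {i. H i \<noteq> 0} (universe S)"
proof -
  have "bij_betw H {i. H i \<noteq> 0} (Suc ` universe S)" using assms by (simp add: full_def bij_betw_def)
  moreover have "bij_betw (\<lambda>a. a - Suc 0) (Suc ` universe S) (universe S)"
    by (auto simp: bij_betw_def inj_on_def image_image)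
  ultimately have "bij_betw ((\<lambda>a. a - Suc 0) \<circ> H) {i. H i \<noteq> 0} (universe S)" by (rule bij_betw_trans)
  then show ?thesis by (simp add: comp_def)
qed

lemma copy_fun:
  assumes "full S H" "is_structure L S" "fun_arity L f = Some (length xs)" "set xs \<subseteq> {i. H i \<noteq> 0}"
  shows "H (fun_interp (copy S H) f xs) = Suc (fun_interp S f (map (\<lambda>i. H i - Suc 0) xs))"
proof -
  have "set (map (\<lambda>i. H i - Suc 0) xs) \<subseteq> universe S"
    using full_bij[OF assms(1)] assms(4) by (auto simp: bij_betw_def)
  then have "fun_interp S f (map (\<lambda>i. H i - Suc 0) xs) \<in> universe S"
    using assms(2,3) by (simp add: is_structure_def)
  then have "Suc (fun_interp S f (map (\<lambda>i. H i - Suc 0) xs)) \<in> H ` {i. H i \<noteq> 0}"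
    using assms(1) by (simp add: full_def)
  then show ?thesis by (simp add: copy_def f_inv_into_f)
qed

lemma is_structure_copy:
  assumes "full S H" "is_structure L S" shows "is_structure L (copy S H)"
proof -
  have "universe S \<noteq> {}" using assms(2) by (simp add: is_structure_def)
  then have "universe (copy S H) \<noteq> {}" using assms(1) by (auto simp: full_def copy_def)
  moreover have "fun_interp (copy S H) f xs \<in> universe (copy S H)"
    if "fun_arity L f = Some (length xs)" "set xs \<subseteq> universe (copy S H)" for f xs
    using copy_fun[OF assms that(1)] that(2) by (simp add: copy_def)
  ultimately show ?thesis by (simp add: is_structure_def)
qed

lemma isomorphic_copy:
  assumes "full S H" "is_structure L S" shows "isomorphic L (copy S H) S"
  unfolding isomorphic_def
proof (intro exI[of _ "\<lambda>i. H i - Suc 0"] conjI allI impI)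
  show "bij_betw (\<lambda>i. H i - Suc 0) (universe (copy S H)) (universe S)"
    using full_bij[OF assms(1)] by (simp add: copy_def)
  show "rel_interp (copy S H) R xs \<longleftrightarrow> rel_interp S R (map (\<lambda>i. H i - Suc 0) xs)" for R xs
    by (simp add: copy_def)
  show "H (fun_interp (copy S H) f xs) - Suc 0 = fun_interp S f (map (\<lambda>i. H i - Suc 0) xs)"
    if "fun_arity L f = Some (length xs)" "set xs \<subseteq> universe (copy S H)" for f xs
    using copy_fun[OF assms that(1)] that(2) by (simp add: copy_def)
qed

lemma tm_in_map [simp]: "tm_in L (map_tm h t) \<longleftrightarrow> tm_in L t"
  by (induction t) auto

lemma basic_in_map [simp]: "basic_in L (map_basic h \<psi>) \<longleftrightarrow> basic_in L \<psi>"
proof -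
  have "atom_in L (map_atom h a) \<longleftrightarrow> atom_in L a" for a by (cases a) auto
  then show ?thesis by (cases \<psi>) auto
qed

lemma tm_val_copy:
  assumes "full S H" "is_structure L S" "tm_in L t" "set_tm t \<subseteq> {i. H i \<noteq> 0}"
  shows "H (tm_val (copy S H) t) = Suc (tm_val S (map_tm (\<lambda>i. H i - Suc 0) t))"
  using assms(3,4)
proof (induction t)
  case (App f ts)
  have IH: "H (tm_val (copy S H) t) = Suc (tm_val S (map_tm (\<lambda>i. H i - Suc 0) t))" if "t \<in> set ts" for t
    using App that by auto
  have "H (fun_interp (copy S H) f (map (tm_val (copy S H)) ts)) =
      Suc (fun_interp S f (map (\<lambda>i. H i - Suc 0) (map (tm_val (copy S H)) ts)))"
    using App.prems(1) IH by (intro copy_fun[OF assms(1,2)]) auto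
  also have "map (\<lambda>i. H i - Suc 0) (map (tm_val (copy S H)) ts) =
      map (tm_val S) (map (map_tm (\<lambda>i. H i - Suc 0)) ts)"
    using IH by simp
  finally show ?case by simp
qed simp

lemma basic_true_copy:
  assumes "full S H" "is_structure L S" "basic_in L \<psi>" "set_basic \<psi> \<subseteq> {i. H i \<noteq> 0}"
  shows "basic_true (copy S H) \<psi> \<longleftrightarrow> basic_true S (map_basic (\<lambda>i. H i - Suc 0) \<psi>)"
proof -
  have "atom_true (copy S H) a \<longleftrightarrow> atom_true S (map_atom (\<lambda>i. H i - Suc 0) a)"
    if a: "atom_in L a" "set_atom a \<subseteq> {i. H i \<noteq> 0}" for a
  proof (cases a)
    case (Eq s t)
    have *: "H (tm_val (copy S H) s) = Suc (tm_val S (map_tm (\<lambda>i. H i - Suc 0) s))"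
      "H (tm_val (copy S H) t) = Suc (tm_val S (map_tm (\<lambda>i. H i - Suc 0) t))"
      using a Eq by (auto intro!: tm_val_copy[OF assms(1,2)])
    have "tm_val (copy S H) s = tm_val (copy S H) t \<longleftrightarrow> H (tm_val (copy S H) s) = H (tm_val (copy S H) t)"
    proof
      assume "H (tm_val (copy S H) s) = H (tm_val (copy S H) t)"
      moreover have "inj_on H {i. H i \<noteq> 0}" using assms(1) by (simp add: full_def)
      ultimately show "tm_val (copy S H) s = tm_val (copy S H) t"
        using inj_onD[of H "{i. H i \<noteq> 0}" "tm_val (copy S H) s" "tm_val (copy S H) t"] *
        by (metis (mono_tags, lifting) mem_Collect_eq nat.distinct(1))
    qed simp
    then show ?thesis using * Eq by simp
  next
    case (Rel R ts)
    have "H (tm_val (copy S H) t) = Suc (tm_val S (map_tm (\<lambda>i. H i - Suc 0) t))" if "t \<in> set ts" for t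
      using a Rel that by (auto intro!: tm_val_copy[OF assms(1,2)])
    then have eq: "map (\<lambda>i. H i - Suc 0) (map (tm_val (copy S H)) ts) =
        map (tm_val S) (map (map_tm (\<lambda>i. H i - Suc 0)) ts)"
      by simp
    have "rel_interp (copy S H) R xs \<longleftrightarrow> rel_interp S R (map (\<lambda>i. H i - Suc 0) xs)" for xs
      by (simp add: copy_def)
    then show ?thesis by (simp only: Rel atom_true.simps atom.map eq)
  qed
  then show ?thesis using assms(3,4) by (cases \<psi>) simp_all
qed

lemma diagram_copy:
  assumes "full S H" "is_structure L S" "basic_in L \<psi>"
  shows "\<psi> \<in> diagram L (copy S H) \<longleftrightarrow>
    (\<forall>a\<in>set_basic \<psi>. H a \<noteq> 0) \<and> map_basic (\<lambda>i. H i - Suc 0) \<psi> \<in> diagram L S"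
proof (cases "\<forall>a\<in>set_basic \<psi>. H a \<noteq> 0")
  case True
  then have sub: "set_basic \<psi> \<subseteq> {i. H i \<noteq> 0}" by blast
  have "(\<lambda>i. H i - Suc 0) ` set_basic \<psi> \<subseteq> universe S"
    using full_bij[OF assms(1)] sub by (auto simp: bij_betw_def)
  then show ?thesis
    using True sub assms(3) basic_true_copy[OF assms sub]
    by (simp add: diagram_def basic.set_map) (simp add: copy_def)
next
  case False
  then have "\<not> set_basic \<psi> \<subseteq> universe (copy S H)" by (auto simp: copy_def)
  then show ?thesis using False by (simp add: diagram_def)
qed

lemma dcode_copy:
  assumes "full S H" "is_structure L S"
  shows "m \<in> dcode L (copy S H) \<longleftrightarrow> bval L m \<and> \<not> babs H m \<and> bsub H m \<in> dcode L S"
proof (cases "bval L m")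
  case True
  then obtain \<psi> where \<psi>: "basic_in L \<psi>" "m = code_basic \<psi>" using bval_ex by blast
  show ?thesis
    unfolding \<psi>(2) bsub_code_basic babs_code_basic inj_image_mem_iff[OF inj_code_basic]
      diagram_copy[OF assms \<psi>(1)] using True \<psi>(2) by simp
next
  case False
  then have "m \<notin> dcode L (copy S H)" using bval_code_basic by (auto simp: diagram_def)
  then show ?thesis using False by simp
qed

text \<open>A number is missing from the diagram of a copy because it codes no sentence, mentions an
  absent number, or codes a sentence whose negation holds. The first two can be read off from the
  presentation; by this lemma the third is a positive fact about the diagram of \<open>S\<close>, so
  it can be used by an enumeration operator.\<close>

lemma dcode_negate:
  assumes "full S H" "is_structure L S" "bval L m" "\<not> babs H m"
  shows "bneg (bsub H m) \<in> dcode L S \<longleftrightarrow> bsub H m \<notin> dcode L S"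
proof -
  obtain \<psi> where \<psi>: "basic_in L \<psi>" "m = code_basic \<psi>" using bval_ex[OF assms(3)] by blast
  let ?\<phi> = "map_basic (\<lambda>i. H i - Suc 0) \<psi>"
  have "set_basic \<psi> \<subseteq> {i. H i \<noteq> 0}" using assms(4) by (auto simp: \<psi>(2) babs_code_basic)
  then have "set_basic ?\<phi> \<subseteq> universe S"
    using full_bij[OF assms(1)] by (auto simp: bij_betw_def basic.set_map)
  moreover have "basic_in L ?\<phi>" using \<psi>(1) by simp
  ultimately have "negate ?\<phi> \<in> diagram L S \<longleftrightarrow> ?\<phi> \<notin> diagram L S"
    by (cases ?\<phi>) (simp_all add: diagram_def)
  then show ?thesis
    unfolding \<psi>(2) bsub_code_basic bneg_code_basic inj_image_mem_iff[OF inj_code_basic] .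
qed

section \<open>Finite parts of presentations\<close>

definition valid :: "struct \<Rightarrow> nat list \<Rightarrow> bool" where
  "valid S hs \<longleftrightarrow> (\<forall>i<length hs. hs ! i \<noteq> 0 \<longrightarrow>
     hs ! i - Suc 0 \<in> universe S \<and> (\<forall>j<i. hs ! j \<noteq> hs ! i))"

definition extends :: "(nat \<Rightarrow> nat) \<Rightarrow> nat list \<Rightarrow> bool" where
  "extends H hs \<longleftrightarrow> (\<forall>i<length hs. H i = hs ! i)"

lemma full_extension:
  assumes "valid S hs" shows "\<exists>H. full S H \<and> extends H hs"
proof -
  define M where "M = universe S - {a. Suc a \<in> set hs}"
  \<comment> \<open>After the finite part, place \<open>length hs + a\<close> presents
    \<open>a\<close> if \<open>a\<close> is in the universe and still missing; all other places are
    absent.\<close>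
  define H where "H i = (if i < length hs then hs ! i
      else if i - length hs \<in> M then Suc (i - length hs) else 0)" for i
  have "H i \<noteq> H j" if "i < j" "H i \<noteq> 0" "H j \<noteq> 0" for i j
  proof (cases "j < length hs")
    case True
    then show ?thesis using that assms by (auto simp: H_def valid_def)
  next
    case False
    then have j: "j - length hs \<in> M" "H j = Suc (j - length hs)" using that(3) by (auto simp: H_def split: if_splits)
    show ?thesis
    proof (cases "i < length hs")
      case True
      then have "H i \<in> set hs" by (simp add: H_def)
      then show ?thesis using j by (auto simp: M_def)
    next
      case False
      then show ?thesis using that j by (auto simp: H_def split: if_splits)
    qed
  qed
  then have "inj_on H {i. H i \<noteq> 0}" by (intro linorder_inj_onI) auto
  moreover have "H ` {i. H i \<noteq> 0} = Suc ` universe S"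
  proof
    show "H ` {i. H i \<noteq> 0} \<subseteq> Suc ` universe S"
    proof
      fix b assume "b \<in> H ` {i. H i \<noteq> 0}"
      then obtain i where i: "b = H i" "H i \<noteq> 0" by blast
      have "H i - Suc 0 \<in> universe S"
        using i(2) assms by (auto simp: H_def valid_def M_def split: if_splits)
      then show "b \<in> Suc ` universe S" using i by (auto intro: image_eqI[of _ _ "H i - Suc 0"])
    qed
    show "Suc ` universe S \<subseteq> H ` {i. H i \<noteq> 0}"
    proof
      fix b assume "b \<in> Suc ` universe S"
      then obtain a where a: "b = Suc a" "a \<in> universe S" by blast
      show "b \<in> H ` {i. H i \<noteq> 0}"
      proof (cases "Suc a \<in> set hs")
        case True
        then obtain i where "i < length hs" "hs ! i = Suc a" by (auto simp: in_set_conv_nth)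
        then show ?thesis using a by (intro image_eqI[of _ _ i]) (simp_all add: H_def)
      next
        case False
        then show ?thesis using a by (intro image_eqI[of _ _ "length hs + a"]) (simp_all add: H_def M_def)
      qed
    qed
  qed
  moreover have "extends H hs" by (simp add: extends_def H_def)
  ultimately show ?thesis unfolding full_def by blast
qed

lemma valid_full:
  assumes "full S H" shows "valid S (map H [0..<N])"
  unfolding valid_def
proof (intro allI impI)
  fix i assume i: "i < length (map H [0..<N])" "map H [0..<N] ! i \<noteq> 0"
  have "H i - Suc 0 \<in> universe S" using i full_bij[OF assms] by (auto simp: bij_betw_def)
  moreover have "H j \<noteq> H i" if "j < i" for j
    using i that assms by (auto simp: full_def dest: inj_onD)
  ultimately show "map H [0..<N] ! i - Suc 0 \<in> universe S \<and> (\<forall>j<i. map H [0..<N] ! j \<noteq> map H [0..<N] ! i)"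
    using i by simp
qed

section \<open>Evidence for the output of a Turing operator\<close>

text \<open>
  \<open>evidence L E h l D\<close>: the codes in \<open>E\<close> suffice to see that \<open>h\<close> is a finite part of a presentation
  and that \<open>D\<close> agrees below \<open>l\<close> with the diagram of every copy presented by an extension of \<open>h\<close>.
\<close>

definition evidence :: "language \<Rightarrow> nat set \<Rightarrow> nat \<Rightarrow> nat \<Rightarrow> nat \<Rightarrow> bool" where
  "evidence L E h l D \<longleftrightarrow> l \<le> len h \<and>
     (\<forall>i<len h. look h i \<noteq> 0 \<longrightarrow>
        eqc (look h i - Suc 0) (look h i - Suc 0) \<in> E \<and> (\<forall>j<i. look h j \<noteq> look h i)) \<and>
     (\<forall>m<l. if m \<in> set_decode D then bval L m \<and> \<not> babs (look h) m \<and> bsub (look h) m \<in> E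
        else bval L m \<longrightarrow> babs (look h) m \<or> bneg (bsub (look h) m) \<in> E)"

text \<open>A forcing relation for positive facts about the image, sound and complete for copies by
  \<open>forced_sound\<close> and \<open>forced_complete\<close>. \<open>Suc 1\<close> is how
  \<open>ev\<close> reports the output 1.\<close>

definition forced :: "prog \<Rightarrow> language \<Rightarrow> nat set \<Rightarrow> nat \<Rightarrow> nat \<Rightarrow> bool" where
  "forced \<Phi> L E h n \<longleftrightarrow> (\<exists>l D. evidence L E h l D \<and> ev \<Phi> l D n = Suc 1)"

text \<open>\<open>E\<close> occurs only positively. Inclusion is asked only for the codes that are
  consulted, so the lemma yields both monotonicity and the finite use in
  \<open>forced_finite\<close>.\<close>

lemma evidence_mono:
  assumes e: "evidence L E h l D"
    and "\<And>i. i < len h \<Longrightarrow> eqc (look h i - Suc 0) (look h i - Suc 0) \<in> E \<Longrightarrow>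
      eqc (look h i - Suc 0) (look h i - Suc 0) \<in> E'"
    and "\<And>m. m < l \<Longrightarrow> bsub (look h) m \<in> E \<Longrightarrow> bsub (look h) m \<in> E'"
    and "\<And>m. m < l \<Longrightarrow> bneg (bsub (look h) m) \<in> E \<Longrightarrow> bneg (bsub (look h) m) \<in> E'"
  shows "evidence L E' h l D"
  unfolding evidence_def
proof (intro conjI allI impI)
  show "l \<le> len h" using e by (simp only: evidence_def)
next
  fix i assume i: "i < len h" "look h i \<noteq> 0"
  then have "eqc (look h i - Suc 0) (look h i - Suc 0) \<in> E" using e unfolding evidence_def by blast
  then show "eqc (look h i - Suc 0) (look h i - Suc 0) \<in> E'" by (rule assms(2)[OF i(1)])
  show "look h j \<noteq> look h i" if "j < i" for j using e i that unfolding evidence_def by blast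
next
  fix m assume m: "m < l"
  have "if m \<in> set_decode D then bval L m \<and> \<not> babs (look h) m \<and> bsub (look h) m \<in> E
      else bval L m \<longrightarrow> babs (look h) m \<or> bneg (bsub (look h) m) \<in> E"
    using e m unfolding evidence_def by blast
  then show "if m \<in> set_decode D then bval L m \<and> \<not> babs (look h) m \<and> bsub (look h) m \<in> E'
      else bval L m \<longrightarrow> babs (look h) m \<or> bneg (bsub (look h) m) \<in> E'"
    using assms(3,4)[OF m] by (cases "m \<in> set_decode D") (simp_all only: if_True if_False, blast+)
qed

lemma forced_mono: "E \<subseteq> E' \<Longrightarrow> forced \<Phi> L E h n \<Longrightarrow> forced \<Phi> L E' h n"
  unfolding forced_def using evidence_mono[of L E h _ _ E'] by blast

lemma forced_finite:
  assumes "forced \<Phi> L E h n" shows "\<exists>E'. finite E' \<and> E' \<subseteq> E \<and> forced \<Phi> L E' h n"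
proof -
  obtain l D where e: "evidence L E h l D" "ev \<Phi> l D n = Suc 1" using assms by (auto simp: forced_def)
  define F where "F = (\<lambda>i. eqc (look h i - Suc 0) (look h i - Suc 0)) ` {..<len h} \<union>
      bsub (look h) ` {..<l} \<union> (\<lambda>m. bneg (bsub (look h) m)) ` {..<l}"
  have "evidence L (E \<inter> F) h l D" by (rule evidence_mono[OF e(1)]) (simp_all add: F_def)
  moreover have "finite (E \<inter> F)" by (simp add: F_def)
  ultimately show ?thesis using e(2) unfolding forced_def by blast
qed

lemma look_extends:
  assumes "extends H hs" "bval L m" "m < length hs"
  shows "babs (look (list_encode hs)) m \<longleftrightarrow> babs H m" "bsub (look (list_encode hs)) m = bsub H m"
proof -
  obtain \<psi> where \<psi>: "m = code_basic \<psi>" using bval_ex[OF assms(2)] by blast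
  have eq: "look (list_encode hs) a = H a" if "a \<in> set_basic \<psi>" for a
    using set_basic_le_code[OF that] assms(1,3) \<psi> by (simp add: look_list_encode extends_def)
  show "babs (look (list_encode hs)) m \<longleftrightarrow> babs H m"
    unfolding \<psi> babs_code_basic using eq by simp
  have "map_basic (\<lambda>a. look (list_encode hs) a - Suc 0) \<psi> = map_basic (\<lambda>a. H a - Suc 0) \<psi>"
    using eq by (intro basic.map_cong) simp_all
  then show "bsub (look (list_encode hs)) m = bsub H m"
    unfolding \<psi> bsub_code_basic by simp
qed

lemma forced_valid:
  assumes "forced \<Phi> L (dcode L S) (list_encode hs) n" shows "valid S hs"
  using assms unfolding forced_def evidence_def valid_def len_list_encode
  by (auto simp: look_list_encode eqc_in_diagram)

text \<open>Below \<open>l\<close> the code \<open>D\<close> agrees with the diagram of the copy, so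
  the bounded evaluation is a genuine computation of \<open>\<Phi>\<close> on the copy.\<close>

lemma forced_sound:
  assumes S: "is_structure L S" and H: "full S H" "extends H hs"
    and f: "forced \<Phi> L (dcode L S) (list_encode hs) n"
  shows "run (dcode L (copy S H)) \<Phi> n = Some 1"
proof -
  obtain l D where e: "evidence L (dcode L S) (list_encode hs) l D" and ev: "ev \<Phi> l D n = Suc 1"
    using f unfolding forced_def by blast
  have l: "l \<le> length hs" using e by (simp add: evidence_def len_list_encode)
  have "m \<in> set_decode D \<longleftrightarrow> m \<in> dcode L (copy S H)" if m: "m < l" for m
  proof (cases "bval L m")
    case True
    have c: "babs (look (list_encode hs)) m \<longleftrightarrow> babs H m" "bsub (look (list_encode hs)) m = bsub H m"
      using look_extends[OF H(2) True] m l by simp_all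
    have "if m \<in> set_decode D then bval L m \<and> \<not> babs H m \<and> bsub H m \<in> dcode L S
        else bval L m \<longrightarrow> babs H m \<or> bneg (bsub H m) \<in> dcode L S"
      using e m unfolding evidence_def c[symmetric] by blast
    then show ?thesis
      using True dcode_negate[OF H(1) S True] unfolding dcode_copy[OF H(1) S] by (auto split: if_splits)
  next
    case False
    then have "m \<notin> set_decode D" using e m unfolding evidence_def by meson
    then show ?thesis using False dcode_copy[OF H(1) S] by simp
  qed
  then have "agree l D (dcode L (copy S H))" by (simp add: agree_def)
  then show ?thesis using ev by (rule ev_sound)
qed

text \<open>A part of the presentation at least as long as the use of the computation settles all
  its oracle queries. The claim covers all long parts, so that it can be combined with lower bounds
  on their length.\<close>

lemma forced_complete:
  assumes S: "is_structure L S" and H: "full S H" and r: "run (dcode L (copy S H)) \<Phi> n = Some 1"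
  shows "\<forall>\<^sub>F N in sequentially. forced \<Phi> L (dcode L S) (list_encode (map H [0..<N])) n"
proof -
  let ?X = "dcode L (copy S H)"
  obtain l where l: "\<And>D. agree l D ?X \<Longrightarrow> ev \<Phi> l D n = Suc 1"
    using ev_complete[OF r] unfolding eventually_sequentially by blast
  define D where "D = set_encode (?X \<inter> {..<l})"
  have D: "set_decode D = ?X \<inter> {..<l}" by (simp add: D_def)
  then have ev: "ev \<Phi> l D n = Suc 1" by (intro l) (simp add: agree_def)
  show ?thesis using eventually_ge_at_top[of l]
  proof eventually_elim
    case (elim N)
    let ?hs = "map H [0..<N]"
    have ext: "extends H ?hs" by (simp add: extends_def)
    have "evidence L (dcode L S) (list_encode ?hs) l D"
      unfolding evidence_def len_list_encode
    proof (intro conjI allI impI)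
      show "l \<le> length ?hs" using elim by simp
    next
      fix i assume i: "i < length ?hs" "look (list_encode ?hs) i \<noteq> 0"
      have look: "look (list_encode ?hs) j = ?hs ! j" if "j \<le> i" for j
        using i(1) that by (simp add: look_list_encode)
      have v: "?hs ! i - Suc 0 \<in> universe S \<and> (\<forall>j<i. ?hs ! j \<noteq> ?hs ! i)"
        using valid_full[OF H, of N] i unfolding valid_def look[OF order_refl] by blast
      then show "eqc (look (list_encode ?hs) i - Suc 0) (look (list_encode ?hs) i - Suc 0) \<in> dcode L S"
        unfolding look[OF order_refl] eqc_in_diagram by blast
      show "look (list_encode ?hs) j \<noteq> look (list_encode ?hs) i" if "j < i" for j
        using v that unfolding look[OF order_refl] look[OF less_imp_le[OF that]] by blast
    next
      fix m assume m: "m < l"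
      have mem: "m \<in> set_decode D \<longleftrightarrow> bval L m \<and> \<not> babs H m \<and> bsub H m \<in> dcode L S"
        using m unfolding D Int_iff dcode_copy[OF H S] by simp
      show "if m \<in> set_decode D then bval L m \<and> \<not> babs (look (list_encode ?hs)) m \<and>
          bsub (look (list_encode ?hs)) m \<in> dcode L S
        else bval L m \<longrightarrow> babs (look (list_encode ?hs)) m \<or> bneg (bsub (look (list_encode ?hs)) m) \<in> dcode L S"
      proof (cases "bval L m")
        case True
        have "m < length ?hs" using m elim by simp
        then show ?thesis
          unfolding look_extends[OF ext True \<open>m < length ?hs\<close>]
          using mem True dcode_negate[OF H S True] by (cases "m \<in> set_decode D"; cases "babs H m") simp_all
      next
        case False
        then show ?thesis using mem by simp
      qed
    qed
    then show ?case using ev unfolding forced_def by blast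
  qed
qed

section \<open>Forcing a least or a greatest element\<close>

text \<open>The parameter lets the searches for a least and for a greatest element share their
  lemmas: a greatest element is a least one of the reversed order.\<close>

definition lts :: "nat \<Rightarrow> struct \<Rightarrow> nat \<Rightarrow> nat \<Rightarrow> bool" where
  "lts \<sigma> T = (if \<sigma> = 0 then lt T else (lt T)\<inverse>\<inverse>)"

definition ltsc :: "nat \<Rightarrow> nat \<Rightarrow> nat \<Rightarrow> nat" where
  "ltsc \<sigma> a b = (if \<sigma> = 0 then ltc a b else ltc b a)"

lemma ltsc_in_diagram:
  "ltsc \<sigma> a b \<in> dcode order_lang T \<longleftrightarrow> a \<in> universe T \<and> b \<in> universe T \<and> lts \<sigma> T a b"
  unfolding ltsc_def lts_def by (cases "\<sigma> = 0") (auto simp: ltc_in_diagram simp del: image_iff)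

definition ext :: "nat \<Rightarrow> nat \<Rightarrow> bool" where
  "ext h h' \<longleftrightarrow> len h \<le> len h' \<and> (\<forall>i<len h. look h' i = look h i)"

text \<open>
  A candidate \<open>(h, x, d)\<close> claims that \<open>x\<close> is least (for \<open>\<sigma> = 0\<close>) or greatest (for \<open>\<sigma> = 1\<close>) in the
  image of every copy presented by an extension of \<open>h\<close>; \<open>d\<close> only serves to repeat candidates.
\<close>

definition candidate :: "prog \<Rightarrow> language \<Rightarrow> nat set \<Rightarrow> nat \<Rightarrow> bool" where
  "candidate \<Phi> L E n \<longleftrightarrow> forced \<Phi> L E (p1 n) (eqc (p1 (p2 n)) (p1 (p2 n)))"

text \<open>Both parts depend positively on \<open>E\<close>, so refutations can be enumerated. One
  extension of the condition that forces a smaller element is enough; it need not belong to any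
  fixed copy.\<close>

definition refuted :: "prog \<Rightarrow> language \<Rightarrow> nat set \<Rightarrow> nat \<Rightarrow> nat \<Rightarrow> bool" where
  "refuted \<Phi> L E \<sigma> n \<longleftrightarrow> candidate \<Phi> L E n \<and>
     (\<exists>h y. ext (p1 n) h \<and> forced \<Phi> L E h (ltsc \<sigma> y (p1 (p2 n))))"

lemma turing_image_run:
  assumes "turing_image \<Phi> L L' S T"
  shows "run (dcode L S) \<Phi> n = Some 1 \<longleftrightarrow> n \<in> dcode L' T"
proof -
  have "run (dcode L S) \<Phi> n = Some (if n \<in> dcode L' T then 1 else 0)"
    using assms unfolding turing_image_def computes_char_fun_def by blast
  then show ?thesis by (cases "n \<in> dcode L' T") simp_all
qed

lemma turing_image_universe:
  assumes "turing_image \<Phi> L L' S T"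
  shows "run (dcode L S) \<Phi> (eqc x x) = Some 1 \<longleftrightarrow> x \<in> universe T"
  unfolding turing_image_run[OF assms] by (rule eqc_in_diagram)

lemma turing_image_lts:
  assumes "turing_image \<Phi> L order_lang S T"
  shows "run (dcode L S) \<Phi> (ltsc \<sigma> a b) = Some 1 \<longleftrightarrow> a \<in> universe T \<and> b \<in> universe T \<and> lts \<sigma> T a b"
  unfolding turing_image_run[OF assms] by (rule ltsc_in_diagram)

text \<open>The last component of a candidate is free, so one forced element gives arbitrarily large
  candidates, as \<open>points_no_least\<close> demands.\<close>

lemma candidate_ex:
  assumes S: "is_structure L S"
    and img: "\<And>S'. is_structure L S' \<Longrightarrow> isomorphic L S' S \<Longrightarrow>
      \<exists>T. turing_image \<Phi> L order_lang S' T \<and> universe T \<noteq> {}"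
  shows "\<exists>n\<ge>N. candidate \<Phi> L (dcode L S) n"
proof -
  have "valid S []" by (simp add: valid_def)
  then obtain H where H: "full S H" using full_extension by blast
  obtain T where T: "turing_image \<Phi> L order_lang (copy S H) T" "universe T \<noteq> {}"
    using img[OF is_structure_copy[OF H S] isomorphic_copy[OF H S]] by blast
  then obtain x where "x \<in> universe T" by blast
  then have "run (dcode L (copy S H)) \<Phi> (eqc x x) = Some 1" using turing_image_universe[OF T(1)] by blast
  from forced_complete[OF S H this]
  obtain M where M: "forced \<Phi> L (dcode L S) (list_encode (map H [0..<M])) (eqc x x)"
    unfolding eventually_sequentially by blast
  define n where "n = prod_encode (list_encode (map H [0..<M]), prod_encode (x, N))"
  have "candidate \<Phi> L (dcode L S) n" using M by (simp add: candidate_def n_def)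
  moreover have "N \<le> n" unfolding n_def by (meson le_prod_encode_2 order_trans)
  ultimately show ?thesis by blast
qed

lemma extends_prefix: "extends H (xs @ ys) \<Longrightarrow> extends H xs"
  by (simp add: extends_def nth_append)

lemma extends_map: "extends H hs \<Longrightarrow> length hs \<le> N \<Longrightarrow> ext (list_encode hs) (list_encode (map H [0..<N]))"
  by (simp add: ext_def len_list_encode look_list_encode extends_def)

text \<open>Extend the condition to a full presentation. In the image of that copy some
  \<open>y\<close> lies before \<open>x\<close> in the direction given by \<open>\<sigma>\<close>,
  and a longer finite part of the presentation already forces this.\<close>

lemma all_refuted:
  assumes S: "is_structure L S"
    and img: "\<And>S'. is_structure L S' \<Longrightarrow> isomorphic L S' S \<Longrightarrow>
      \<exists>T. turing_image \<Phi> L order_lang S' T \<and> unbounded (universe T) (lts \<sigma> T)\<inverse>\<inverse>"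
    and c: "candidate \<Phi> L (dcode L S) n"
  shows "refuted \<Phi> L (dcode L S) \<sigma> n"
proof -
  define hs where "hs = list_decode (p1 n)"
  define x where "x = p1 (p2 n)"
  have f: "forced \<Phi> L (dcode L S) (list_encode hs) (eqc x x)"
    using c by (simp add: candidate_def hs_def x_def)
  obtain H where H: "full S H" "extends H hs" using full_extension[OF forced_valid[OF f]] by blast
  obtain T where T: "turing_image \<Phi> L order_lang (copy S H) T" "unbounded (universe T) (lts \<sigma> T)\<inverse>\<inverse>"
    using img[OF is_structure_copy[OF H(1) S] isomorphic_copy[OF H(1) S]] by blast
  have x: "x \<in> universe T" using forced_sound[OF S H f] turing_image_universe[OF T(1)] by blast
  then obtain y where y: "y \<in> universe T" "lts \<sigma> T y x" using T(2) by (auto simp: unbounded_def)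
  then have "run (dcode L (copy S H)) \<Phi> (ltsc \<sigma> y x) = Some 1"
    unfolding turing_image_lts[OF T(1)] using x by blast
  from forced_complete[OF S H(1) this] eventually_ge_at_top[of "length hs"]
  have "\<forall>\<^sub>F N in sequentially. forced \<Phi> L (dcode L S) (list_encode (map H [0..<N])) (ltsc \<sigma> y x) \<and> length hs \<le> N"
    by (rule eventually_conj)
  then obtain N where N: "forced \<Phi> L (dcode L S) (list_encode (map H [0..<N])) (ltsc \<sigma> y x)" "length hs \<le> N"
    unfolding eventually_sequentially by blast
  have "ext (p1 n) (list_encode (map H [0..<N]))"
    using extends_map[OF H(2) N(2)] by (simp add: hs_def)
  then show ?thesis using c N(1) unfolding refuted_def x_def by blast
qed

lemma ext_list_encode:
  assumes "ext (list_encode hs) h" shows "\<exists>zs. list_decode h = hs @ zs"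
proof -
  have l: "length hs \<le> length (list_decode h)" and eq: "\<And>i. i < length hs \<Longrightarrow> list_decode h ! i = hs ! i"
    using assms by (auto simp: ext_def len_def look_def split: if_splits dest: spec)
  have "take (length hs) (list_decode h) = hs" using l eq by (simp add: list_eq_iff_nth_eq)
  then show ?thesis by (metis append_take_drop_id)
qed

lemma valid_append_0: "valid S hs \<Longrightarrow> valid S (hs @ [0])"
  by (auto simp: valid_def nth_append less_Suc_eq)

lemma valid_append_element:
  assumes "valid S hs" "a \<in> universe S" "Suc a \<notin> set hs"
  shows "valid S (hs @ [Suc a])"
proof -
  have "hs ! j \<noteq> Suc a" if "j < length hs" for j using assms(3) that by (metis nth_mem)
  then show ?thesis using assms(1,2) by (auto simp: valid_def nth_append less_Suc_eq)
qed

text \<open>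
  If every candidate is refuted then a sufficiently generic copy is sent to an order without a
  least element: at stage \<open>k\<close> the construction adds the element \<open>k\<close> of \<open>S\<close> and refutes that
  \<open>p1 k\<close> is least.
\<close>

lemma unrefuted_ex:
  assumes S: "is_structure L S"
    and img: "\<And>S'. is_structure L S' \<Longrightarrow> isomorphic L S' S \<Longrightarrow>
      \<exists>T. turing_image \<Phi> L order_lang S' T \<and> linear_on (universe T) (lts \<sigma> T) \<and> has_least (universe T) (lts \<sigma> T)"
  shows "\<exists>n. candidate \<Phi> L (dcode L S) n \<and> \<not> refuted \<Phi> L (dcode L S) \<sigma> n"
proof (rule ccontr)
  assume contr: "\<nexists>n. candidate \<Phi> L (dcode L S) n \<and> \<not> refuted \<Phi> L (dcode L S) \<sigma> n"
  \<comment> \<open>\<open>zs\<close> is the refuting extension and \<open>ws\<close> brings in the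
    element \<open>k\<close>. A non-empty \<open>ws\<close> makes the lists grow, so that their
    limit is defined everywhere.\<close>
  define step where "step k hs hs' \<longleftrightarrow> (\<exists>zs ws. hs' = hs @ zs @ ws \<and> ws \<noteq> [] \<and>
      (k \<in> universe S \<longrightarrow> Suc k \<in> set hs') \<and>
      (forced \<Phi> L (dcode L S) (list_encode hs) (eqc (p1 k) (p1 k)) \<longrightarrow>
        (\<exists>y. forced \<Phi> L (dcode L S) (list_encode (hs @ zs)) (ltsc \<sigma> y (p1 k)))))" for k hs hs'
  have "\<exists>hs'. valid S hs' \<and> step k hs hs'" if hs: "valid S hs" for k hs
  proof -
    obtain zs where zs: "valid S (hs @ zs)"
      "forced \<Phi> L (dcode L S) (list_encode hs) (eqc (p1 k) (p1 k)) \<longrightarrow>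
        (\<exists>y. forced \<Phi> L (dcode L S) (list_encode (hs @ zs)) (ltsc \<sigma> y (p1 k)))"
    proof (cases "forced \<Phi> L (dcode L S) (list_encode hs) (eqc (p1 k) (p1 k))")
      case True
      define n where "n = prod_encode (list_encode hs, prod_encode (p1 k, 0))"
      have "candidate \<Phi> L (dcode L S) n" using True by (simp add: candidate_def n_def)
      then have "refuted \<Phi> L (dcode L S) \<sigma> n" using contr by blast
      then obtain h y where h: "ext (list_encode hs) h" "forced \<Phi> L (dcode L S) h (ltsc \<sigma> y (p1 k))"
        by (auto simp: refuted_def n_def)
      obtain zs where "list_decode h = hs @ zs" using ext_list_encode[OF h(1)] by blast
      then have "h = list_encode (hs @ zs)" by (metis list_decode_inverse)
      then show ?thesis using h(2) forced_valid by (intro that[of zs]) blast+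
    next
      case False
      then show ?thesis using hs by (intro that[of "[]"]) simp_all
    qed
    \<comment> \<open>The appended 0 is an absent number: it lengthens the list without affecting
      validity.\<close>
    have zs0: "valid S (hs @ zs @ [0])" using valid_append_0[OF zs(1)] by simp
    show ?thesis
    proof (cases "k \<in> universe S \<and> Suc k \<notin> set (hs @ zs @ [0])")
      case True
      then have "valid S (hs @ zs @ [0, Suc k])" using valid_append_element[OF zs0] by simp
      moreover have "step k hs (hs @ zs @ [0, Suc k])"
        unfolding step_def using zs(2) by (intro exI[of _ zs] exI[of _ "[0, Suc k]"]) simp
      ultimately show ?thesis by blast
    next
      case False
      have "step k hs (hs @ zs @ [0])"
        unfolding step_def using zs(2) False by (intro exI[of _ zs] exI[of _ "[0]"]) simp
      then show ?thesis using zs0 by blast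
    qed
  qed
  moreover have "valid S []" by (simp add: valid_def)
  ultimately have "\<exists>G. \<forall>k. valid S (G k) \<and> step k (G k) (G (Suc k))"
    by (intro dependent_nat_choice) blast+
  then obtain G where valid: "\<And>k. valid S (G k)" and step: "\<And>k. step k (G k) (G (Suc k))" by blast
  have len: "k \<le> length (G k)" for k
  proof (induction k)
    case (Suc k)
    obtain zs ws where "G (Suc k) = G k @ zs @ ws" "ws \<noteq> []" using step[of k] unfolding step_def by blast
    then have "length (G k) < length (G (Suc k))" by simp
    then show ?case using Suc by simp
  qed simp
  have nth: "G j ! i = G k ! i" if "k \<le> j" "i < length (G k)" for i j k
  proof -
    have "i < length (G j) \<and> G j ! i = G k ! i" using that(1)
    proof (induction j rule: dec_induct)
      case base
      show ?case using that(2) by simp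
    next
      case (step j)
      obtain zs where "G (Suc j) = G j @ zs" using \<open>\<And>k. step k (G k) (G (Suc k))\<close>[of j] unfolding step_def by blast
      then show ?case using step.IH by (simp add: nth_append)
    qed
    then show ?thesis by blast
  qed
  \<comment> \<open>The limit of the lists; \<open>G (Suc i)\<close> has more than \<open>i\<close>
    entries.\<close>
  define H where "H i = G (Suc i) ! i" for i
  have ext: "extends H (G k)" for k
    unfolding extends_def
  proof (intro allI impI)
    fix i assume i: "i < length (G k)"
    have "i < length (G (Suc i))" using len[of "Suc i"] by simp
    then show "H i = G k ! i"
      using nth[of k "max k (Suc i)" i] nth[of "Suc i" "max k (Suc i)" i] i by (simp add: H_def)
  qed
  have full: "full S H"
    unfolding full_def
  proof
    have "H i \<noteq> H j" if "i < j" "H j \<noteq> 0" for i j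
    proof -
      have l: "j < length (G (Suc j))" using len[of "Suc j"] by simp
      have "H i = G (Suc j) ! i" "H j = G (Suc j) ! j"
        using ext[of "Suc j"] l that(1) by (simp_all add: extends_def)
      then show ?thesis using valid[of "Suc j"] l that unfolding valid_def by metis
    qed
    then show "inj_on H {i. H i \<noteq> 0}" by (intro linorder_inj_onI) auto
    show "H ` {i. H i \<noteq> 0} = Suc ` universe S"
    proof (intro set_eqI iffI)
      fix b assume "b \<in> H ` {i. H i \<noteq> 0}"
      then obtain i where i: "b = H i" "H i \<noteq> 0" by blast
      have l: "i < length (G (Suc i))" using len[of "Suc i"] by simp
      then have "H i - Suc 0 \<in> universe S" using valid[of "Suc i"] i(2) by (simp add: valid_def H_def)
      then show "b \<in> Suc ` universe S" using i by (auto intro: image_eqI[of _ _ "H i - Suc 0"])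
    next
      fix b assume "b \<in> Suc ` universe S"
      then obtain k where k: "b = Suc k" "k \<in> universe S" by blast
      then have "Suc k \<in> set (G (Suc k))" using step[of k] unfolding step_def by blast
      then obtain i where i: "i < length (G (Suc k))" "G (Suc k) ! i = Suc k" by (auto simp: in_set_conv_nth)
      then have "H i = Suc k" using ext[of "Suc k"] by (simp add: extends_def)
      then show "b \<in> H ` {i. H i \<noteq> 0}" using k(1) by (intro image_eqI[of _ _ i]) simp_all
    qed
  qed
  obtain T where T: "turing_image \<Phi> L order_lang (copy S H) T" "linear_on (universe T) (lts \<sigma> T)"
      "has_least (universe T) (lts \<sigma> T)"
    using img[OF is_structure_copy[OF full S] isomorphic_copy[OF full S]] by blast
  obtain x where x: "x \<in> universe T" "\<forall>y\<in>universe T. y \<noteq> x \<longrightarrow> lts \<sigma> T x y"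
    using T(3) by (auto simp: has_least_def)
  have "run (dcode L (copy S H)) \<Phi> (eqc x x) = Some 1" using x turing_image_universe[OF T(1)] by blast
  from forced_complete[OF S full this]
  obtain N where N: "\<And>M. N \<le> M \<Longrightarrow> forced \<Phi> L (dcode L S) (list_encode (map H [0..<M])) (eqc x x)"
    unfolding eventually_sequentially by blast
  \<comment> \<open>Stage \<open>k\<close> attacks \<open>x\<close>, as \<open>p1 k = x\<close>, and
    it is late enough, as \<open>N \<le> k\<close>, for the list to force \<open>x\<close> into the
    image.\<close>
  define k where "k = prod_encode (x, N)"
  have "N \<le> length (G k)" using len[of k] le_prod_encode_2[of N x] by (simp add: k_def)
  moreover have "map H [0..<length (G k)] = G k"
    using ext[of k] by (intro nth_equalityI) (simp_all add: extends_def)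
  ultimately have "forced \<Phi> L (dcode L S) (list_encode (G k)) (eqc (p1 k) (p1 k))"
    using N[of "length (G k)"] by (simp add: k_def)
  then obtain zs ws y where y: "G (Suc k) = G k @ zs @ ws"
      "forced \<Phi> L (dcode L S) (list_encode (G k @ zs)) (ltsc \<sigma> y x)"
    using step[of k] unfolding step_def by (auto simp: k_def)
  have "extends H ((G k @ zs) @ ws)" using ext[of "Suc k"] y(1) by simp
  then have "extends H (G k @ zs)" by (rule extends_prefix)
  note r = forced_sound[OF S full this y(2)]
  then have yT: "y \<in> universe T" and "lts \<sigma> T y x" unfolding turing_image_lts[OF T(1)] by blast+
  moreover have "y \<noteq> x" using \<open>lts \<sigma> T y x\<close> linear_onD(1)[OF T(2) x(1)] by metis
  then have "lts \<sigma> T x y" using x(2) yT by blast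
  ultimately show False using linear_onD(4)[OF T(2) _ yT x(1)] by blast
qed

section \<open>The order built from candidates and refutations\<close>

text \<open>
  The point \<open>(n, F)\<close> is read as the infinite sequence with the digit 0 at the places \<open>k < n\<close> in
  \<open>F\<close>, the digit 2 at the other places below \<open>n\<close>, and the digit 1 from \<open>n\<close> on; points are ordered
  lexicographically.
\<close>

definition digit :: "nat \<Rightarrow> nat \<Rightarrow> nat" where
  "digit p j = (if j < p1 p then if j \<in> set_decode (p2 p) then 0 else 2 else 1)"

definition pless :: "nat \<Rightarrow> nat \<Rightarrow> bool" where
  "pless p q \<longleftrightarrow> (\<exists>k\<le>p1 p + p1 q. (\<forall>j<k. digit p j = digit q j) \<and> digit p k < digit q k)"

text \<open>Membership depends positively on \<open>P\<close> and \<open>R\<close>, so a growing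
  diagram only adds points. Once \<open>k\<close> is refuted, the digit 0 becomes available at
  \<open>k\<close>, and points that use it lie below all points that agree with them before
  \<open>k\<close> and have the digit 1 or 2 there.\<close>

definition points :: "nat set \<Rightarrow> nat set \<Rightarrow> nat set" where
  "points P R = {p. p1 p \<in> P \<and> (\<forall>k\<in>set_decode (p2 p). k < p1 p \<and> k \<in> R)}"

text \<open>From the larger of the two lengths on, both digits are 1, so a difference occurs
  earlier. Thus the bound in \<open>pless\<close>, which makes the relation decidable, loses
  nothing.\<close>

lemma plessI:
  assumes "\<And>j. j < k \<Longrightarrow> digit p j = digit q j" "digit p k < digit q k"
  shows "pless p q"
proof -
  have "\<not> (p1 p \<le> k \<and> p1 q \<le> k)"
  proof
    assume "p1 p \<le> k \<and> p1 q \<le> k"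
    then have "digit p k = 1" "digit q k = 1" by (simp_all add: digit_def)
    then show False using assms(2) by simp
  qed
  then have "k \<le> p1 p + p1 q" by linarith
  then show ?thesis unfolding pless_def using assms by blast
qed

text \<open>The hypotheses keep the finite sets below the lengths, since members beyond would not
  show in the digits.\<close>

lemma digit_inject:
  assumes p: "\<forall>k\<in>set_decode (p2 p). k < p1 p" and q: "\<forall>k\<in>set_decode (p2 q). k < p1 q"
    and eq: "\<And>j. digit p j = digit q j"
  shows "p = q"
proof -
  have one: "digit p j = 1 \<longleftrightarrow> p1 p \<le> j" "digit q j = 1 \<longleftrightarrow> p1 q \<le> j" for j
    by (auto simp: digit_def)
  then have "p1 p \<le> j \<longleftrightarrow> p1 q \<le> j" for j using eq[of j] by metis
  then have 1: "p1 p = p1 q" by (meson order_antisym order_refl)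
  have "digit p j = 0 \<longleftrightarrow> j \<in> set_decode (p2 p)" "digit q j = 0 \<longleftrightarrow> j \<in> set_decode (p2 q)" for j
    using p q by (auto simp: digit_def)
  then have "set_decode (p2 p) = set_decode (p2 q)" using eq by (intro set_eqI) metis
  then have 2: "p2 p = p2 q" by (metis set_decode_inverse)
  have "prod_encode (p1 p, p2 p) = prod_encode (p1 q, p2 q)" by (simp only: 1 2)
  then show ?thesis by (simp only: encode_p1_p2)
qed

lemma linear_on_points: "linear_on (points P R) pless"
  unfolding linear_on_def
proof (intro conjI ballI impI)
  fix p show "\<not> pless p p" by (simp add: pless_def)
next
  fix p q s assume "pless p q" "pless q s"
  then obtain i j where i: "\<And>l. l < i \<Longrightarrow> digit p l = digit q l" "digit p i < digit q i"
    and j: "\<And>l. l < j \<Longrightarrow> digit q l = digit s l" "digit q j < digit s j"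
    unfolding pless_def by blast
  show "pless p s"
  proof (rule plessI[of "min i j"])
    show "digit p l = digit s l" if "l < min i j" for l using i(1)[of l] j(1)[of l] that by simp
    show "digit p (min i j) < digit s (min i j)"
      using i(1)[of j] i(2) j(1)[of i] j(2) by (cases i j rule: linorder_cases) simp_all
  qed
next
  fix p q assume pq: "p \<in> points P R" "q \<in> points P R" "p \<noteq> q"
  then obtain i where "digit p i \<noteq> digit q i"
    using digit_inject[of p q] unfolding points_def by blast
  define k where "k = (LEAST i. digit p i \<noteq> digit q i)"
  have k: "digit p k \<noteq> digit q k" unfolding k_def using \<open>digit p i \<noteq> digit q i\<close> by (rule LeastI)
  have below: "digit p j = digit q j" if "j < k" for j
    using not_less_Least that unfolding k_def by blast
  show "pless p q \<or> pless q p"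
  proof (cases "digit p k < digit q k")
    case True
    then show ?thesis using plessI[of k p q] below by blast
  next
    case False
    then have "digit q k < digit p k" using k by simp
    then show ?thesis using plessI[of k q p] below by metis
  qed
qed

text \<open>
  The true path has the digit 0 at refuted places, 2 at places that are not candidates, and ends at
  the first unrefuted candidate.  Every point lies at or above it.
\<close>

lemma points_least:
  assumes R: "R \<subseteq> P" and U: "P - R \<noteq> {}"
  shows "has_least (points P R) pless"
proof -
  \<comment> \<open>The first candidate that is never refuted, where the true path ends.\<close>
  define m where "m = (LEAST n. n \<in> P - R)"
  have m: "m \<in> P" "m \<notin> R" using LeastI_ex[of "\<lambda>n. n \<in> P - R"] U unfolding m_def by blast+
  have below: "k \<in> P \<Longrightarrow> k \<in> R" if "k < m" for k using not_less_Least[of k "\<lambda>n. n \<in> P - R"] that unfolding m_def by blast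
  define t where "t = prod_encode (m, set_encode (R \<inter> {..<m}))"
  have dec: "set_decode (p2 t) = R \<inter> {..<m}" "p1 t = m" by (simp_all add: t_def)
  have t: "t \<in> points P R" using m dec by (simp add: points_def)
  have "pless t q" if q: "q \<in> points P R" "q \<noteq> t" for q
  proof -
    have q': "p1 q \<in> P" "\<And>k. k \<in> set_decode (p2 q) \<Longrightarrow> k < p1 q \<and> k \<in> R"
      using q(1) by (simp_all add: points_def)
    obtain i where "digit t i \<noteq> digit q i"
      using digit_inject[of t q] t q unfolding points_def by blast
    define k where "k = (LEAST i. digit t i \<noteq> digit q i)"
    have k: "digit t k \<noteq> digit q k" unfolding k_def using \<open>digit t i \<noteq> digit q i\<close> by (rule LeastI)
    have eq: "digit t j = digit q j" if "j < k" for j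
      using not_less_Least that unfolding k_def by blast
    \<comment> \<open>If the digits agreed up to and including \<open>m\<close>, then
      \<open>q\<close> would have ended by \<open>m\<close> too, and both sequences would be 1 from
      there on.\<close>
    have km: "k \<le> m"
    proof (rule ccontr)
      assume "\<not> k \<le> m"
      then have "digit t m = digit q m" by (intro eq) simp
      then have "p1 q \<le> m" using dec by (auto simp: digit_def split: if_splits)
      then have "digit q k = 1" "digit t k = 1" using \<open>\<not> k \<le> m\<close> dec by (simp_all add: digit_def)
      then show False using k by simp
    qed
    have "digit t k < digit q k"
    proof (cases "k < m")
      case True
      show ?thesis
      proof (cases "k \<in> R")
        case True
        then have "digit t k = 0" using \<open>k < m\<close> dec by (simp add: digit_def)
        then show ?thesis using k by simp
      next
        case False
        \<comment> \<open>Here \<open>q\<close> cannot end at \<open>k\<close>, which is no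
          candidate, nor earlier, since \<open>t\<close> has no digit 1 before \<open>m\<close>. So
          both digits are 2, contrary to the choice of \<open>k\<close>.\<close>
        then have "k \<notin> P" using below \<open>k < m\<close> by blast
        then have "k \<noteq> p1 q" "k \<notin> set_decode (p2 q)" using q' R by auto
        have "\<not> p1 q < k"
        proof
          assume "p1 q < k"
          then have "digit t (p1 q) = digit q (p1 q)" by (rule eq)
          then show False using \<open>p1 q < k\<close> \<open>k < m\<close> dec by (auto simp: digit_def split: if_splits)
        qed
        then have "digit q k = 2" using \<open>k \<noteq> p1 q\<close> \<open>k \<notin> set_decode (p2 q)\<close> by (simp add: digit_def)
        moreover have "digit t k = 2" using False \<open>k < m\<close> dec by (simp add: digit_def)
        ultimately show ?thesis using k by simp
      qed
    next
      case False
      then have "k = m" using km by simp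
      then have "digit t k = 1" using dec by (simp add: digit_def)
      moreover have "k \<notin> set_decode (p2 q)" using q'(2) m(2) \<open>k = m\<close> by blast
      then have "digit q k \<noteq> 0" by (simp add: digit_def)
      ultimately show ?thesis using k by simp
    qed
    then show ?thesis using plessI[of k t q] eq by blast
  qed
  then show ?thesis unfolding has_least_def using t by blast
qed

text \<open>Go to a candidate \<open>n\<close> beyond the end of \<open>q\<close> and put the digit
  0 at every candidate below \<open>n\<close>. Before its end \<open>q\<close> has the digit 0 only
  at candidates, so the new point is nowhere larger there, and at the end of \<open>q\<close> it has
  0 against 1.\<close>

lemma points_no_least:
  assumes inf: "\<And>N. \<exists>n\<ge>N. n \<in> P"
  shows "unbounded (points P P) pless\<inverse>\<inverse>"
  unfolding unbounded_def
proof
  fix q assume q: "q \<in> points P P"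
  then have q': "p1 q \<in> P" "\<And>k. k \<in> set_decode (p2 q) \<Longrightarrow> k < p1 q \<and> k \<in> P"
    by (simp_all add: points_def)
  obtain n where n: "Suc (p1 q) \<le> n" "n \<in> P" using inf by blast
  define t where "t = prod_encode (n, set_encode (P \<inter> {..<n}))"
  have dec: "set_decode (p2 t) = P \<inter> {..<n}" "p1 t = n" by (simp_all add: t_def)
  have t: "t \<in> points P P" using n dec by (simp add: points_def)
  have at: "digit t (p1 q) < digit q (p1 q)" using q' n dec by (simp add: digit_def)
  have le: "digit t j \<le> digit q j" if "j < p1 q" for j
    using that q'(2)[of j] n dec by (auto simp: digit_def)
  define k where "k = (LEAST i. digit t i \<noteq> digit q i)"
  have ne: "digit t (p1 q) \<noteq> digit q (p1 q)" using at by simp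
  have k: "digit t k \<noteq> digit q k" unfolding k_def using ne by (rule LeastI)
  have eq: "digit t j = digit q j" if "j < k" for j
    using not_less_Least that unfolding k_def by blast
  have "k \<le> p1 q" unfolding k_def using ne by (rule Least_le)
  then have "digit t k < digit q k" using le[of k] at k by (cases "k = p1 q") simp_all
  then have "pless t q" using plessI[of k t q] eq by blast
  then show "\<exists>y\<in>points P P. pless\<inverse>\<inverse> q y" using t by blast
qed

section \<open>The enumeration operator\<close>

text \<open>Oracle-free: finite sets of evidence enter as numbers through
  \<open>set_decode\<close>.\<close>

definition semidecidable :: "(nat \<Rightarrow> bool) \<Rightarrow> bool" where
  "semidecidable P \<longleftrightarrow> (\<exists>R. decidable (\<lambda>X n. R (p1 n) (p2 n)) \<and> (\<forall>n. P n \<longleftrightarrow> (\<exists>k. R n k)))"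

lemma semidecidable_ce_set:
  assumes "semidecidable P" shows "ce_set {n. P n}"
proof -
  obtain R where R: "decidable (\<lambda>X n. R (p1 n) (p2 n))" "\<And>n. P n \<longleftrightarrow> (\<exists>k. R n k)"
    using assms unfolding semidecidable_def by blast
  then show ?thesis using recursive_ce_set[OF R(1)] by simp
qed

lemma semidecidable_decidable:
  assumes "decidable (\<lambda>X n. P n)" shows "semidecidable P"
  unfolding semidecidable_def
proof (intro exI[of _ "\<lambda>n k. P n"] conjI)
  show "decidable (\<lambda>X n. P (p1 n))" by (intro decidable_comp[OF assms] recursive_intros)
qed simp

lemma semidecidable_conj:
  assumes "semidecidable P" "semidecidable Q" shows "semidecidable (\<lambda>n. P n \<and> Q n)"
proof -
  obtain R where R: "decidable (\<lambda>X n. R (p1 n) (p2 n))" "\<And>n. P n \<longleftrightarrow> (\<exists>k. R n k)"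
    using assms(1) unfolding semidecidable_def by blast
  obtain R' where R': "decidable (\<lambda>X n. R' (p1 n) (p2 n))" "\<And>n. Q n \<longleftrightarrow> (\<exists>k. R' n k)"
    using assms(2) unfolding semidecidable_def by blast
  have "P n \<and> Q n \<longleftrightarrow> (\<exists>k. R n (p1 k) \<and> R' n (p2 k))" for n
    unfolding R(2) R'(2) by (metis p1_encode p2_encode)
  moreover have "decidable (\<lambda>X n. R (p1 n) (p1 (p2 n)) \<and> R' (p1 n) (p2 (p2 n)))"
    by (intro recursive_intros decidable_comp2[where P = "\<lambda>_. R", OF R(1)]
        decidable_comp2[where P = "\<lambda>_. R'", OF R'(1)])
  ultimately show ?thesis unfolding semidecidable_def by (intro exI[of _ "\<lambda>n k. R n (p1 k) \<and> R' n (p2 k)"]) simp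
qed

lemma semidecidable_ex:
  assumes "semidecidable (\<lambda>n. P (p1 n) (p2 n))" shows "semidecidable (\<lambda>n. \<exists>m. P n m)"
proof -
  obtain R where R: "decidable (\<lambda>X n. R (p1 n) (p2 n))" "\<And>n. P (p1 n) (p2 n) \<longleftrightarrow> (\<exists>k. R n k)"
    using assms unfolding semidecidable_def by blast
  have PR: "P n m \<longleftrightarrow> (\<exists>k. R (prod_encode (n, m)) k)" for n m using R(2)[of "prod_encode (n, m)"] by simp
  have "(\<exists>m. P n m) \<longleftrightarrow> (\<exists>j. R (prod_encode (n, p1 j)) (p2 j))" for n
    unfolding PR by (metis p1_encode p2_encode)
  moreover have "decidable (\<lambda>X n. R (prod_encode (p1 n, p1 (p2 n))) (p2 (p2 n)))"
    by (intro recursive_intros decidable_comp2[where P = "\<lambda>_. R", OF R(1)])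
  ultimately show ?thesis unfolding semidecidable_def
    by (intro exI[of _ "\<lambda>n j. R (prod_encode (n, p1 j)) (p2 j)"]) simp
qed

text \<open>Finitely many witnesses have a common bound, so the bounded universal quantifier can be
  moved inside the search.\<close>

lemma semidecidable_all_less:
  assumes "semidecidable (\<lambda>n. P (p1 n) (p2 n))" "recursive (\<lambda>X n. b n)"
  shows "semidecidable (\<lambda>n. \<forall>m<b n. P n m)"
proof -
  obtain R where R: "decidable (\<lambda>X n. R (p1 n) (p2 n))" "\<And>n. P (p1 n) (p2 n) \<longleftrightarrow> (\<exists>k. R n k)"
    using assms(1) unfolding semidecidable_def by blast
  have PR: "P n m \<longleftrightarrow> (\<exists>k. R (prod_encode (n, m)) k)" for n m using R(2)[of "prod_encode (n, m)"] by simp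
  have "(\<forall>m<b n. P n m) \<longleftrightarrow> (\<exists>j. \<forall>m<b n. \<exists>k\<le>j. R (prod_encode (n, m)) k)" for n
  proof
    assume "\<forall>m<b n. P n m"
    then obtain f where f: "\<And>m. m < b n \<Longrightarrow> R (prod_encode (n, m)) (f m)" unfolding PR by metis
    have "f m \<le> Max (f ` {..<b n})" if "m < b n" for m using that by simp
    then show "\<exists>j. \<forall>m<b n. \<exists>k\<le>j. R (prod_encode (n, m)) k" using f by blast
  next
    assume "\<exists>j. \<forall>m<b n. \<exists>k\<le>j. R (prod_encode (n, m)) k"
    then show "\<forall>m<b n. P n m" unfolding PR by blast
  qed
  moreover have "decidable (\<lambda>X n. \<forall>m<b (p1 n). \<exists>k\<le>p2 n. R (prod_encode (p1 n, m)) k)"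
    by (intro recursive_intros decidable_comp2[where P = "\<lambda>_. R", OF R(1)] recursive_comp[OF assms(2)])
  ultimately show ?thesis unfolding semidecidable_def
    by (intro exI[of _ "\<lambda>n j. \<forall>m<b n. \<exists>k\<le>j. R (prod_encode (n, m)) k"]) simp
qed

lemma semidecidable_imp:
  assumes "decidable (\<lambda>X n. Q n)" "semidecidable P" shows "semidecidable (\<lambda>n. Q n \<longrightarrow> P n)"
proof -
  obtain R where R: "decidable (\<lambda>X n. R (p1 n) (p2 n))" "\<And>n. P n \<longleftrightarrow> (\<exists>k. R n k)"
    using assms(2) unfolding semidecidable_def by blast
  have "decidable (\<lambda>X n. Q (p1 n) \<longrightarrow> R (p1 n) (p2 n))"
    by (intro recursive_intros R(1) decidable_comp[OF assms(1)])
  then show ?thesis unfolding semidecidable_def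
    by (intro exI[of _ "\<lambda>n k. Q n \<longrightarrow> R n k"]) (simp add: R(2))
qed

lemma semidecidable_comp:
  assumes "semidecidable P" "recursive (\<lambda>X n. f n)" shows "semidecidable (\<lambda>n. P (f n))"
proof -
  obtain R where R: "decidable (\<lambda>X n. R (p1 n) (p2 n))" "\<And>n. P n \<longleftrightarrow> (\<exists>k. R n k)"
    using assms(1) unfolding semidecidable_def by blast
  have "decidable (\<lambda>X n. R (f (p1 n)) (p2 n))"
    by (intro recursive_intros decidable_comp2[where P = "\<lambda>_. R", OF R(1)] recursive_comp[OF assms(2)])
  then show ?thesis unfolding semidecidable_def
    by (intro exI[of _ "\<lambda>n k. R (f n) k"]) (simp add: R(2))
qed

lemma semidecidable_comp2:
  assumes "semidecidable (\<lambda>n. P (p1 n) (p2 n))" "recursive (\<lambda>X n. f n)" "recursive (\<lambda>X n. g n)"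
  shows "semidecidable (\<lambda>n. P (f n) (g n))"
  using semidecidable_comp[OF assms(1) recursive_pair[OF assms(2,3)]] by simp

lemma semidecidable_comp3:
  assumes "semidecidable (\<lambda>n. P (p1 n) (p1 (p2 n)) (p2 (p2 n)))"
    "recursive (\<lambda>X n. f n)" "recursive (\<lambda>X n. g n)" "recursive (\<lambda>X n. h n)"
  shows "semidecidable (\<lambda>n. P (f n) (g n) (h n))"
  using semidecidable_comp[OF assms(1) recursive_pair[OF assms(2) recursive_pair[OF assms(3,4)]]] by simp

lemma semidecidable_forced:
  assumes L: "computable_language L"
    and "recursive (\<lambda>X n. e n)" "recursive (\<lambda>X n. h n)" "recursive (\<lambda>X n. m n)"
  shows "semidecidable (\<lambda>n. forced \<Phi> L (set_decode (e n)) (h n) (m n))"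
proof -
  have "decidable (\<lambda>X n. evidence L (set_decode (p1 (p1 (p1 n)))) (p1 (p2 (p1 (p1 n)))) (p2 (p1 n)) (p2 n) \<and>
      ev \<Phi> (p2 (p1 n)) (p2 n) (p2 (p2 (p1 (p1 n)))) = Suc 1)"
    unfolding evidence_def by (intro recursive_intros decidable_bval[OF L] recursive_ev)
  then have "semidecidable (\<lambda>n. forced \<Phi> L (set_decode (p1 n)) (p1 (p2 n)) (p2 (p2 n)))"
    unfolding forced_def by (intro semidecidable_ex semidecidable_decidable)
  then show ?thesis using assms(2-4)
    by (rule semidecidable_comp3[where P = "\<lambda>e h m. forced \<Phi> L (set_decode e) h m"])
qed

lemma recursive_ltsc [recursive_intros]:
  assumes "recursive s" "recursive f" "recursive g" shows "recursive (\<lambda>X n. ltsc (s X n) (f X n) (g X n))"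
  unfolding ltsc_def by (intro recursive_intros assms)

lemma decidable_ext:
  assumes "recursive f" "recursive g" shows "decidable (\<lambda>X n. ext (f X n) (g X n))"
proof -
  have "decidable (\<lambda>X n. ext (p1 n) (p2 n))" unfolding ext_def by (intro recursive_intros)
  then show ?thesis using assms by (rule decidable_comp2)
qed

lemma semidecidable_candidate:
  assumes L: "computable_language L" and "recursive (\<lambda>X n. e n)" "recursive (\<lambda>X n. f n)"
  shows "semidecidable (\<lambda>n. candidate \<Phi> L (set_decode (e n)) (f n))"
  unfolding candidate_def by (intro semidecidable_forced L assms recursive_intros)

lemma semidecidable_refuted:
  assumes L: "computable_language L"
    and "recursive (\<lambda>X n. e n)" "recursive (\<lambda>X n. s n)" "recursive (\<lambda>X n. f n)"
  shows "semidecidable (\<lambda>n. refuted \<Phi> L (set_decode (e n)) (s n) (f n))"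
proof -
  have "semidecidable (\<lambda>n. refuted \<Phi> L (set_decode (p1 n)) (p1 (p2 n)) (p2 (p2 n)))"
    unfolding refuted_def
    by (intro semidecidable_conj semidecidable_candidate L semidecidable_ex semidecidable_forced
        semidecidable_decidable decidable_ext recursive_intros)
  then show ?thesis using assms(2-4)
    by (rule semidecidable_comp3[where P = "\<lambda>e s f. refuted \<Phi> L (set_decode e) s f"])
qed

text \<open>\<open>c\<close> is read as (side, ((n, F), code of a rational)), where (n, F) is a
  point. All conditions are positive in \<open>E\<close>. The members of \<open>set_decode F\<close>
  are below \<open>F\<close>, so the quantifier over them can be given an explicit bound.\<close>

definition present :: "prog \<Rightarrow> language \<Rightarrow> nat set \<Rightarrow> nat \<Rightarrow> bool" where
  "present \<Phi> L E c \<longleftrightarrow> p1 c \<le> 1 \<and> canon (p2 (p2 c)) \<and> candidate \<Phi> L E (p1 (p1 (p2 c))) \<and>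
     (\<forall>k<p2 (p1 (p2 c)). k \<in> set_decode (p2 (p1 (p2 c))) \<longrightarrow>
        k < p1 (p1 (p2 c)) \<and> refuted \<Phi> L E (p1 c) k)"

lemma set_decode_less: "k \<in> set_decode F \<Longrightarrow> k < F"
proof -
  assume "k \<in> set_decode F"
  then have "set_decode (2 ^ k) \<subseteq> set_decode F"
    using set_encode_insert[of "{}" k] set_encode_inverse[of "{k}"] by simp
  then have "2 ^ k \<le> F" by (rule subset_decode_imp_le)
  then show "k < F" using less_exp[of k] by linarith
qed

lemma present_sides:
  "{c. present \<Phi> L E c} = sides (rays (points {n. candidate \<Phi> L E n} {n. refuted \<Phi> L E 0 n}))
     (rays (points {n. candidate \<Phi> L E n} {n. refuted \<Phi> L E 1 n}))"
proof (rule set_eqI)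
  fix c
  let ?F = "set_decode (p2 (p1 (p2 c)))" and ?n = "p1 (p1 (p2 c))"
  have "(\<forall>k<p2 (p1 (p2 c)). k \<in> ?F \<longrightarrow> k < ?n \<and> refuted \<Phi> L E (p1 c) k) \<longleftrightarrow>
      (\<forall>k\<in>?F. k < ?n \<and> refuted \<Phi> L E (p1 c) k)"
    using set_decode_less by blast
  moreover have "p1 c \<le> 1 \<longleftrightarrow> p1 c = 0 \<or> p1 c = 1" by linarith
  ultimately show "c \<in> {c. present \<Phi> L E c} \<longleftrightarrow> c \<in> sides
      (rays (points {n. candidate \<Phi> L E n} {n. refuted \<Phi> L E 0 n}))
      (rays (points {n. candidate \<Phi> L E n} {n. refuted \<Phi> L E 1 n}))"
    unfolding present_def sides_def rays_def points_def mem_Collect_eq by metis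
qed

lemma semidecidable_present:
  assumes L: "computable_language L" and "recursive (\<lambda>X n. e n)" "recursive (\<lambda>X n. c n)"
  shows "semidecidable (\<lambda>n. present \<Phi> L (set_decode (e n)) (c n))"
proof -
  have d: "semidecidable (\<lambda>n. p1 (p2 n) \<le> 1 \<and> canon (p2 (p2 (p2 n))))"
    by (intro semidecidable_decidable recursive_intros)
  have r: "semidecidable (\<lambda>n. p2 n < p1 (p1 (p2 (p2 (p1 n)))) \<and>
      refuted \<Phi> L (set_decode (p1 (p1 n))) (p1 (p2 (p1 n))) (p2 n))"
    by (intro semidecidable_conj semidecidable_refuted L) (intro semidecidable_decidable recursive_intros)+
  have i: "decidable (\<lambda>X n. p2 n \<in> set_decode (p2 (p1 (p2 (p2 (p1 n))))))"
    by (intro recursive_intros)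
  have b: "recursive (\<lambda>X n. p2 (p1 (p2 (p2 n))))" by (intro recursive_intros)
  have c: "semidecidable (\<lambda>n. candidate \<Phi> L (set_decode (p1 n)) (p1 (p1 (p2 (p2 n)))))"
    by (intro semidecidable_candidate L recursive_intros)
  have "semidecidable (\<lambda>n. (p1 (p2 n) \<le> 1 \<and> canon (p2 (p2 (p2 n)))) \<and>
      candidate \<Phi> L (set_decode (p1 n)) (p1 (p1 (p2 (p2 n)))) \<and>
      (\<forall>k<p2 (p1 (p2 (p2 n))). k \<in> set_decode (p2 (p1 (p2 (p2 n)))) \<longrightarrow>
        k < p1 (p1 (p2 (p2 n))) \<and> refuted \<Phi> L (set_decode (p1 n)) (p1 (p2 n)) k))"
    by (rule semidecidable_conj[OF d semidecidable_conj[OF c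
          semidecidable_all_less[OF semidecidable_imp[OF i r] b]]])
  then have "semidecidable (\<lambda>n. present \<Phi> L (set_decode (p1 n)) (p2 n))"
    unfolding present_def conj_assoc .
  then show ?thesis using assms(2,3)
    by (rule semidecidable_comp2[where P = "\<lambda>e c. present \<Phi> L (set_decode e) c"])
qed

lemma decidable_pless: "decidable (\<lambda>X n. pless (p1 n) (p2 n))"
proof -
  have "recursive (\<lambda>X n. digit (p1 n) (p2 n))" unfolding digit_def by (intro recursive_intros)
  then have digit: "recursive (\<lambda>X n. digit (a X n) (b X n))" if "recursive a" "recursive b" for a b
    using that by (rule recursive_comp2)
  show ?thesis unfolding pless_def by (intro recursive_intros digit)
qed

section \<open>Monotonicity and finite use\<close>

lemma candidate_mono: "E \<subseteq> E' \<Longrightarrow> candidate \<Phi> L E n \<Longrightarrow> candidate \<Phi> L E' n"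
  unfolding candidate_def by (rule forced_mono)

lemma refuted_mono: "E \<subseteq> E' \<Longrightarrow> refuted \<Phi> L E \<sigma> n \<Longrightarrow> refuted \<Phi> L E' \<sigma> n"
  unfolding refuted_def using candidate_mono[of E E'] forced_mono[of E E'] by blast

lemma present_mono: "E \<subseteq> E' \<Longrightarrow> present \<Phi> L E c \<Longrightarrow> present \<Phi> L E' c"
  unfolding present_def using candidate_mono[of E E'] refuted_mono[of E E'] by blast

lemma candidate_finite:
  assumes "candidate \<Phi> L E n" shows "\<exists>E'. finite E' \<and> E' \<subseteq> E \<and> candidate \<Phi> L E' n"
  using assms unfolding candidate_def by (rule forced_finite)

lemma refuted_finite:
  assumes "refuted \<Phi> L E \<sigma> n" shows "\<exists>E'. finite E' \<and> E' \<subseteq> E \<and> refuted \<Phi> L E' \<sigma> n"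
proof -
  obtain h y where *: "candidate \<Phi> L E n" "ext (p1 n) h" "forced \<Phi> L E h (ltsc \<sigma> y (p1 (p2 n)))"
    using assms unfolding refuted_def by blast
  obtain E1 where E1: "finite E1" "E1 \<subseteq> E" "candidate \<Phi> L E1 n"
    using candidate_finite[OF *(1)] by blast
  obtain E2 where E2: "finite E2" "E2 \<subseteq> E" "forced \<Phi> L E2 h (ltsc \<sigma> y (p1 (p2 n)))"
    using forced_finite[OF *(3)] by blast
  have "candidate \<Phi> L (E1 \<union> E2) n" by (rule candidate_mono[OF _ E1(3)]) blast
  moreover have "forced \<Phi> L (E1 \<union> E2) h (ltsc \<sigma> y (p1 (p2 n)))" by (rule forced_mono[OF _ E2(3)]) blast
  ultimately have "refuted \<Phi> L (E1 \<union> E2) \<sigma> n" using *(2) unfolding refuted_def by blast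
  then show ?thesis using E1(1,2) E2(1,2) by (intro exI[of _ "E1 \<union> E2"]) simp
qed

text \<open>A point names finitely many refuted candidates, so the union of the evidence for its
  candidate and for these refutations is still finite.\<close>

lemma present_finite:
  assumes "present \<Phi> L E c" shows "\<exists>E'. finite E' \<and> E' \<subseteq> E \<and> present \<Phi> L E' c"
proof -
  define K where "K = set_decode (p2 (p1 (p2 c)))"
  have c: "p1 c \<le> 1" "canon (p2 (p2 c))" "candidate \<Phi> L E (p1 (p1 (p2 c)))"
    "\<And>k. k < p2 (p1 (p2 c)) \<Longrightarrow> k \<in> K \<Longrightarrow> k < p1 (p1 (p2 c)) \<and> refuted \<Phi> L E (p1 c) k"
    using assms unfolding present_def K_def by blast+
  obtain E1 where E1: "finite E1" "E1 \<subseteq> E" "candidate \<Phi> L E1 (p1 (p1 (p2 c)))"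
    using candidate_finite[OF c(3)] by blast
  have "\<forall>k\<in>K. \<exists>E'. finite E' \<and> E' \<subseteq> E \<and> refuted \<Phi> L E' (p1 c) k"
  proof
    fix k assume k: "k \<in> K"
    then have "k < p2 (p1 (p2 c))" unfolding K_def by (rule set_decode_less)
    then have "refuted \<Phi> L E (p1 c) k" using c(4) k by blast
    then show "\<exists>E'. finite E' \<and> E' \<subseteq> E \<and> refuted \<Phi> L E' (p1 c) k" by (rule refuted_finite)
  qed
  from bchoice[OF this] obtain f where f: "\<And>k. k \<in> K \<Longrightarrow> finite (f k) \<and> f k \<subseteq> E \<and> refuted \<Phi> L (f k) (p1 c) k" by blast
  define E' where "E' = E1 \<union> (\<Union>k\<in>K. f k)"
  have "candidate \<Phi> L E' (p1 (p1 (p2 c)))" by (rule candidate_mono[OF _ E1(3)]) (simp add: E'_def)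
  moreover have "refuted \<Phi> L E' (p1 c) k" if k: "k \<in> K" for k
    by (rule refuted_mono[of "f k"]) (use f[OF k] k in \<open>auto simp: E'_def\<close>)
  ultimately have "present \<Phi> L E' c" using c unfolding present_def K_def by blast
  moreover have "finite K" by (simp add: K_def)
  then have "finite E'" using E1(1) f by (simp add: E'_def)
  moreover have "E' \<subseteq> E" using E1(2) f unfolding E'_def by blast
  ultimately show ?thesis by blast
qed

text \<open>The operator outputs the diagrams of all orders obtained from finite sets of evidence.
  Since \<open>oless pless pless\<close> is fixed and only the universe depends on the evidence,
  negative sentences, too, stay true when evidence is added.\<close>

definition gamma :: "prog \<Rightarrow> language \<Rightarrow> operator" where
  "gamma \<Phi> L = {(\<alpha>, \<phi>). finite \<alpha> \<and> (\<forall>\<psi>\<in>\<alpha>. basic_in L \<psi>) \<and>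
     \<phi> \<in> diagram order_lang (ord {c. present \<Phi> L (code_basic ` \<alpha>) c} (oless pless pless))}"

lemma diagram_ord_iff:
  "\<phi> \<in> diagram order_lang (ord W r) \<longleftrightarrow> (\<exists>a b. order_code W r (code_basic \<phi>) a b)"
  using code_diagram_order[of "ord W r"] inj_image_mem_iff[OF inj_code_basic, of \<phi>]
  unfolding ord_simps by blast

lemma order_code_subset: "order_code W r n a b \<Longrightarrow> a \<in> V \<Longrightarrow> b \<in> V \<Longrightarrow> order_code V r n a b"
  by (simp add: order_code_def)

text \<open>One inclusion is monotonicity of \<open>present\<close>. For the other, a sentence
  mentions only two constants, whose presence has finite evidence, and its truth does not depend on
  the evidence.\<close>

lemma apply_gamma:
  "apply_operator (gamma \<Phi> L) L S = diagram order_lang (ord {c. present \<Phi> L (dcode L S) c} (oless pless pless))"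
proof (intro set_eqI iffI)
  fix \<phi> assume "\<phi> \<in> apply_operator (gamma \<Phi> L) L S"
  then obtain \<alpha> where \<alpha>: "(\<alpha>, \<phi>) \<in> gamma \<Phi> L" "\<alpha> \<subseteq> diagram L S"
    unfolding apply_operator_def by blast
  then obtain a b where ab: "order_code {c. present \<Phi> L (code_basic ` \<alpha>) c} (oless pless pless) (code_basic \<phi>) a b"
    unfolding gamma_def mem_Collect_eq split diagram_ord_iff by blast
  have "code_basic ` \<alpha> \<subseteq> dcode L S" using \<alpha>(2) by blast
  then have mono: "present \<Phi> L (code_basic ` \<alpha>) c \<Longrightarrow> present \<Phi> L (dcode L S) c" for c
    by (rule present_mono)
  have "order_code {c. present \<Phi> L (dcode L S) c} (oless pless pless) (code_basic \<phi>) a b"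
    using ab mono by (intro order_code_subset[OF ab]) (simp_all add: order_code_def)
  then show "\<phi> \<in> diagram order_lang (ord {c. present \<Phi> L (dcode L S) c} (oless pless pless))"
    unfolding diagram_ord_iff by blast
next
  fix \<phi> assume "\<phi> \<in> diagram order_lang (ord {c. present \<Phi> L (dcode L S) c} (oless pless pless))"
  then obtain a b where ab: "order_code {c. present \<Phi> L (dcode L S) c} (oless pless pless) (code_basic \<phi>) a b"
    unfolding diagram_ord_iff by blast
  then have "present \<Phi> L (dcode L S) a" "present \<Phi> L (dcode L S) b" by (simp_all add: order_code_def)
  then obtain Ea Eb where E: "finite Ea" "Ea \<subseteq> dcode L S" "present \<Phi> L Ea a"
      "finite Eb" "Eb \<subseteq> dcode L S" "present \<Phi> L Eb b"
    using present_finite by metis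
  have "finite (Ea \<union> Eb)" "Ea \<union> Eb \<subseteq> dcode L S" using E by simp_all
  then obtain \<alpha> where \<alpha>: "\<alpha> \<subseteq> diagram L S" "finite \<alpha>" "Ea \<union> Eb = code_basic ` \<alpha>"
    using finite_subset_image by metis
  have "present \<Phi> L (code_basic ` \<alpha>) a" by (rule present_mono[OF _ E(3)]) (use \<alpha>(3) in blast)
  moreover have "present \<Phi> L (code_basic ` \<alpha>) b" by (rule present_mono[OF _ E(6)]) (use \<alpha>(3) in blast)
  ultimately have "order_code {c. present \<Phi> L (code_basic ` \<alpha>) c} (oless pless pless) (code_basic \<phi>) a b"
    by (intro order_code_subset[OF ab]) simp_all
  moreover have "\<forall>\<psi>\<in>\<alpha>. basic_in L \<psi>" using \<alpha>(1) by (auto simp: diagram_def)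
  ultimately have "(\<alpha>, \<phi>) \<in> gamma \<Phi> L" using \<alpha>(2) unfolding gamma_def mem_Collect_eq split diagram_ord_iff by blast
  then show "\<phi> \<in> apply_operator (gamma \<Phi> L) L S" using \<alpha>(1) unfolding apply_operator_def by blast
qed

text \<open>The axioms in purely numerical form, with finite sets given by their codes, so that the
  rules for \<open>semidecidable\<close> apply.\<close>

lemma code_axiom_gamma:
  "code_axiom ` gamma \<Phi> L = {m. (\<forall>x<p1 m. x \<in> set_decode (p1 m) \<longrightarrow> bval L x) \<and>
     (\<exists>a b. order_code {c. present \<Phi> L (set_decode (p1 m)) c} (oless pless pless) (p2 m) a b)}"
proof (intro set_eqI iffI)
  fix m assume "m \<in> code_axiom ` gamma \<Phi> L"
  then obtain \<alpha> \<phi> where g: "(\<alpha>, \<phi>) \<in> gamma \<Phi> L" and m: "m = prod_encode (set_encode (code_basic ` \<alpha>), code_basic \<phi>)"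
    unfolding code_axiom_def by auto
  have \<alpha>: "finite \<alpha>" "\<forall>\<psi>\<in>\<alpha>. basic_in L \<psi>"
    and \<phi>: "\<exists>a b. order_code {c. present \<Phi> L (code_basic ` \<alpha>) c} (oless pless pless) (code_basic \<phi>) a b"
    using g unfolding gamma_def mem_Collect_eq split diagram_ord_iff by blast+
  have dec: "set_decode (p1 m) = code_basic ` \<alpha>" "p2 m = code_basic \<phi>" using \<alpha>(1) by (simp_all add: m)
  have "\<forall>x<p1 m. x \<in> set_decode (p1 m) \<longrightarrow> bval L x"
    unfolding dec using \<alpha>(2) bval_code_basic by blast
  then show "m \<in> {m. (\<forall>x<p1 m. x \<in> set_decode (p1 m) \<longrightarrow> bval L x) \<and>
     (\<exists>a b. order_code {c. present \<Phi> L (set_decode (p1 m)) c} (oless pless pless) (p2 m) a b)}"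
    using \<phi> unfolding mem_Collect_eq dec by blast
next
  fix m assume "m \<in> {m. (\<forall>x<p1 m. x \<in> set_decode (p1 m) \<longrightarrow> bval L x) \<and>
     (\<exists>a b. order_code {c. present \<Phi> L (set_decode (p1 m)) c} (oless pless pless) (p2 m) a b)}"
  then have val: "\<And>x. x \<in> set_decode (p1 m) \<Longrightarrow> bval L x"
    and ex: "\<exists>a b. order_code {c. present \<Phi> L (set_decode (p1 m)) c} (oless pless pless) (p2 m) a b"
    using set_decode_less by blast+
  have "set_decode (p1 m) \<subseteq> code_basic ` {\<psi>. basic_in L \<psi>}" using val bval_ex by blast
  then obtain \<alpha> where \<alpha>: "\<alpha> \<subseteq> {\<psi>. basic_in L \<psi>}" "finite \<alpha>" "set_decode (p1 m) = code_basic ` \<alpha>"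
    using finite_subset_image finite_set_decode by metis
  have "p2 m \<in> dcode order_lang (ord {c. present \<Phi> L (set_decode (p1 m)) c} (oless pless pless))"
    unfolding code_diagram_order ord_simps using ex by blast
  then obtain \<phi> where \<phi>: "p2 m = code_basic \<phi>" "\<phi> \<in> diagram order_lang (ord {c. present \<Phi> L (set_decode (p1 m)) c} (oless pless pless))"
    by blast
  have "(\<alpha>, \<phi>) \<in> gamma \<Phi> L" using \<alpha>(1,2) \<phi>(2) unfolding gamma_def \<alpha>(3) by blast
  moreover have "prod_encode (set_encode (code_basic ` \<alpha>), code_basic \<phi>) = prod_encode (p1 m, p2 m)"
    unfolding \<alpha>(3)[symmetric] \<phi>(1) by simp
  then have "code_axiom (\<alpha>, \<phi>) = m" by (simp add: code_axiom_def)
  ultimately show "m \<in> code_axiom ` gamma \<Phi> L" by blast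
qed

lemma enumeration_operator_gamma:
  assumes L: "computable_language L" shows "enumeration_operator L order_lang (gamma \<Phi> L)"
proof -
  have v: "semidecidable (\<lambda>m. \<forall>x<p1 m. x \<in> set_decode (p1 m) \<longrightarrow> bval L x)"
    by (intro semidecidable_decidable recursive_intros decidable_bval[OF L])
  have pa: "semidecidable (\<lambda>m. present \<Phi> L (set_decode (p1 (p1 (p1 m)))) (p2 (p1 m)))"
    and pb: "semidecidable (\<lambda>m. present \<Phi> L (set_decode (p1 (p1 (p1 m)))) (p2 m))"
    by (intro semidecidable_present L recursive_intros)+
  have d: "semidecidable (\<lambda>m. p2 (p1 (p1 m)) = eqc (p2 (p1 m)) (p2 m) \<and> p2 (p1 m) = p2 m \<or>
      p2 (p1 (p1 m)) = nec (p2 (p1 m)) (p2 m) \<and> p2 (p1 m) \<noteq> p2 m \<or>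
      p2 (p1 (p1 m)) = ltc (p2 (p1 m)) (p2 m) \<and> oless pless pless (p2 (p1 m)) (p2 m) \<or>
      p2 (p1 (p1 m)) = nlc (p2 (p1 m)) (p2 m) \<and> \<not> oless pless pless (p2 (p1 m)) (p2 m))"
    by (intro semidecidable_decidable recursive_intros decidable_oless decidable_pless)
  have "semidecidable (\<lambda>m. \<exists>a b. order_code {c. present \<Phi> L (set_decode (p1 m)) c} (oless pless pless) (p2 m) a b)"
    unfolding order_code_def mem_Collect_eq
    by (rule semidecidable_ex, rule semidecidable_ex, rule semidecidable_conj[OF pa semidecidable_conj[OF pb d]])
  from semidecidable_ce_set[OF semidecidable_conj[OF v this]]
  have "ce_set (code_axiom ` gamma \<Phi> L)" unfolding code_axiom_gamma .
  moreover have "finite \<alpha> \<and> (\<forall>\<psi>\<in>\<alpha>. basic_in L \<psi>) \<and> basic_in order_lang \<phi>" if "(\<alpha>, \<phi>) \<in> gamma \<Phi> L" for \<alpha> \<phi>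
    using that unfolding gamma_def diagram_def by blast
  ultimately show ?thesis unfolding enumeration_operator_def by blast
qed

text \<open>In the direction \<open>\<sigma>\<close> all images have a least element and some
  candidate survives. In the opposite direction \<open>\<tau>\<close> every candidate is refuted, so
  the two sets of numbers coincide and \<open>points_no_least\<close> applies.\<close>

lemma points_candidates:
  assumes S: "is_structure L S"
    and img: "\<And>S'. is_structure L S' \<Longrightarrow> isomorphic L S' S \<Longrightarrow>
      \<exists>T. turing_image \<Phi> L order_lang S' T \<and> type_omega (universe T) (lts \<sigma> T)"
    and \<tau>: "\<And>T. lts \<tau> T = (lts \<sigma> T)\<inverse>\<inverse>"
  defines "P \<equiv> {n. candidate \<Phi> L (dcode L S) n}" and "R \<equiv> \<lambda>\<sigma>. {n. refuted \<Phi> L (dcode L S) \<sigma> n}"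
  shows "has_least (points P (R \<sigma>)) pless" "unbounded (points P (R \<tau>)) pless\<inverse>\<inverse>"
proof -
  have sub: "R \<rho> \<subseteq> P" for \<rho> unfolding R_def P_def refuted_def by blast
  have ne: "universe T \<noteq> {}" if "type_omega (universe T) (lts \<sigma> T)" for T using that by (auto simp: type_omega_def)
  have "\<exists>T. turing_image \<Phi> L order_lang S' T \<and> linear_on (universe T) (lts \<sigma> T) \<and> has_least (universe T) (lts \<sigma> T)"
    if "is_structure L S'" "isomorphic L S' S" for S'
    using img[OF that] type_omega_ends(1,2) by blast
  then have "\<exists>n. candidate \<Phi> L (dcode L S) n \<and> \<not> refuted \<Phi> L (dcode L S) \<sigma> n" by (rule unrefuted_ex[OF S])
  then show "has_least (points P (R \<sigma>)) pless"
    using sub by (intro points_least) (auto simp: P_def R_def)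
  have "\<exists>T. turing_image \<Phi> L order_lang S' T \<and> unbounded (universe T) (lts \<tau> T)\<inverse>\<inverse>"
    if "is_structure L S'" "isomorphic L S' S" for S'
    using img[OF that] type_omega_ends(3) unfolding \<tau> conversep_conversep by blast
  then have "refuted \<Phi> L (dcode L S) \<tau> n" if "candidate \<Phi> L (dcode L S) n" for n
    using all_refuted[OF S _ that] by blast
  then have R: "R \<tau> = P" using sub[of \<tau>] unfolding R_def P_def by blast
  have "\<exists>T. turing_image \<Phi> L order_lang S' T \<and> universe T \<noteq> {}"
    if "is_structure L S'" "isomorphic L S' S" for S'
    using img[OF that] ne by blast
  then have "\<exists>n\<ge>N. n \<in> P" for N using candidate_ex[OF S, of \<Phi> N] by (simp add: P_def)
  then show "unbounded (points P (R \<tau>)) pless\<inverse>\<inverse>" unfolding R by (rule points_no_least)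
qed

lemma type_1eta_present:
  assumes S: "is_structure L S"
    and img: "\<And>S'. is_structure L S' \<Longrightarrow> isomorphic L S' S \<Longrightarrow>
      \<exists>T. turing_image \<Phi> L order_lang S' T \<and> type_omega (universe T) (lt T)"
  shows "type_1eta {c. present \<Phi> L (dcode L S) c} (oless pless pless)"
  unfolding present_sides
proof (intro type_1eta_sides linear_on_points)
  have lts: "lts 0 T = lt T" "lts 1 T = (lts 0 T)\<inverse>\<inverse>" for T by (simp_all add: lts_def)
  note * = points_candidates[OF S img[folded lts(1)] lts(2)]
  show "has_least (points {n. candidate \<Phi> L (dcode L S) n} {n. refuted \<Phi> L (dcode L S) 0 n}) pless"
    by (rule *(1))
  show "unbounded (points {n. candidate \<Phi> L (dcode L S) n} {n. refuted \<Phi> L (dcode L S) 1 n}) pless\<inverse>\<inverse>"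
    by (rule *(2))
qed

lemma type_1eta_present_conversep:
  assumes S: "is_structure L S"
    and img: "\<And>S'. is_structure L S' \<Longrightarrow> isomorphic L S' S \<Longrightarrow>
      \<exists>T. turing_image \<Phi> L order_lang S' T \<and> type_omega (universe T) (lt T)\<inverse>\<inverse>"
  shows "type_1eta {c. present \<Phi> L (dcode L S) c} (oless pless pless)\<inverse>\<inverse>"
  unfolding present_sides
proof (intro type_1eta_sides_conversep linear_on_points)
  have lts: "lts 1 T = (lt T)\<inverse>\<inverse>" "lts 0 T = (lts 1 T)\<inverse>\<inverse>" for T by (simp_all add: lts_def)
  note * = points_candidates[OF S img[folded lts(1)] lts(2)]
  show "has_least (points {n. candidate \<Phi> L (dcode L S) n} {n. refuted \<Phi> L (dcode L S) 1 n}) pless"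
    by (rule *(1))
  show "unbounded (points {n. candidate \<Phi> L (dcode L S) n} {n. refuted \<Phi> L (dcode L S) 0 n}) pless\<inverse>\<inverse>"
    by (rule *(2))
qed

lemma c_reducible_eta:
  assumes L: "computable_language L" and A: "is_structure L A" and B: "is_structure L B"
    and AB: "\<not> isomorphic L A B" and tc: "tc_reducible L A B order_lang omega omega_star"
  shows "c_reducible L A B order_lang one_plus_eta eta_plus_one"
proof -
  obtain \<Phi> TA TB where emb: "embedding L (pair_class L A B) order_lang (pair_class order_lang omega omega_star)
        (turing_image \<Phi> L order_lang)"
    and TA: "is_structure order_lang TA" "isomorphic order_lang TA omega" "turing_image \<Phi> L order_lang A TA"
    and TB: "is_structure order_lang TB" "isomorphic order_lang TB omega_star" "turing_image \<Phi> L order_lang B TB"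
    using tc unfolding tc_reducible_def turing_embedding_def by blast
  have cls: "A \<in> pair_class L A B" "B \<in> pair_class L A B"
    "TA \<in> pair_class order_lang omega omega_star" "TB \<in> pair_class order_lang omega omega_star"
    using A B TA(1,2) TB(1,2) isomorphic_refl unfolding pair_class_def by blast+
  \<comment> \<open>The embedding only places an image in the class of the pair; preservation of
    isomorphism, compared with the given image of \<open>C\<close>, selects the member.\<close>
  have image: "\<exists>T. turing_image \<Phi> L order_lang S T \<and> isomorphic order_lang T TC"
    if S: "S \<in> pair_class L A B" and C: "C \<in> pair_class L A B" "TC \<in> pair_class order_lang omega omega_star"
      "turing_image \<Phi> L order_lang C TC" "isomorphic L S C" for S C TC
  proof -
    obtain T where T: "T \<in> pair_class order_lang omega omega_star" "turing_image \<Phi> L order_lang S T"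
      using emb S unfolding embedding_def by blast
    then have "isomorphic L S C \<longleftrightarrow> isomorphic order_lang T TC"
      using emb S C(1-3) unfolding embedding_def by blast
    then show ?thesis using T(2) C(4) by blast
  qed
  have imgA: "\<exists>T. turing_image \<Phi> L order_lang S T \<and> type_omega (universe T) (lt T)"
    if S: "is_structure L S" "isomorphic L S A" for S
  proof -
    have "S \<in> pair_class L A B" using S unfolding pair_class_def by blast
    then obtain T where T: "turing_image \<Phi> L order_lang S T" "isomorphic order_lang T TA"
      using image[OF _ cls(1,3) TA(3) S(2)] by blast
    then have "isomorphic order_lang T omega" using isomorphic_trans TA(2) by blast
    then show ?thesis using T(1) unfolding isomorphic_omega by blast
  qed
  have imgB: "\<exists>T. turing_image \<Phi> L order_lang S T \<and> type_omega (universe T) (lt T)\<inverse>\<inverse>"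
    if S: "is_structure L S" "isomorphic L S B" for S
  proof -
    have "S \<in> pair_class L A B" using S unfolding pair_class_def by blast
    then obtain T where T: "turing_image \<Phi> L order_lang S T" "isomorphic order_lang T TB"
      using image[OF _ cls(2,4) TB(3) S(2)] by blast
    then have "isomorphic order_lang T omega_star" using isomorphic_trans TB(2) by blast
    then show ?thesis using T(1) unfolding isomorphic_omega_star by blast
  qed
  let ?T = "\<lambda>S. ord {c. present \<Phi> L (dcode L S) c} (oless pless pless)"
  let ?F = "enum_image (gamma \<Phi> L) L order_lang"
  have F: "?F S (?T S)" for S unfolding enum_image_def by (rule apply_gamma)
  have gA: "\<exists>T. is_structure order_lang T \<and> isomorphic order_lang T one_plus_eta \<and> ?F S T"
    if S: "is_structure L S" "isomorphic L S A" for S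
  proof -
    have "type_1eta {c. present \<Phi> L (dcode L S) c} (oless pless pless)"
      by (rule type_1eta_present[OF S(1)]) (rule imgA, assumption, rule isomorphic_trans[OF _ S(2)])
    note ty = this
    show ?thesis using F[of S] ty type_1eta_nonempty[OF ty]
      by (intro exI[of _ "?T S"]) (simp add: is_structure_order isomorphic_one_plus_eta)
  qed
  have gB: "\<exists>T. is_structure order_lang T \<and> isomorphic order_lang T eta_plus_one \<and> ?F S T"
    if S: "is_structure L S" "isomorphic L S B" for S
  proof -
    have "type_1eta {c. present \<Phi> L (dcode L S) c} (oless pless pless)\<inverse>\<inverse>"
      by (rule type_1eta_present_conversep[OF S(1)]) (rule imgB, assumption, rule isomorphic_trans[OF _ S(2)])
    note ty = this
    show ?thesis using F[of S] ty type_1eta_nonempty[OF ty]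
      by (intro exI[of _ "?T S"]) (simp add: is_structure_order isomorphic_eta_plus_one)
  qed
  have "embedding L (pair_class L A B) order_lang (pair_class order_lang one_plus_eta eta_plus_one) ?F"
  proof (rule embedding_pairI[OF A B AB not_isomorphic_eta is_structure_orders(3)])
    show "\<And>S T T'. ?F S T \<Longrightarrow> ?F S T' \<Longrightarrow> diagram order_lang T = diagram order_lang T'"
      unfolding enum_image_def by (rule trans[OF sym])
  qed (rule gA gB; assumption)+
  then have "computable_embedding L (pair_class L A B) order_lang
      (pair_class order_lang one_plus_eta eta_plus_one) (gamma \<Phi> L)"
    unfolding computable_embedding_def using enumeration_operator_gamma[OF L] by blast
  then show ?thesis
    unfolding c_reducible_def using gA[OF A isomorphic_refl] gB[OF B isomorphic_refl] by blast
qed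

theorem theorem4p12:
  shows "tc_equivalent order_lang one_plus_eta eta_plus_one order_lang omega omega_star \<and>
    (\<forall>L A B. computable_language L \<longrightarrow> is_structure L A \<longrightarrow> is_structure L B \<longrightarrow>
       \<not> isomorphic L A B \<longrightarrow>
       tc_equivalent L A B order_lang omega omega_star \<longrightarrow>
       c_reducible L A B order_lang one_plus_eta eta_plus_one)"
  unfolding tc_equivalent_def
  using tc_reducible_eta_omega tc_reducible_omega_eta c_reducible_eta by blast

end
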